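(* Let $\{S(t)\}_{t\ge 0}$ denote the continuous semigroup on $L^2(\mathbb{R})$ generated by the differential operator $A=\partial_x^2-\partial_x^3$ with domain $H^3(\mathbb{R})$. Let $T,\varepsilon$ be positive numbers such that $\varepsilon<\frac{T}{2}$. Let $u_0,u_T\in L^2(\mathbb{R})$. Then there exists a function $$u\in L^2_{loc}(\mathbb{R}^2)\cap C([0,\varepsilon],L^2(\mathbb{R}))\cap C([T-\varepsilon,T],L^2(\mathbb{R}))$$ which solves $$\begin{cases} u_t-u_{xx}+u_{xxx}=0 & \text{in } \mathcal{D}'(\mathbb{R}\times(0,T)),\\ u(x,0)=u_0(x) & \text{in } \mathbb{R},\\ u(x,T)=S(T)u_T(x) & \text{in } \mathbb{R}.\end{cases}$$
   Context: $x\in\mathbb{R}$ is the space variable and $t$ the time variable; functions are real valued. Membership of $u$ in $C([a,b],L^2(\mathbb{R}))$ means that the restriction of $u$ to times $t\in[a,b]$ is (represented by) a continuous function of $t$ with values in $L^2(\mathbb{R})$; the conditions at $t=0$ and $t=T$ are understood through these continuous representatives. $\mathcal{D}'(\mathbb{R}\times(0,T))$ is the space of distributions on $\mathbb{R}\times(0,T)$. *)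

theory Defs
  imports "HOL-Analysis.Analysis"
begin

text \<open>
  Elements of \<open>L\<^sup>2\<close> are represented by Lebesgue measurable real functions; identities in
  \<open>L\<^sup>2\<close> are identities almost everywhere.
\<close>

definition L2 :: "('a::euclidean_space \<Rightarrow> real) set" where
  "L2 = {f. f \<in> borel_measurable lebesgue \<and> integrable lebesgue (\<lambda>x. (f x)\<^sup>2)}"

definition L2_norm :: "('a::euclidean_space \<Rightarrow> real) \<Rightarrow> real" where
  "L2_norm f = sqrt (integral\<^sup>L lebesgue (\<lambda>x. (f x)\<^sup>2))"

definition L2_loc :: "('a::euclidean_space \<Rightarrow> real) set" where
  "L2_loc = {f. f \<in> borel_measurable lebesgue \<and>
     (\<forall>K. compact K \<longrightarrow> set_integrable lebesgue K (\<lambda>x. (f x)\<^sup>2))}"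

definition eq_ae :: "('a::euclidean_space \<Rightarrow> real) \<Rightarrow> ('a \<Rightarrow> real) \<Rightarrow> bool"  (infix "=\<^sub>a" 50) where
  "f =\<^sub>a g \<longleftrightarrow> (AE x in lebesgue. f x = g x)"

definition L2_continuous_on :: "real set \<Rightarrow> (real \<Rightarrow> 'a::euclidean_space \<Rightarrow> real) \<Rightarrow> bool" where
  "L2_continuous_on I v \<longleftrightarrow> (\<forall>t\<in>I. v t \<in> L2) \<and>
     (\<forall>s\<in>I. ((\<lambda>t. L2_norm (\<lambda>x. v t x - v s x)) \<longlongrightarrow> 0) (at s within I))"

text \<open>
  \<open>v\<close> is the continuous representative of the restriction to times in \<open>I\<close> of the function
  \<open>u\<close> of \<open>(x, t)\<close>, that is, \<open>u\<close> belongs to \<open>C(I, L\<^sup>2)\<close> by means of \<open>v\<close>.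
\<close>

definition continuous_representative ::
    "real set \<Rightarrow> (real \<times> real \<Rightarrow> real) \<Rightarrow> (real \<Rightarrow> real \<Rightarrow> real) \<Rightarrow> bool" where
  "continuous_representative I u v \<longleftrightarrow> L2_continuous_on I v \<and>
     (AE t in lebesgue. t \<in> I \<longrightarrow> (\<lambda>x. u (x, t)) =\<^sub>a v t)"

definition partial :: "'a \<Rightarrow> ('a::euclidean_space \<Rightarrow> real) \<Rightarrow> 'a \<Rightarrow> real" where
  "partial e f x = deriv (\<lambda>h::real. f (x + h *\<^sub>R e)) 0"

fun Ck :: "nat \<Rightarrow> ('a::euclidean_space \<Rightarrow> real) \<Rightarrow> bool" where
  "Ck 0 f \<longleftrightarrow> continuous_on UNIV f"
| "Ck (Suc k) f \<longleftrightarrow> continuous_on UNIV f \<and>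
     (\<forall>e\<in>Basis. (\<forall>x. (\<lambda>h::real. f (x + h *\<^sub>R e)) differentiable (at 0)) \<and> Ck k (partial e f))"

text \<open>Test functions on \<open>\<Omega>\<close> are regarded as extended by \<open>0\<close> to the whole space.\<close>

definition test_functions :: "'a::euclidean_space set \<Rightarrow> ('a \<Rightarrow> real) set" where
  "test_functions \<Omega> = {\<phi>. (\<forall>k. Ck k \<phi>) \<and>
     compact (closure {x. \<phi> x \<noteq> 0}) \<and> closure {x. \<phi> x \<noteq> 0} \<subseteq> \<Omega>}"

text \<open>
  A distribution on \<open>\<Omega>\<close> is a functional whose values matter only on \<open>test_functions \<Omega>\<close>.
  Only regular distributions of locally integrable functions and their derivatives occur, so
  linearity and continuity hold automatically.
\<close>

type_synonym 'a distribution = "('a \<Rightarrow> real) \<Rightarrow> real"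

definition regular_distribution :: "('a::euclidean_space \<Rightarrow> real) \<Rightarrow> 'a distribution" where
  "regular_distribution f \<phi> = integral\<^sup>L lebesgue (\<lambda>x. f x * \<phi> x)"

definition distr_partial :: "'a::euclidean_space \<Rightarrow> 'a distribution \<Rightarrow> 'a distribution" where
  "distr_partial e F \<phi> = - F (partial e \<phi>)"

definition distr_eq :: "'a::euclidean_space set \<Rightarrow> 'a distribution \<Rightarrow> 'a distribution \<Rightarrow> bool" where
  "distr_eq \<Omega> F G \<longleftrightarrow> (\<forall>\<phi>\<in>test_functions \<Omega>. F \<phi> = G \<phi>)"

definition distr_deriv :: "nat \<Rightarrow> (real \<Rightarrow> real) \<Rightarrow> real distribution" where
  "distr_deriv k f = (distr_partial 1 ^^ k) (regular_distribution f)"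

definition sobolev_H :: "nat \<Rightarrow> (real \<Rightarrow> real) set" where
  "sobolev_H k = {f \<in> L2. \<forall>j\<le>k. \<exists>g\<in>L2. distr_eq UNIV (regular_distribution g) (distr_deriv j f)}"

text \<open>
  Unbounded operators on \<open>L\<^sup>2(\<real>)\<close> are given by their graphs, which are closed under
  equality almost everywhere in both components.
\<close>

definition operator_A :: "((real \<Rightarrow> real) \<times> (real \<Rightarrow> real)) set" where
  "operator_A = {(f, g). f \<in> sobolev_H 3 \<and> g \<in> L2 \<and>
     distr_eq UNIV (regular_distribution g) (\<lambda>\<phi>. distr_deriv 2 f \<phi> - distr_deriv 3 f \<phi>)}"

text \<open>
  Linearity and boundedness imply that every \<open>S t\<close> respects equality almost everywhere.
\<close>

definition bounded_linear_L2 :: "((real \<Rightarrow> real) \<Rightarrow> real \<Rightarrow> real) \<Rightarrow> bool" where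
  "bounded_linear_L2 B \<longleftrightarrow>
     (\<forall>f\<in>L2. B f \<in> L2) \<and>
     (\<forall>f\<in>L2. \<forall>g\<in>L2. B (\<lambda>x. f x + g x) =\<^sub>a (\<lambda>x. B f x + B g x)) \<and>
     (\<forall>f\<in>L2. \<forall>c. B (\<lambda>x. c * f x) =\<^sub>a (\<lambda>x. c * B f x)) \<and>
     (\<exists>K. \<forall>f\<in>L2. L2_norm (B f) \<le> K * L2_norm f)"

definition continuous_semigroup_L2 :: "(real \<Rightarrow> (real \<Rightarrow> real) \<Rightarrow> real \<Rightarrow> real) \<Rightarrow> bool" where
  "continuous_semigroup_L2 S \<longleftrightarrow>
     (\<forall>t\<ge>0. bounded_linear_L2 (S t)) \<and>
     (\<forall>f\<in>L2. S 0 f =\<^sub>a f) \<and>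
     (\<forall>s\<ge>0. \<forall>t\<ge>0. \<forall>f\<in>L2. S (s + t) f =\<^sub>a S s (S t f)) \<and>
     (\<forall>f\<in>L2. ((\<lambda>t. L2_norm (\<lambda>x. S t f x - f x)) \<longlongrightarrow> 0) (at_right 0))"

definition infinitesimal_generator ::
    "(real \<Rightarrow> (real \<Rightarrow> real) \<Rightarrow> real \<Rightarrow> real) \<Rightarrow> ((real \<Rightarrow> real) \<times> (real \<Rightarrow> real)) set" where
  "infinitesimal_generator S = {(f, g). f \<in> L2 \<and> g \<in> L2 \<and>
     ((\<lambda>h. L2_norm (\<lambda>x. (S h f x - f x) / h - g x)) \<longlongrightarrow> 0) (at_right 0)}"

text \<open>
  The equation \<open>u\<^sub>t - u\<^sub>x\<^sub>x + u\<^sub>x\<^sub>x\<^sub>x = 0\<close> for functions of \<open>(x, t)\<close>; the unit vectors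
  \<open>(1, 0)\<close> and \<open>(0, 1)\<close> are the directions of \<open>x\<close> and of \<open>t\<close>.
\<close>

definition solves_equation_in :: "(real \<times> real) set \<Rightarrow> (real \<times> real \<Rightarrow> real) \<Rightarrow> bool" where
  "solves_equation_in \<Omega> u \<longleftrightarrow>
     (let F = regular_distribution u; dx = distr_partial (1, 0); dt = distr_partial (0, 1)
      in distr_eq \<Omega> (\<lambda>\<phi>. dt F \<phi> - (dx ^^ 2) F \<phi> + (dx ^^ 3) F \<phi>) (\<lambda>\<phi>. 0))"

end

theory Submission
  imports Defs "HOL-Probability.Sinc_Integral" "HOL-Complex_Analysis.Cauchy_Integral_Formula"
    "HOL-Real_Asymp.Real_Asymp"
begin

text \<open>
  For \<open>t > 0\<close> the function \<open>S(t)f\<close> is the convolution of \<open>f\<close> with the kernel whose Fourier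
  transform is \<open>exp (- t \<xi>\<^sup>2 + \<i> t \<xi>\<^sup>3)\<close>. Hence \<open>S(t)f\<close> is entire in \<open>x\<close>, and
  its Cauchy data \<open>u, u\<^sub>x, u\<^sub>x\<^sub>x\<close> on the line \<open>x = 0\<close> are of Gevrey order two (even
  \<open>3 / 2\<close>) in \<open>t\<close>. Read as an evolution in \<open>x\<close>, the equation is
  \<open>u\<^sub>x\<^sub>x\<^sub>x = u\<^sub>x\<^sub>x - u\<^sub>t\<close>; three space derivatives cost one time derivative, so the formal
  power series solution in \<open>x\<close> converges everywhere as soon as the Cauchy data are of Gevrey order
  less than three. A Gevrey cutoff in time therefore interpolates between the Cauchy data of
  \<open>S(t)u\<^sub>0\<close> for \<open>t \<le> \<epsilon>\<close> and those of \<open>S(t)u\<^sub>T\<close> for \<open>t \<ge> T - \<epsilon>\<close>, and the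
  power series with these data is the required solution.

  That \<open>S(t)f\<close> is the convolution follows by pairing it with Gaussians, for which the adjoint
  equation is solved explicitly by the same kernels.
\<close>

section \<open>The space of square integrable functions\<close>

text \<open>All that is established about the kernel is smoothness and decay like 1/(1+|x|). This
  majorant is square integrable but not absolutely integrable, so the convolution is bounded
  pointwise by Cauchy-Schwarz, with constants that degenerate as t tends to 0. Hence the Cauchy data
  on x = 0 are Gevrey only on time intervals bounded away from 0, and square integrability of the
  solution near t = 0 is imported from the abstract semigroup; this is where the a.e. identity of
  S(t)f with the convolution enters. The diffusion and dispersion parameters \<open>p\<close> and
  \<open>s\<close> of the kernel stay independent: a Gaussian of parameter \<delta> carried by the
  adjoint flow has p = \<delta> + t and s = t, and letting \<delta> tend to 0 with s fixed removes
  the mollification. Order two replaces 3/2 because the flat function exp(-1/t), from which the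
  cutoff is built, satisfies bounds (n!)^2 and these are stable under products. The k-th Taylor
  coefficient then grows like ((k/3)!)^2, while k! dominates ((k/3)!)^3: one factorial is left to
  beat every geometric factor.\<close>

definition L2_inner :: "('a::euclidean_space \<Rightarrow> real) \<Rightarrow> ('a \<Rightarrow> real) \<Rightarrow> real" where
  "L2_inner f g = integral\<^sup>L lebesgue (\<lambda>x. f x * g x)"

lemma L2_I:
  "f \<in> borel_measurable lebesgue \<Longrightarrow> integrable lebesgue (\<lambda>x. (f x)\<^sup>2) \<Longrightarrow> f \<in> L2"
  by (simp add: L2_def)

lemma L2_measurable: "f \<in> L2 \<Longrightarrow> f \<in> borel_measurable lebesgue"
  by (simp add: L2_def)

lemma L2_square_integrable: "f \<in> L2 \<Longrightarrow> integrable lebesgue (\<lambda>x. (f x)\<^sup>2)"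
  by (simp add: L2_def)

lemma L2_mult_integrable:
  assumes "f \<in> L2" "g \<in> L2"
  shows "integrable lebesgue (\<lambda>x. f x * g x)"
proof (rule Bochner_Integration.integrable_bound)
  show "integrable lebesgue (\<lambda>x. (f x)\<^sup>2 + (g x)\<^sup>2)"
    using assms by (intro Bochner_Integration.integrable_add L2_square_integrable)
  show "(\<lambda>x. f x * g x) \<in> borel_measurable lebesgue"
    using assms[THEN L2_measurable] by measurable
  have "\<bar>a * b\<bar> \<le> a\<^sup>2 + b\<^sup>2" for a b :: real
    using sum_squares_bound[of "\<bar>a\<bar>" "\<bar>b\<bar>"] mult_nonneg_nonneg[of "\<bar>a\<bar>" "\<bar>b\<bar>"]
    unfolding abs_mult power2_abs by linarith
  then show "AE x in lebesgue. norm (f x * g x) \<le> norm ((f x)\<^sup>2 + (g x)\<^sup>2)"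
    by simp
qed

lemma L2_add:
  assumes "f \<in> L2" "g \<in> L2"
  shows "(\<lambda>x. f x + g x) \<in> L2"
proof (rule L2_I)
  show "(\<lambda>x. f x + g x) \<in> borel_measurable lebesgue"
    using assms[THEN L2_measurable] by measurable
  have "integrable lebesgue (\<lambda>x. (f x)\<^sup>2 + (g x)\<^sup>2 + 2 * (f x * g x))"
    using assms by (intro Bochner_Integration.integrable_add L2_square_integrable integrable_mult_right L2_mult_integrable)
  then show "integrable lebesgue (\<lambda>x. (f x + g x)\<^sup>2)"
    by (simp add: power2_sum mult.assoc)
qed

lemma L2_cmult: "f \<in> L2 \<Longrightarrow> (\<lambda>x. c * f x) \<in> L2"
  by (auto simp: L2_def power_mult_distrib)

lemma L2_zero: "(\<lambda>x. 0) \<in> L2"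
  by (simp add: L2_def)

lemma L2_minus: "f \<in> L2 \<Longrightarrow> (\<lambda>x. - f x) \<in> L2"
  using L2_cmult[of f "-1"] by simp

lemma L2_diff: "f \<in> L2 \<Longrightarrow> g \<in> L2 \<Longrightarrow> (\<lambda>x. f x - g x) \<in> L2"
  using L2_add[OF _ L2_minus, of f g] by simp

lemma L2_bound:
  assumes "g \<in> L2" "f \<in> borel_measurable lebesgue" "\<And>x. \<bar>f x\<bar> \<le> \<bar>g x\<bar>"
  shows "f \<in> L2"
proof (rule L2_I)
  show "integrable lebesgue (\<lambda>x. (f x)\<^sup>2)"
  proof (rule Bochner_Integration.integrable_bound[OF L2_square_integrable[OF assms(1)]])
    show "(\<lambda>x. (f x)\<^sup>2) \<in> borel_measurable lebesgue" using assms(2) by measurable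
    show "AE x in lebesgue. norm ((f x)\<^sup>2) \<le> norm ((g x)\<^sup>2)"
      using assms(3) by (auto intro!: AE_I2 simp: abs_le_square_iff)
  qed
qed (fact assms(2))

section \<open>Norm and inner product: Cauchy-Schwarz, triangle inequality, dominated
  convergence\<close>

lemma L2_norm_nonneg [simp]: "0 \<le> L2_norm f"
  by (simp add: L2_norm_def)

lemma L2_norm_square: "(L2_norm f)\<^sup>2 = integral\<^sup>L lebesgue (\<lambda>x. (f x)\<^sup>2)"
  by (simp add: L2_norm_def)

lemma L2_norm_zero [simp]: "L2_norm (\<lambda>x. 0) = 0"
  by (simp add: L2_norm_def)

lemma L2_norm_cmult: "L2_norm (\<lambda>x. c * f x) = \<bar>c\<bar> * L2_norm f"
  by (simp add: L2_norm_def power_mult_distrib real_sqrt_mult)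

lemma L2_norm_minus: "L2_norm (\<lambda>x. - f x) = L2_norm f"
  by (simp add: L2_norm_def)

lemma L2_norm_minus_commute: "L2_norm (\<lambda>x. f x - g x) = L2_norm (\<lambda>x. g x - f x)"
  by (simp add: L2_norm_def power2_commute)

lemma L2_norm_cong: "f =\<^sub>a g \<Longrightarrow> f \<in> L2 \<Longrightarrow> g \<in> L2 \<Longrightarrow> L2_norm f = L2_norm g"
  unfolding L2_norm_def eq_ae_def
  by (intro arg_cong[where f=sqrt] integral_cong_AE) (auto dest!: L2_measurable)

lemma L2_norm_mono:
  assumes "g \<in> L2" "f \<in> borel_measurable lebesgue" "\<And>x. \<bar>f x\<bar> \<le> \<bar>g x\<bar>"
  shows "L2_norm f \<le> L2_norm g"
  unfolding L2_norm_def
  using L2_square_integrable[OF L2_bound[OF assms]] L2_square_integrable[OF assms(1)] assms(3)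
  by (intro real_sqrt_le_mono integral_mono) (auto simp: abs_le_square_iff)

lemma L2_inner_cong:
  "f =\<^sub>a g \<Longrightarrow> f \<in> L2 \<Longrightarrow> g \<in> L2 \<Longrightarrow> h \<in> L2 \<Longrightarrow> L2_inner f h = L2_inner g h"
  unfolding L2_inner_def eq_ae_def
  by (intro integral_cong_AE) (auto dest!: L2_measurable)

lemma L2_inner_add_left:
  "f \<in> L2 \<Longrightarrow> g \<in> L2 \<Longrightarrow> h \<in> L2 \<Longrightarrow> L2_inner (\<lambda>x. f x + g x) h = L2_inner f h + L2_inner g h"
  unfolding L2_inner_def by (simp add: distrib_right L2_mult_integrable)

lemma L2_inner_diff_left:
  "f \<in> L2 \<Longrightarrow> g \<in> L2 \<Longrightarrow> h \<in> L2 \<Longrightarrow> L2_inner (\<lambda>x. f x - g x) h = L2_inner f h - L2_inner g h"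
  unfolding L2_inner_def by (simp add: left_diff_distrib L2_mult_integrable)

lemma L2_inner_cmult_left: "L2_inner (\<lambda>x. c * f x) h = c * L2_inner f h"
  unfolding L2_inner_def by (simp add: mult.assoc)

lemma L2_inner_commute: "L2_inner f g = L2_inner g f"
  unfolding L2_inner_def by (simp add: mult.commute)

lemma L2_inner_add_right:
  "f \<in> L2 \<Longrightarrow> g \<in> L2 \<Longrightarrow> h \<in> L2 \<Longrightarrow> L2_inner h (\<lambda>x. f x + g x) = L2_inner h f + L2_inner h g"
  using L2_inner_add_left[of f g h] by (simp add: L2_inner_commute)

lemma L2_inner_diff_right:
  "f \<in> L2 \<Longrightarrow> g \<in> L2 \<Longrightarrow> h \<in> L2 \<Longrightarrow> L2_inner h (\<lambda>x. f x - g x) = L2_inner h f - L2_inner h g"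
  using L2_inner_diff_left[of f g h] by (simp add: L2_inner_commute)

lemma L2_inner_cmult_right: "L2_inner h (\<lambda>x. c * f x) = c * L2_inner h f"
  using L2_inner_cmult_left[of c f h] by (simp add: L2_inner_commute)

lemma L2_norm_inner: "(L2_norm f)\<^sup>2 = L2_inner f f"
  unfolding L2_norm_square L2_inner_def by (simp add: power2_eq_square)

lemma L2_norm_square_add:
  assumes f: "f \<in> L2" and g: "g \<in> L2"
  shows "(L2_norm (\<lambda>x. f x + r * g x))\<^sup>2 = (L2_norm f)\<^sup>2 + 2 * r * L2_inner f g + r\<^sup>2 * (L2_norm g)\<^sup>2"
proof -
  have rg: "(\<lambda>x. r * g x) \<in> L2" using L2_cmult[OF g] .
  have "L2_inner (\<lambda>x. f x + r * g x) (\<lambda>x. f x + r * g x)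
     = (L2_inner f f + r * L2_inner g f) + (r * L2_inner f g + r * (r * L2_inner g g))"
    using L2_inner_add_left[OF f rg L2_add[OF f rg]] L2_inner_add_right[OF f rg f]
      L2_inner_add_right[OF f rg rg]
    by (simp add: L2_inner_cmult_left L2_inner_cmult_right L2_inner_commute[of g f])
  then show ?thesis
    unfolding L2_norm_inner by (simp add: L2_inner_commute[of g f] power2_eq_square algebra_simps)
qed

lemma L2_Cauchy_Schwarz:
  assumes f: "f \<in> L2" and g: "g \<in> L2"
  shows "\<bar>L2_inner f g\<bar> \<le> L2_norm f * L2_norm g"
proof -
  define b where "b = L2_inner f g"
  have q: "0 \<le> (L2_norm f)\<^sup>2 + 2 * r * b + r\<^sup>2 * (L2_norm g)\<^sup>2" for r
    using L2_norm_square_add[OF f g, of r] zero_le_power2[of "L2_norm (\<lambda>x. f x + r * g x)"]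
    unfolding b_def by linarith
  have "0 \<le> (L2_norm f)\<^sup>2 * (L2_norm g)\<^sup>2 - b\<^sup>2"
  proof (cases "L2_norm g = 0")
    case True
    have "b = 0"
    proof (rule ccontr)
      assume "b \<noteq> 0"
      \<comment> \<open>When \<open>g\<close> has norm zero the quadratic is affine in r, and this r
        gives it the value -1.\<close>
      then show False using q[of "- ((L2_norm f)\<^sup>2 + 1) / (2 * b)"] True by (simp add: field_simps)
    qed
    then show ?thesis by simp
  next
    case False
    let ?G = "(L2_norm g)\<^sup>2"
    have G: "?G > 0" using False by simp
    \<comment> \<open>r = -b/G is the minimiser of the quadratic.\<close>
    have "(L2_norm f)\<^sup>2 + 2 * (- b / ?G) * b + (- b / ?G)\<^sup>2 * ?G = (L2_norm f)\<^sup>2 - b\<^sup>2 / ?G"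
      using False by (simp add: field_simps power2_eq_square)
    then have "b\<^sup>2 / ?G \<le> (L2_norm f)\<^sup>2" using q[of "- b / ?G"] by linarith
    then show ?thesis using G by (simp add: field_simps)
  qed
  then have "b\<^sup>2 \<le> (L2_norm f * L2_norm g)\<^sup>2" by (simp add: power_mult_distrib)
  then show ?thesis unfolding b_def
    by (metis L2_norm_nonneg abs_le_square_iff abs_of_nonneg mult_nonneg_nonneg)
qed

lemma L2_norm_triangle:
  assumes f: "f \<in> L2" and g: "g \<in> L2"
  shows "L2_norm (\<lambda>x. f x + g x) \<le> L2_norm f + L2_norm g"
proof (rule power2_le_imp_le)
  have "(L2_norm (\<lambda>x. f x + g x))\<^sup>2 = (L2_norm f)\<^sup>2 + 2 * L2_inner f g + (L2_norm g)\<^sup>2"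
    using L2_norm_square_add[OF f g, of 1] by simp
  also have "\<dots> \<le> (L2_norm f + L2_norm g)\<^sup>2"
    using L2_Cauchy_Schwarz[OF f g] by (simp add: power2_sum)
  finally show "(L2_norm (\<lambda>x. f x + g x))\<^sup>2 \<le> (L2_norm f + L2_norm g)\<^sup>2" .
qed simp

lemma L2_norm_le_add_diff:
  assumes "f \<in> L2" "g \<in> L2"
  shows "L2_norm f \<le> L2_norm g + L2_norm (\<lambda>x. f x - g x)"
  using L2_norm_triangle[of g "\<lambda>x. f x - g x"] assms by (simp add: L2_diff)

lemma L2_norm_eq_0_imp:
  assumes "f \<in> L2" "L2_norm f = 0"
  shows "AE x in lebesgue. f x = 0"
proof -
  have "integral\<^sup>L lebesgue (\<lambda>x. (f x)\<^sup>2) = 0"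
    using assms(2) by (simp add: L2_norm_def)
  then have "AE x in lebesgue. (f x)\<^sup>2 = 0"
    using integral_nonneg_eq_0_iff_AE[OF L2_square_integrable[OF assms(1)]] by simp
  then show ?thesis by simp
qed

text \<open>The squares (s n - f)^2 are dominated by (2g)^2, which reduces convergence in norm to
  scalar dominated convergence. The bound by \<open>g\<close> passes to the limit, so
  \<open>f\<close> is square integrable too.\<close>

lemma L2_dominated_convergence:
  assumes g: "g \<in> L2" and s: "\<And>n. s n \<in> borel_measurable lebesgue"
    and lim: "AE x in lebesgue. (\<lambda>n. s n x) \<longlonglongrightarrow> f x" and f: "f \<in> borel_measurable lebesgue"
    and bd: "\<And>n. AE x in lebesgue. \<bar>s n x\<bar> \<le> g x"
  shows "f \<in> L2" "\<And>n. s n \<in> L2" "(\<lambda>n. L2_norm (\<lambda>x. s n x - f x)) \<longlonglongrightarrow> 0"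
proof -
  have bd': "AE x in lebesgue. \<forall>n. \<bar>s n x\<bar> \<le> g x" using bd by (simp add: AE_all_countable)
  have fb: "AE x in lebesgue. \<bar>f x\<bar> \<le> g x"
    using lim bd'
  proof eventually_elim
    case (elim x)
    show ?case by (rule LIMSEQ_le_const2[OF tendsto_rabs[OF elim(1)]]) (use elim in auto)
  qed
  have L: "h \<in> L2" if "h \<in> borel_measurable lebesgue" "AE x in lebesgue. \<bar>h x\<bar> \<le> g x" for h
  proof (rule L2_I[OF that(1)])
    show "integrable lebesgue (\<lambda>x. (h x)\<^sup>2)"
    proof (rule Bochner_Integration.integrable_bound[OF L2_square_integrable[OF g]])
      show "(\<lambda>x. (h x)\<^sup>2) \<in> borel_measurable lebesgue" using that(1) by measurable
      show "AE x in lebesgue. norm ((h x)\<^sup>2) \<le> norm ((g x)\<^sup>2)"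
        using that(2) by eventually_elim (auto simp: abs_le_square_iff[symmetric])
    qed
  qed
  show fL: "f \<in> L2" using L f fb by blast
  show sL: "s n \<in> L2" for n using L s bd by blast
  have "(\<lambda>n. integral\<^sup>L lebesgue (\<lambda>x. (s n x - f x)\<^sup>2)) \<longlonglongrightarrow> integral\<^sup>L lebesgue (\<lambda>x::'a. 0::real)"
  proof (rule integral_dominated_convergence[where w="\<lambda>x. (2 * g x)\<^sup>2"])
    show "integrable lebesgue (\<lambda>x. (2 * g x)\<^sup>2)" using L2_square_integrable[OF L2_cmult[OF g]] .
    show "(\<lambda>x. (s n x - f x)\<^sup>2) \<in> borel_measurable lebesgue" for n using s f by measurable
    show "AE x in lebesgue. (\<lambda>n. (s n x - f x)\<^sup>2) \<longlonglongrightarrow> 0"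
      using lim by eventually_elim (auto intro!: tendsto_eq_intros)
    show "AE x in lebesgue. norm ((s n x - f x)\<^sup>2) \<le> (2 * g x)\<^sup>2" for n
      using bd[of n] fb
    proof eventually_elim
      case (elim x)
      then have "\<bar>s n x - f x\<bar> \<le> \<bar>2 * g x\<bar>" by linarith
      then show ?case by (simp only: abs_le_square_iff real_norm_def abs_power2)
    qed
  qed simp
  then show "(\<lambda>n. L2_norm (\<lambda>x. s n x - f x)) \<longlonglongrightarrow> 0"
    unfolding L2_norm_def using tendsto_real_sqrt by fastforce
qed

section \<open>Density of the span of interval indicators\<close>

lemma L2_indicator_interval: "indicator {a..b} \<in> (L2 :: (real \<Rightarrow> real) set)"
proof (rule L2_I)
  have "integrable lebesgue (indicator {a..b} :: real \<Rightarrow> real)"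
    by (rule integrable_real_indicator) (auto simp: emeasure_lborel_Icc_eq)
  then show "integrable lebesgue (\<lambda>x. (indicator {a..b} x :: real)\<^sup>2)"
    by (rule back_subst[of "integrable lebesgue"]) (auto simp: fun_eq_iff split: split_indicator)
qed (auto intro!: borel_measurable_indicator)

lemma L2_indicator_Int_interval:
  "A \<in> sets borel \<Longrightarrow> indicator (A \<inter> {a..b}) \<in> (L2 :: (real \<Rightarrow> real) set)"
  by (rule L2_bound[OF L2_indicator_interval[of a b]])
     (auto split: split_indicator intro!: borel_measurable_indicator)

lemma L2_sum:
  assumes "finite I" "\<And>i. i \<in> I \<Longrightarrow> f i \<in> L2"
  shows "(\<lambda>x. \<Sum>i\<in>I. f i x) \<in> L2"
  using assms by (induction I rule: finite_induct) (auto intro: L2_zero L2_add)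

text \<open>A property stable under sums, multiples and limits in norm passes from intervals to
  bounded Borel sets (closed intervals are an intersection-stable generator), then to truncated
  simple functions, then to a Borel representative of \<open>f\<close>.\<close>

lemma L2_interval_induct [consumes 1, case_names interval add cmult limit]:
  fixes P :: "(real \<Rightarrow> real) \<Rightarrow> bool"
  assumes f: "f \<in> L2"
    and ind: "\<And>a b. P (indicator {a..b})"
    and add: "\<And>f g. f \<in> L2 \<Longrightarrow> g \<in> L2 \<Longrightarrow> P f \<Longrightarrow> P g \<Longrightarrow> P (\<lambda>x. f x + g x)"
    and cmult: "\<And>f c. f \<in> L2 \<Longrightarrow> P f \<Longrightarrow> P (\<lambda>x. c * f x)"
    and lim: "\<And>s f. (\<And>n::nat. s n \<in> L2) \<Longrightarrow> f \<in> L2 \<Longrightarrow> (\<And>n. P (s n)) \<Longrightarrow>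
      (\<lambda>n. L2_norm (\<lambda>x. s n x - f x)) \<longlonglongrightarrow> 0 \<Longrightarrow> P f"
  shows "P f"
proof -
  have zero: "P (\<lambda>x. 0)" using cmult[OF L2_indicator_interval[of 0 0] ind[of 0 0], of 0] by simp
  have sum: "P (\<lambda>x. \<Sum>i\<in>I. f i x)" if "finite I" "\<And>i. i \<in> I \<Longrightarrow> f i \<in> L2 \<and> P (f i)" for I :: "'i set" and f
    using that by (induction I rule: finite_induct) (auto intro!: zero add L2_sum)
  have sumn: "P (\<lambda>x. \<Sum>i<n. f i x)" if "\<And>i::nat. f i \<in> L2 \<and> P (f i)" for n f
    using that by (induction n) (auto intro!: zero add L2_sum)
  \<comment> \<open>Everything is cut to a fixed window {-c..c}: the complement of a set of finite
    measure is not square integrable, whereas within the window complementation is a difference of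
    two admissible indicators.\<close>
  have set: "P (indicator (A \<inter> {- c..c}))" if "A \<in> sets borel" for A and c :: real
  proof -
    have B: "sets (borel :: real measure) = sigma_sets UNIV (range (\<lambda>(a, b). {a..b}))"
      unfolding borel_eq_atLeastAtMost by simp
    have IS: "Int_stable (range (\<lambda>(a, b). {a..b::real}))"
      by (auto simp: Int_stable_def)
    have subset_Pow: "range (\<lambda>(a, b). {a..b::real}) \<subseteq> Pow UNIV" by simp
    have "A \<in> sigma_sets UNIV (range (\<lambda>(a, b). {a..b::real}))" using that B by simp
    then show ?thesis
    proof (induction rule: sigma_sets_induct_disjoint[OF IS subset_Pow, consumes 1, case_names basic empty compl union])
      case (basic A) then show ?case using ind by auto
    next
      case empty show ?case using zero by simp
    next
      case (compl A)
      then have "A \<in> sets borel" using B by simp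
      have "P (\<lambda>x. indicator {-c..c} x + (-1) * indicator (A \<inter> {-c..c}) x)"
        by (intro add cmult L2_cmult ind compl L2_indicator_interval L2_indicator_Int_interval) fact+
      then show ?case
        by (rule back_subst[of P]) (auto simp: fun_eq_iff split: split_indicator)
    next
      case (union A)
      then have Ab: "A i \<in> sets borel" for i using B by auto
      let ?s = "\<lambda>n x. \<Sum>i<n. indicator (A i \<inter> {-c..c}) x :: real"
      have eq: "?s n = indicator ((\<Union>i<n. A i) \<inter> {-c..c})" for n
      proof
        fix x
        have "(indicator ((\<Union>i<n. A i)) x :: real) = (\<Sum>i<n. indicator (A i) x)"
          by (rule indicator_UN_disjoint) (use union(1) in \<open>auto simp: disjoint_family_on_def\<close>)
        then show "?s n x = indicator ((\<Union>i<n. A i) \<inter> {-c..c}) x"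
          by (simp add: indicator_inter_arith sum_distrib_right)
      qed
      have lim': "(\<lambda>n. ?s n x) \<longlonglongrightarrow> indicator ((\<Union>i. A i) \<inter> {-c..c}) x" for x
      proof -
        have "(\<lambda>n. indicator (\<Union>i<n. A i) x :: real) \<longlonglongrightarrow> indicator (\<Union>i. A i) x"
          by (rule LIMSEQ_indicator_UN)
        then have "(\<lambda>n. indicator (\<Union>i<n. A i) x * indicator {-c..c} x :: real) \<longlonglongrightarrow> indicator (\<Union>i. A i) x * indicator {-c..c} x"
          by (intro tendsto_intros)
        then have "(\<lambda>n. indicator ((\<Union>i<n. A i) \<inter> {-c..c}) x :: real) \<longlonglongrightarrow> indicator ((\<Union>i. A i) \<inter> {-c..c}) x"
          by (simp only: indicator_inter_arith)
        then show ?thesis by (simp only: fun_cong[OF eq])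
      qed
      have meas: "(\<Union>i<n. A i) \<in> sets borel" for n
        using Ab by (intro sets.finite_UN) simp_all
      have meas': "(\<Union>i. A i) \<in> sets borel" using Ab by (intro sets.countable_UN) blast
      show ?case
      proof (rule lim[where s="?s"])
        show "?s n \<in> L2" for n using Ab by (intro L2_sum L2_indicator_Int_interval) simp_all
        show "P (?s n)" for n by (rule sumn) (use Ab union(3) L2_indicator_Int_interval in blast)
        show "indicator (\<Union> (range A) \<inter> {- c..c}) \<in> L2" using meas' by (rule L2_indicator_Int_interval)
        show "(\<lambda>n. L2_norm (\<lambda>x. ?s n x - indicator ((\<Union>i. A i) \<inter> {- c..c}) x)) \<longlonglongrightarrow> 0"
        proof (rule L2_dominated_convergence(3)[OF L2_indicator_interval[of "-c" c]])
          show "?s n \<in> borel_measurable lebesgue" for n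
            using Ab by (intro L2_measurable L2_sum L2_indicator_Int_interval) simp_all
          show "indicat_real ((\<Union>i. A i) \<inter> {- c..c}) \<in> borel_measurable lebesgue"
            by (intro L2_measurable L2_indicator_Int_interval meas')
          show "AE x in lebesgue. (\<lambda>n. ?s n x) \<longlonglongrightarrow> indicat_real ((\<Union>i. A i) \<inter> {- c..c}) x" by (intro AE_I2 lim')
          show "AE x in lebesgue. \<bar>?s n x\<bar> \<le> indicat_real {- c..c} x" for n
            by (intro AE_I2) (simp only: fun_cong[OF eq], simp split: split_indicator)
        qed
      qed
    qed
  qed
  obtain f' where f': "f' \<in> borel_measurable lborel" and ff': "AE x in lborel. f x = f' x"
    using completion_ex_borel_measurable_real[OF L2_measurable[OF f]] by blast
  have f'm: "f' \<in> borel_measurable borel" "f' \<in> borel_measurable lebesgue"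
    using f' by (auto intro: measurable_completion)
  have AEf: "AE x in lebesgue. f x = f' x" using AE_completion[OF ff'] .
  have f'L2: "f' \<in> L2"
  proof (rule L2_I)
    show "integrable lebesgue (\<lambda>x. (f' x)\<^sup>2)"
      by (rule Bochner_Integration.integrable_cong_AE_imp[OF L2_square_integrable[OF f]])
         (use AEf f'm in auto)
  qed (use f'm in auto)
  obtain F where F: "\<And>i. simple_function borel (F i)"
     and Flim: "\<And>x. x \<in> space borel \<Longrightarrow> (\<lambda>i. F i x) \<longlonglongrightarrow> f' x"
     and Fb: "\<And>i x. x \<in> space borel \<Longrightarrow> dist (F i x) 0 \<le> 2 * dist (f' x) 0"
    using borel_measurable_implies_sequence_metric[OF f'm(1), of 0] by auto
  \<comment> \<open>The level sets of the simple functions may have infinite measure; the growing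
    window makes each approximant square integrable.\<close>
  define s where "s n x = indicator {- real n..real n} x * F n x" for n x
  have s_eq: "s n = (\<lambda>x. \<Sum>y\<in>F n ` UNIV. y * indicator ((F n -` {y}) \<inter> {- real n..real n}) x)" for n
  proof
    fix x
    have "F n x = (\<Sum>y\<in>F n ` UNIV. y * indicator (F n -` {y}) x)"
      using simple_functionD(1)[OF F[of n]]
      by (subst sum.mono_neutral_cong_right[where S="{F n x}" and h="\<lambda>y. y"]) (auto split: split_indicator)
    then have "s n x = indicator {- real n..real n} x * (\<Sum>y\<in>F n ` UNIV. y * indicator (F n -` {y}) x)"
      unfolding s_def by (rule arg_cong)
    also have "\<dots> = (\<Sum>y\<in>F n ` UNIV. y * indicator ((F n -` {y}) \<inter> {- real n..real n}) x)"
      unfolding sum_distrib_left by (intro sum.cong refl) (simp split: split_indicator)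
    finally show "s n x = (\<Sum>y\<in>F n ` UNIV. y * indicator ((F n -` {y}) \<inter> {- real n..real n}) x)" .
  qed
  have vm: "F n -` {y} \<in> sets borel" for n y
    using simple_functionD(2)[OF F[of n], of "{y}"] by simp
  have sP: "s n \<in> L2 \<and> P (s n)" for n
  proof -
    have fin: "finite (F n ` UNIV)" using simple_functionD(1)[OF F[of n]] by simp
    have "(\<lambda>x. y * indicator ((F n -` {y}) \<inter> {- real n..real n}) x) \<in> L2"
      "P (\<lambda>x. y * indicator ((F n -` {y}) \<inter> {- real n..real n}) x)" for y
      using L2_indicator_Int_interval[OF vm] set[OF vm] by (blast intro: L2_cmult cmult)+
    then show ?thesis unfolding s_eq by (intro conjI L2_sum sum fin) simp_all
  qed
  have sb: "\<bar>s n x\<bar> \<le> 2 * \<bar>f' x\<bar>" for n x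
    using Fb[of x n] by (auto simp: s_def split: split_indicator)
  have sl: "(\<lambda>n. s n x) \<longlonglongrightarrow> f' x" for x
  proof (rule Lim_transform_eventually[OF Flim])
    obtain N :: nat where N: "\<bar>x\<bar> \<le> N" using real_arch_simple by blast
    show "\<forall>\<^sub>F n in sequentially. F n x = s n x"
      using eventually_ge_at_top[of N] by eventually_elim (use N in \<open>auto simp: s_def split: split_indicator\<close>)
  qed simp
  have "P f'"
  proof (rule lim[where s=s])
    have abs: "(\<lambda>x. 2 * \<bar>f' x\<bar>) \<in> L2"
      by (rule L2_bound[OF L2_cmult[OF f'L2, of 2]]) (use f'm in auto)
    show "(\<lambda>n. L2_norm (\<lambda>x. s n x - f' x)) \<longlonglongrightarrow> 0"
      by (rule L2_dominated_convergence(3)[OF abs]) (use sP sl sb f'm in \<open>auto intro: L2_measurable\<close>)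
  qed (use sP f'L2 in auto)
  \<comment> \<open>\<open>P\<close> is not assumed invariant under a.e. equality. The constant
    sequence f', at distance zero from f, yields this from the limit rule.\<close>
  moreover have "L2_norm (\<lambda>x. f' x - f x) = 0"
  proof -
    have "(\<lambda>x. f' x - f x) =\<^sub>a (\<lambda>x. 0)"
      unfolding eq_ae_def using AEf by eventually_elim simp
    from L2_norm_cong[OF this L2_diff[OF f'L2 f] L2_zero] show ?thesis by simp
  qed
  ultimately have "P f'" "(\<lambda>n::nat. L2_norm (\<lambda>x. f' x - f x)) \<longlonglongrightarrow> 0" by simp_all
  then show ?thesis by (rule lim[where s="\<lambda>_. f'" and f=f, OF f'L2 f])
qed

text \<open>The tail of the series is controlled by the Cauchy--Schwarz inequality with weights
  \<open>a\<^sub>n\<close>, which avoids the completeness of \<open>L\<^sup>2\<close>.\<close>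

lemma L2_series:
  fixes f :: "nat \<Rightarrow> 'a::euclidean_space \<Rightarrow> real" and a :: "nat \<Rightarrow> real"
  assumes f: "\<And>n. f n \<in> L2" and f1: "\<And>n. L2_norm (f n) \<le> 1"
    and a: "\<And>n. 0 \<le> a n" and sa: "summable a"
  obtains x where "x \<in> L2"
    "\<And>N. L2_norm (\<lambda>y. x y - (\<Sum>n<N. a n * f n y)) \<le> (\<Sum>n. a (n + N))"
proof -
  have fm [measurable]: "f n \<in> borel_measurable lebesgue" for n using f L2_measurable by auto
  have int: "integrable lebesgue (\<lambda>y. a n * (f n y)\<^sup>2)" for n
    using L2_square_integrable[OF f] by (intro integrable_mult_right) auto
  have intv: "integral\<^sup>L lebesgue (\<lambda>y. a n * (f n y)\<^sup>2) \<le> a n" for n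
  proof -
    have "integral\<^sup>L lebesgue (\<lambda>y. a n * (f n y)\<^sup>2) = a n * (L2_norm (f n))\<^sup>2"
      by (simp add: L2_norm_square)
    also have "\<dots> \<le> a n * 1" using f1[of n] a[of n] by (intro mult_left_mono) (auto simp: power_le_one)
    finally show ?thesis by simp
  qed
  have sint: "summable (\<lambda>n. integral\<^sup>L lebesgue (\<lambda>y. norm (a n * (f n y)\<^sup>2)))"
    by (rule summable_comparison_test[OF _ sa]) (use a intv in \<open>auto simp: abs_mult\<close>)
  have AEs: "AE y in lebesgue. summable (\<lambda>n. a n * (f n y)\<^sup>2)"
  proof -
    have "(\<integral>\<^sup>+ y. (\<Sum>n. ennreal (a n * (f n y)\<^sup>2)) \<partial>lebesgue) = (\<Sum>n. \<integral>\<^sup>+ y. ennreal (a n * (f n y)\<^sup>2) \<partial>lebesgue)"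
      by (rule nn_integral_suminf) auto
    also have "\<dots> = (\<Sum>n. ennreal (integral\<^sup>L lebesgue (\<lambda>y. a n * (f n y)\<^sup>2)))"
      using a by (intro suminf_cong nn_integral_eq_integral int) auto
    also have "\<dots> \<le> (\<Sum>n. ennreal (a n))" using intv by (intro suminf_le) (auto intro: ennreal_leI)
    also have "\<dots> = ennreal (\<Sum>n. a n)" using a sa by (intro suminf_ennreal2) auto
    finally have "(\<integral>\<^sup>+ y. (\<Sum>n. ennreal (a n * (f n y)\<^sup>2)) \<partial>lebesgue) \<noteq> \<infinity>"
      using ennreal_less_top[of "\<Sum>n. a n"] by (auto simp: top_unique)
    then have "AE y in lebesgue. (\<Sum>n. ennreal (a n * (f n y)\<^sup>2)) \<noteq> \<infinity>"
      by (intro nn_integral_PInf_AE) auto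
    then show ?thesis
      by eventually_elim (use a in \<open>auto intro!: summable_suminf_not_top\<close>)
  qed
  define x where "x y = (\<Sum>n. a n * f n y)" for y
  have xm [measurable]: "x \<in> borel_measurable lebesgue" unfolding x_def by measurable
  define t where "t N y = x y - (\<Sum>n<N. a n * f n y)" for N y
  have tm [measurable]: "t N \<in> borel_measurable lebesgue" for N unfolding t_def by measurable
  \<comment> \<open>The right-hand side integrates to at most the square of the tail of
    \<open>a\<close>, since every \<open>f n\<close> has norm at most one. Absolute convergence at y
    comes from |f| \<le> 1 + f^2.\<close>
  have tb: "AE y in lebesgue. (t N y)\<^sup>2 \<le> (\<Sum>n. a (n + N)) * (\<Sum>n. a (n + N) * (f (n + N) y)\<^sup>2)" for N
    using AEs
  proof eventually_elim
    case (elim y)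
    have b: "a n * \<bar>f n y\<bar> \<le> a n + a n * (f n y)\<^sup>2" for n
    proof -
      have "\<bar>f n y\<bar> \<le> 1 + (f n y)\<^sup>2"
        using sum_squares_bound[of 1 "\<bar>f n y\<bar>"] by simp
      from mult_left_mono[OF this a[of n]] show ?thesis by (simp add: algebra_simps)
    qed
    have sabs: "summable (\<lambda>n. \<bar>a n * f n y\<bar>)"
      by (rule summable_comparison_test[OF _ summable_add[OF sa elim]]) (use b a in \<open>auto simp: abs_mult\<close>)
    have s: "summable (\<lambda>n. a n * f n y)" using summable_rabs_cancel[OF sabs] .
    have t: "t N y = (\<Sum>n. a (n + N) * f (n + N) y)"
      unfolding t_def x_def using suminf_minus_initial_segment[OF s, of N] by simp
    have p: "(\<Sum>n<M. a (n + N) * f (n + N) y)\<^sup>2 \<le> (\<Sum>n. a (n + N)) * (\<Sum>n. a (n + N) * (f (n + N) y)\<^sup>2)" for M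
    proof -
      have "(\<Sum>n<M. a (n + N) * f (n + N) y)\<^sup>2 = (\<Sum>n<M. sqrt (a (n + N)) * (sqrt (a (n + N)) * f (n + N) y))\<^sup>2"
        using a by (simp add: mult.assoc[symmetric] )
      also have "\<dots> \<le> (\<Sum>n<M. (sqrt (a (n + N)))\<^sup>2) * (\<Sum>n<M. (sqrt (a (n + N)) * f (n + N) y)\<^sup>2)"
        by (rule Cauchy_Schwarz_ineq_sum)
      also have "\<dots> = (\<Sum>n<M. a (n + N)) * (\<Sum>n<M. a (n + N) * (f (n + N) y)\<^sup>2)"
        using a by (simp add: power_mult_distrib)
      also have "\<dots> \<le> (\<Sum>n. a (n + N)) * (\<Sum>n. a (n + N) * (f (n + N) y)\<^sup>2)"
        using a sa elim by (intro mult_mono sum_le_suminf sum_nonneg suminf_nonneg) (auto simp: summable_iff_shift[of a] summable_iff_shift[of "\<lambda>n. a n * (f n y)\<^sup>2"])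
      finally show ?thesis .
    qed
    have "(\<lambda>M. \<Sum>n<M. a (n + N) * f (n + N) y) \<longlonglongrightarrow> t N y"
      unfolding t using s by (intro summable_LIMSEQ) (auto simp: summable_iff_shift[of "\<lambda>n. a n * f n y"])
    from tendsto_power[OF this, of 2] show ?case
      by (rule LIMSEQ_le_const2) (use p in auto)
  qed
  have maj: "integrable lebesgue (\<lambda>y. \<Sum>n. a (n + N) * (f (n + N) y)\<^sup>2)"
    "integral\<^sup>L lebesgue (\<lambda>y. \<Sum>n. a (n + N) * (f (n + N) y)\<^sup>2) \<le> (\<Sum>n. a (n + N))" for N
  proof -
    have 1: "AE y in lebesgue. summable (\<lambda>n. norm (a (n + N) * (f (n + N) y)\<^sup>2))"
      using AEs
    proof eventually_elim
      case (elim y) then show ?case using a summable_iff_shift[of "\<lambda>n. a n * (f n y)\<^sup>2" N] by (simp add: abs_mult)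
    qed
    have 2: "summable (\<lambda>n. integral\<^sup>L lebesgue (\<lambda>y. norm (a (n + N) * (f (n + N) y)\<^sup>2)))"
      using sint summable_iff_shift[of "\<lambda>n. integral\<^sup>L lebesgue (\<lambda>y. norm (a n * (f n y)\<^sup>2))" N] by simp
    show "integrable lebesgue (\<lambda>y. \<Sum>n. a (n + N) * (f (n + N) y)\<^sup>2)"
      by (rule integrable_suminf[OF int 1 2])
    have "integral\<^sup>L lebesgue (\<lambda>y. \<Sum>n. a (n + N) * (f (n + N) y)\<^sup>2) = (\<Sum>n. integral\<^sup>L lebesgue (\<lambda>y. a (n + N) * (f (n + N) y)\<^sup>2))"
      by (rule integral_suminf[OF int 1 2])
    also have "\<dots> \<le> (\<Sum>n. a (n + N))"
      using intv 2 sa a by (intro suminf_le) (auto simp: summable_iff_shift[of a] abs_mult)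
    finally show "integral\<^sup>L lebesgue (\<lambda>y. \<Sum>n. a (n + N) * (f (n + N) y)\<^sup>2) \<le> (\<Sum>n. a (n + N))" .
  qed
  have A0: "0 \<le> (\<Sum>n. a (n + N))" for N using a sa by (intro suminf_nonneg) (auto simp: summable_iff_shift[of a])
  have ti: "integrable lebesgue (\<lambda>y. (t N y)\<^sup>2)" for N
    by (rule Bochner_Integration.integrable_bound[OF integrable_mult_right[OF maj(1)[of N], of "\<Sum>n. a (n + N)"]])
      (use tb[of N] in \<open>simp_all, eventually_elim, simp\<close>)
  have tn: "L2_norm (t N) \<le> (\<Sum>n. a (n + N))" for N
  proof -
    have "(L2_norm (t N))\<^sup>2 \<le> integral\<^sup>L lebesgue (\<lambda>y. (\<Sum>n. a (n + N)) * (\<Sum>n. a (n + N) * (f (n + N) y)\<^sup>2))"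
      unfolding L2_norm_square by (rule integral_mono_AE[OF ti integrable_mult_right[OF maj(1)] tb])
    also have "\<dots> \<le> (\<Sum>n. a (n + N)) * (\<Sum>n. a (n + N))"
      using maj(2)[of N] A0[of N] by (simp add: mult_left_mono)
    finally have "(L2_norm (t N))\<^sup>2 \<le> (\<Sum>n. a (n + N))\<^sup>2" by (simp only: power2_eq_square)
    then show ?thesis using A0[of N] by (rule power2_le_imp_le)
  qed
  have "t 0 = x" by (auto simp: t_def)
  then have "x \<in> L2" using ti[of 0] xm by (auto intro!: L2_I)
  then show ?thesis by (rule that[of x, OF _ tn[unfolded t_def]])
qed

section \<open>Uniform boundedness and continuity of semigroups\<close>

lemma bounded_linear_L2_bound:
  assumes "bounded_linear_L2 B"
  obtains K where "\<And>f. f \<in> L2 \<Longrightarrow> L2_norm (B f) \<le> K * L2_norm f"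
  using assms unfolding bounded_linear_L2_def by blast

lemma bounded_linear_L2_closed: "bounded_linear_L2 B \<Longrightarrow> f \<in> L2 \<Longrightarrow> B f \<in> L2"
  unfolding bounded_linear_L2_def by blast

lemma bounded_linear_L2_combination:
  assumes B: "bounded_linear_L2 B" and f: "f \<in> L2" and g: "g \<in> L2"
  shows "B (\<lambda>x. f x + c * g x) =\<^sub>a (\<lambda>x. B f x + c * B g x)"
proof -
  have "B (\<lambda>x. f x + c * g x) =\<^sub>a (\<lambda>x. B f x + B (\<lambda>x. c * g x) x)"
    by (rule B[unfolded bounded_linear_L2_def, THEN conjunct2, THEN conjunct1, rule_format, OF f L2_cmult[OF g]])
  moreover have "B (\<lambda>x. c * g x) =\<^sub>a (\<lambda>x. c * B g x)"
    using B g unfolding bounded_linear_L2_def by blast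
  ultimately show ?thesis unfolding eq_ae_def by eventually_elim simp
qed

lemma bounded_linear_L2_diff:
  assumes B: "bounded_linear_L2 B" and f: "f \<in> L2" and g: "g \<in> L2"
  shows "B (\<lambda>x. f x - g x) =\<^sub>a (\<lambda>x. B f x - B g x)"
  using bounded_linear_L2_combination[OF assms, of "-1"] by simp

text \<open>The gliding hump proof of the uniform boundedness principle (A. Sokal).\<close>

theorem uniform_boundedness_L2:
  fixes B :: "nat \<Rightarrow> (real \<Rightarrow> real) \<Rightarrow> real \<Rightarrow> real"
  assumes bl: "\<And>n. bounded_linear_L2 (B n)"
    and pt: "\<And>f. f \<in> L2 \<Longrightarrow> \<exists>C. \<forall>n. L2_norm (B n f) \<le> C"
  shows "\<exists>C. \<forall>n. \<forall>f\<in>L2. L2_norm (B n f) \<le> C * L2_norm f"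
proof (rule ccontr)
  assume neg: "\<nexists>C. \<forall>n. \<forall>f\<in>L2. L2_norm (B n f) \<le> C * L2_norm f"
  note cl = bounded_linear_L2_closed[OF bl]
  define U where "U = {f :: real \<Rightarrow> real. f \<in> L2 \<and> L2_norm f \<le> 1}"
  \<comment> \<open>The operator norm of \<open>B n\<close>.\<close>
  define N where "N n = (SUP f\<in>U. L2_norm (B n f))" for n
  have bdd: "bdd_above ((\<lambda>f. L2_norm (B n f)) ` U)" for n
  proof -
    obtain K where K: "\<And>f. f \<in> L2 \<Longrightarrow> L2_norm (B n f) \<le> K * L2_norm f"
      using bounded_linear_L2_bound[OF bl] by blast
    have "L2_norm (B n f) \<le> \<bar>K\<bar>" if "f \<in> U" for f
    proof -
      have "L2_norm (B n f) \<le> K * L2_norm f" using K that by (auto simp: U_def)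
      also have "\<dots> \<le> \<bar>K\<bar> * 1" using that by (intro mult_mono) (auto simp: U_def)
      finally show ?thesis by simp
    qed
    then show ?thesis by (auto intro!: bdd_aboveI)
  qed
  have U0: "(\<lambda>x. 0) \<in> U" by (simp add: U_def L2_zero)
  have N_U: "L2_norm (B n f) \<le> N n" if "f \<in> U" for n f
    unfolding N_def by (rule cSUP_upper[OF that bdd])
  have N0: "0 \<le> N n" for n using N_U[OF U0, of n] L2_norm_nonneg order_trans by blast
  have N_bound: "L2_norm (B n f) \<le> N n * L2_norm f" if f: "f \<in> L2" for n f
  proof (cases "L2_norm f = 0")
    case True
    obtain K where K: "\<And>f. f \<in> L2 \<Longrightarrow> L2_norm (B n f) \<le> K * L2_norm f"
      using bounded_linear_L2_bound[OF bl] by blast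
    show ?thesis using K[OF f] True by simp
  next
    case False
    then have pos: "L2_norm f > 0" using L2_norm_nonneg[of f] by linarith
    let ?c = "1 / L2_norm f"
    have "(\<lambda>x. ?c * f x) \<in> U" unfolding U_def using L2_cmult[OF f, of ?c] pos
      by (simp only: mem_Collect_eq L2_norm_cmult) simp
    then have "L2_norm (B n (\<lambda>x. ?c * f x)) \<le> N n" by (rule N_U)
    moreover have "B n (\<lambda>x. ?c * f x) =\<^sub>a (\<lambda>x. ?c * B n f x)"
      using bl[of n] f unfolding bounded_linear_L2_def by blast
    then have "L2_norm (B n (\<lambda>x. ?c * f x)) = ?c * L2_norm (B n f)"
      using L2_norm_cong[OF _ cl[OF L2_cmult[OF f]] L2_cmult[OF cl[OF f]]] pos by (simp add: L2_norm_cmult del: times_divide_eq_left)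
    ultimately have "?c * L2_norm (B n f) \<le> N n" by (simp only:)
    then show ?thesis using pos by (simp add: field_simps)
  qed
  \<comment> \<open>The growth 4^j must outrun the weights 3^(-j) used below, and the fraction 3/4
    must exceed the share 1/2 that the tail of the series will consume.\<close>
  have ex: "\<exists>n f. f \<in> L2 \<and> L2_norm f \<le> 1 \<and> N n > 4 ^ j \<and> L2_norm (B n f) > 3 / 4 * N n" for j :: nat
  proof -
    have "\<exists>n. N n > 4 ^ j"
    proof (rule ccontr)
      assume "\<nexists>n. N n > 4 ^ j"
      then have "N n \<le> 4 ^ j" for n by (simp add: not_less)
      then have "L2_norm (B n f) \<le> 4 ^ j * L2_norm f" if "f \<in> L2" for n f
        using N_bound[OF that, of n] mult_right_mono[OF _ L2_norm_nonneg[of f]] order_trans by blast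
      with neg show False by blast
    qed
    then obtain n where n: "N n > 4 ^ j" by blast
    have "(0::real) < 4 ^ j" by simp
    with n have "3 / 4 * N n < N n" by linarith
    then obtain f where "f \<in> U" "3 / 4 * N n < L2_norm (B n f)"
      unfolding N_def using less_cSUP_iff[OF _ bdd] U0 by blast
    with n show ?thesis by (auto simp: U_def)
  qed
  then obtain m e where e: "\<And>j. e j \<in> L2" "\<And>j. L2_norm (e j) \<le> 1"
    and mN: "\<And>j. N (m j) > 4 ^ j" and eN: "\<And>j::nat. L2_norm (B (m j) (e j)) > 3 / 4 * N (m j)"
    by metis
  \<comment> \<open>The sign of the j-th hump. One of the two signs always works, because 2 ||B y||
    \<le> ||B (x + y)|| + ||B (x - y)||.\<close>
  define step where "step X j = (if L2_norm (B (m j) (\<lambda>x. X x + (1/3) ^ j * e j x)) \<ge> 3 / 4 * (1/3) ^ j * N (m j)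
      then 1 else - 1 :: real)" for X and j :: nat
  define X where "X = rec_nat (\<lambda>x::real. 0::real) (\<lambda>j Y x. Y x + (1/3) ^ j * (step Y j * e j x))"
  have X0: "X 0 = (\<lambda>x. 0)" and XS: "X (Suc j) = (\<lambda>x. X j x + (1/3) ^ j * (step (X j) j * e j x))" for j
    by (simp_all add: X_def)
  define g where "g j = (\<lambda>x. step (X j) j * e j x)" for j
  have step: "\<bar>step Y j\<bar> = 1" for Y j by (simp add: step_def)
  have gL: "g j \<in> L2" for j unfolding g_def by (rule L2_cmult[OF e(1)])
  have gn: "L2_norm (g j) \<le> 1" for j unfolding g_def L2_norm_cmult step using e(2) by simp
  have X_sum: "X n = (\<lambda>x. \<Sum>j<n. (1/3) ^ j * g j x)" for n
    by (induction n) (auto simp: X0 XS g_def)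
  have XL: "X j \<in> L2" for j unfolding X_sum by (intro L2_sum L2_cmult gL) simp
  have hump: "L2_norm (B (m j) (X (Suc j))) \<ge> 3 / 4 * (1/3) ^ j * N (m j)" for j
  proof (cases "step (X j) j = 1")
    case True
    then have "L2_norm (B (m j) (\<lambda>x. X j x + (1/3) ^ j * e j x)) \<ge> 3 / 4 * (1/3) ^ j * N (m j)"
      by (auto simp: step_def split: if_splits)
    then show ?thesis unfolding XS True by simp
  next
    case False
    let ?B = "B (m j)" and ?c = "(1/3) ^ j :: real"
    from False have lt: "L2_norm (?B (\<lambda>x. X j x + ?c * e j x)) < 3 / 4 * ?c * N (m j)"
      and s: "step (X j) j = - 1"
      by (auto simp: step_def split: if_splits)
    have p: "?B (\<lambda>x. X j x + ?c * e j x) =\<^sub>a (\<lambda>x. ?B (X j) x + ?c * ?B (e j) x)"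
      and q: "?B (\<lambda>x. X j x + (- ?c) * e j x) =\<^sub>a (\<lambda>x. ?B (X j) x + (- ?c) * ?B (e j) x)"
      by (intro bounded_linear_L2_combination bl XL e)+
    have L: "(\<lambda>x. X j x + d * e j x) \<in> L2" "(\<lambda>x. ?B (X j) x + d * ?B (e j) x) \<in> L2" for d
      by (intro L2_add L2_cmult XL e cl)+
    have "2 * ?c * L2_norm (?B (e j)) = L2_norm (\<lambda>x. (2 * ?c) * ?B (e j) x)"
      unfolding L2_norm_cmult by simp
    also have "\<dots> = L2_norm (\<lambda>x. (?B (X j) x + ?c * ?B (e j) x) + - (?B (X j) x + (- ?c) * ?B (e j) x))"
      by (simp add: algebra_simps)
    also have "\<dots> \<le> L2_norm (\<lambda>x. ?B (X j) x + ?c * ?B (e j) x) + L2_norm (\<lambda>x. - (?B (X j) x + (- ?c) * ?B (e j) x))"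
      by (rule L2_norm_triangle[OF L(2) L2_minus[OF L(2)]])
    also have "L2_norm (\<lambda>x. - (?B (X j) x + (- ?c) * ?B (e j) x)) = L2_norm (\<lambda>x. ?B (X j) x + (- ?c) * ?B (e j) x)"
      by (rule L2_norm_minus)
    also have "L2_norm (\<lambda>x. ?B (X j) x + ?c * ?B (e j) x) + L2_norm (\<lambda>x. ?B (X j) x + (- ?c) * ?B (e j) x)
       = L2_norm (?B (\<lambda>x. X j x + ?c * e j x)) + L2_norm (?B (\<lambda>x. X j x + (- ?c) * e j x))"
      using L2_norm_cong[OF p cl[OF L(1)] L(2)] L2_norm_cong[OF q cl[OF L(1)] L(2)] by simp
    also have "(\<lambda>x. X j x + (- ?c) * e j x) = X (Suc j)"
      unfolding XS s by simp
    finally have "2 * ?c * L2_norm (?B (e j)) \<le> L2_norm (?B (\<lambda>x. X j x + ?c * e j x)) + L2_norm (?B (X (Suc j)))" .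
    moreover have "?c * (3 / 4 * N (m j)) \<le> ?c * L2_norm (?B (e j))"
      using eN[of j] by (intro mult_left_mono) auto
    then have "3 / 4 * ?c * N (m j) \<le> ?c * L2_norm (?B (e j))"
      by (simp only: mult.assoc mult.left_commute[of "3 / 4" ?c])
    ultimately show ?thesis using lt by linarith
  qed
  have sa: "summable (\<lambda>n. (1/3) ^ n :: real)" by (rule summable_geometric) simp
  obtain x where x: "x \<in> L2" "\<And>n. L2_norm (\<lambda>y. x y - X n y) \<le> (\<Sum>i. (1/3) ^ (i + n))"
    by (rule L2_series[of g "\<lambda>n. (1/3) ^ n", OF gL gn _ sa]) (auto simp: X_sum)
  \<comment> \<open>At n = Suc j the tail is half of (1/3)^j. Against the hump 3/4 this leaves 1/4
    of (1/3)^j N, which exceeds (4/3)^j / 4 and is unbounded.\<close>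
  have tail: "(\<Sum>i. (1/3) ^ (i + n)) = (1/3) ^ n * (3 / 2 :: real)" for n
    using suminf_mult[OF sa, of "(1/3) ^ n"] suminf_geometric[of "1/3 :: real"]
    by (simp add: power_add mult.commute)
  have low: "1 / 4 * (4/3) ^ j \<le> L2_norm (B (m j) x)" for j
  proof -
    let ?B = "B (m j)" and ?d = "\<lambda>y. X (Suc j) y - x y"
    have dL: "?d \<in> L2" by (rule L2_diff[OF XL x(1)])
    have "L2_norm (?B (X (Suc j))) \<le> L2_norm (?B x) + L2_norm (\<lambda>y. ?B (X (Suc j)) y - ?B x y)"
      by (intro L2_norm_le_add_diff cl XL x)
    also have "L2_norm (\<lambda>y. ?B (X (Suc j)) y - ?B x y) = L2_norm (?B ?d)"
      by (rule L2_norm_cong[OF bounded_linear_L2_diff[OF bl XL x(1)] cl[OF dL] L2_diff[OF cl[OF XL] cl[OF x(1)]], symmetric])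
    also have "\<dots> \<le> N (m j) * L2_norm ?d" by (rule N_bound[OF dL])
    also have "\<dots> \<le> N (m j) * ((1/3) ^ Suc j * (3 / 2))"
      using x(2)[of "Suc j"] N0[of "m j"] unfolding tail L2_norm_minus_commute[of "X (Suc j)"] by (intro mult_left_mono)
    finally have "3 / 4 * (1/3) ^ j * N (m j) \<le> L2_norm (?B x) + N (m j) * ((1/3) ^ Suc j * (3 / 2))"
      using hump[of j] by linarith
    then have "1 / 4 * ((1/3) ^ j * N (m j)) \<le> L2_norm (?B x)"
      by (simp add: algebra_simps)
    moreover have "(4/3) ^ j \<le> (1/3) ^ j * N (m j)"
      using mN[of j] by (simp add: power_divide field_simps)
    ultimately show ?thesis by linarith
  qed
  obtain C where C: "\<And>n. L2_norm (B n x) \<le> C" using pt[OF x(1)] by blast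
  obtain j where "4 * C < (4/3) ^ j" using real_arch_pow[of "4/3 :: real" "4 * C"] by auto
  with low[of j] C[of "m j"] show False by linarith
qed

section \<open>Strongly continuous semigroups: local bounds and continuity in time\<close>

locale L2_semigroup =
  fixes S :: "real \<Rightarrow> (real \<Rightarrow> real) \<Rightarrow> real \<Rightarrow> real"
  assumes semigroup: "continuous_semigroup_L2 S"
begin

lemma bl: "0 \<le> t \<Longrightarrow> bounded_linear_L2 (S t)"
  using semigroup unfolding continuous_semigroup_L2_def by blast

lemma closed: "0 \<le> t \<Longrightarrow> f \<in> L2 \<Longrightarrow> S t f \<in> L2"
  using bounded_linear_L2_closed[OF bl] .

lemma at_0: "f \<in> L2 \<Longrightarrow> S 0 f =\<^sub>a f"
  using semigroup unfolding continuous_semigroup_L2_def by blast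

lemma comp: "0 \<le> s \<Longrightarrow> 0 \<le> t \<Longrightarrow> f \<in> L2 \<Longrightarrow> S (s + t) f =\<^sub>a S s (S t f)"
  using semigroup unfolding continuous_semigroup_L2_def by blast

lemma continuous_0: "f \<in> L2 \<Longrightarrow> ((\<lambda>t. L2_norm (\<lambda>x. S t f x - f x)) \<longlongrightarrow> 0) (at_right 0)"
  using semigroup unfolding continuous_semigroup_L2_def by blast

lemma norm_diff:
  assumes "0 \<le> t" "f \<in> L2" "g \<in> L2"
  shows "L2_norm (\<lambda>x. S t f x - S t g x) = L2_norm (S t (\<lambda>x. f x - g x))"
  using assms by (intro L2_norm_cong[symmetric] bounded_linear_L2_diff bl closed L2_diff)

lemma continuous_0':
  assumes f: "f \<in> L2" and e: "e > 0"
  obtains d where "d > 0" "\<And>t. 0 \<le> t \<Longrightarrow> t < d \<Longrightarrow> L2_norm (\<lambda>x. S t f x - f x) < e"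
proof -
  have "\<forall>\<^sub>F t in at_right 0. L2_norm (\<lambda>x. S t f x - f x) < e"
    using order_tendstoD(2)[OF continuous_0[OF f] e] .
  then obtain d where d: "d > 0" "\<And>t. 0 < t \<Longrightarrow> t < d \<Longrightarrow> L2_norm (\<lambda>x. S t f x - f x) < e"
    unfolding eventually_at_right_field by blast
  \<comment> \<open>The limit from the right says nothing at t = 0, where the semigroup is the
    identity only up to null sets.\<close>
  have "L2_norm (\<lambda>x. S 0 f x - f x) = 0"
  proof -
    have "(\<lambda>x. S 0 f x - f x) =\<^sub>a (\<lambda>x. 0)"
      using at_0[OF f] unfolding eq_ae_def by eventually_elim simp
    from L2_norm_cong[OF this L2_diff[OF closed[OF _ f] f] L2_zero] show ?thesis by simp
  qed
  with d e show ?thesis by (intro that[of d]) (metis order_le_less)+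
qed

text \<open>Otherwise there are times t n \<le> 1/(n+1) at which the constant n+1 fails. Strong
  continuity at 0 bounds every orbit along these times, so uniform boundedness supplies one constant
  for all n, a contradiction.\<close>

lemma locally_bounded_0:
  obtains d M where "d > 0" "M \<ge> 1" "\<And>t f. 0 \<le> t \<Longrightarrow> t \<le> d \<Longrightarrow> f \<in> L2 \<Longrightarrow> L2_norm (S t f) \<le> M * L2_norm f"
proof -
  have "\<exists>n::nat. \<forall>t. 0 \<le> t \<and> t \<le> 1 / real (Suc n) \<longrightarrow> (\<forall>f\<in>L2. L2_norm (S t f) \<le> real (Suc n) * L2_norm f)"
  proof (rule ccontr)
    assume "\<not> ?thesis"
    then have "\<forall>n::nat. \<exists>t f. 0 \<le> t \<and> t \<le> 1 / real (Suc n) \<and> f \<in> L2 \<and> L2_norm (S t f) > real (Suc n) * L2_norm f"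
      by (simp add: not_le) blast
    then obtain t f where t: "\<And>n. 0 \<le> t n" "\<And>n::nat. t n \<le> 1 / real (Suc n)"
      and f: "\<And>n. f n \<in> L2" "\<And>n. L2_norm (S (t n) (f n)) > real (Suc n) * L2_norm (f n)"
      by metis
    have "\<exists>C. \<forall>n. \<forall>f\<in>L2. L2_norm (S (t n) f) \<le> C * L2_norm f"
    proof (rule uniform_boundedness_L2[OF bl[OF t(1)]])
      fix h :: "real \<Rightarrow> real" assume h: "h \<in> L2"
      obtain d where d: "d > 0" "\<And>t. 0 \<le> t \<Longrightarrow> t < d \<Longrightarrow> L2_norm (\<lambda>x. S t h x - h x) < 1"
        using continuous_0'[OF h, of 1] by auto
      obtain N :: nat where N: "1 / real (Suc N) < d" using d(1) nat_approx_posE by blast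
      have big: "L2_norm (S (t n) h) \<le> L2_norm h + 1" if "n \<ge> N" for n
      proof -
        have "1 / real (Suc n) \<le> 1 / real (Suc N)" using that by (simp add: frac_le)
        then have "t n < d" using t(2)[of n] N by linarith
        then show ?thesis
          using d(2)[OF t(1), of n] L2_norm_le_add_diff[OF closed[OF t(1) h] h, of n] by linarith
      qed
      have "L2_norm (S (t n) h) \<le> L2_norm h + 1 + (\<Sum>i<N. L2_norm (S (t i) h))" for n
      proof (cases "n < N")
        case True
        then have "L2_norm (S (t n) h) \<le> (\<Sum>i<N. L2_norm (S (t i) h))"
          by (intro member_le_sum) auto
        then show ?thesis using L2_norm_nonneg[of h] by linarith
      next
        case False
        have "0 \<le> (\<Sum>i<N. L2_norm (S (t i) h))" by (intro sum_nonneg) simp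
        with big[of n] False show ?thesis by simp
      qed
      then show "\<exists>C. \<forall>n. L2_norm (S (t n) h) \<le> C" by blast
    qed
    then obtain C where C: "\<And>n h. h \<in> L2 \<Longrightarrow> L2_norm (S (t n) h) \<le> C * L2_norm h" by blast
    obtain n :: nat where "C \<le> real n" using real_arch_simple by blast
    then have "C * L2_norm (f n) \<le> real (Suc n) * L2_norm (f n)"
      by (intro mult_right_mono) auto
    with C[OF f(1)[of n], of n] f(2)[of n] show False by linarith
  qed
  then obtain n :: nat where "\<And>t f. 0 \<le> t \<Longrightarrow> t \<le> 1 / real (Suc n) \<Longrightarrow> f \<in> L2 \<Longrightarrow> L2_norm (S t f) \<le> real (Suc n) * L2_norm f"
    by blast
  then show ?thesis by (intro that[of "1 / real (Suc n)" "real (Suc n)"]) auto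
qed

text \<open>The semigroup law splits [0, b] into steps of length at most d, each costing a factor M;
  a power of M serves on the whole interval.\<close>

lemma locally_bounded:
  obtains M where "M > 0" "\<And>t f. 0 \<le> t \<Longrightarrow> t \<le> b \<Longrightarrow> f \<in> L2 \<Longrightarrow> L2_norm (S t f) \<le> M * L2_norm f"
proof -
  obtain d M where d: "d > 0" "M \<ge> 1"
    and M: "\<And>t f. 0 \<le> t \<Longrightarrow> t \<le> d \<Longrightarrow> f \<in> L2 \<Longrightarrow> L2_norm (S t f) \<le> M * L2_norm f"
    using locally_bounded_0 by blast
  have iter: "L2_norm (S t f) \<le> M ^ n * L2_norm f" if "0 \<le> t" "t \<le> real n * d" "f \<in> L2" for n t f
    using that
  proof (induction n arbitrary: t)
    case 0
    then have "t = 0" by simp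
    then show ?case using L2_norm_cong[OF at_0[OF 0(3)] closed[OF _ 0(3)] 0(3)] by simp
  next
    case (Suc n)
    define s where "s = min t d"
    have s: "0 \<le> s" "s \<le> d" "0 \<le> t - s" "t - s \<le> real n * d"
      using Suc.prems d(1) by (auto simp: s_def min_def algebra_simps)
    have "L2_norm (S t f) = L2_norm (S s (S (t - s) f))"
      using comp[OF s(1,3) Suc.prems(3)] by (intro L2_norm_cong closed s Suc.prems) auto
    also have "\<dots> \<le> M * L2_norm (S (t - s) f)" by (intro M s closed Suc.prems)
    also have "\<dots> \<le> M * (M ^ n * L2_norm f)"
      using Suc.IH[OF s(3,4) Suc.prems(3)] d(2) by (intro mult_left_mono) auto
    finally show ?case by (simp add: mult.assoc)
  qed
  obtain n :: nat where "b / d \<le> real n" using real_arch_simple by blast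
  then have "b \<le> real n * d" using d(1) by (simp add: field_simps)
  then show ?thesis using iter d(2) by (intro that[of "M ^ n"]) auto
qed

text \<open>The operator at the smaller of the two times is pulled out, so increments on either side
  are bounded by M times the increment of length |t - s| at 0. Left continuity therefore needs the
  local bound.\<close>

lemma continuous:
  assumes f: "f \<in> L2" shows "L2_continuous_on {0..b} (\<lambda>t. S t f)"
  unfolding L2_continuous_on_def
proof (intro conjI ballI)
  fix s assume s: "s \<in> {0..b}"
  obtain M where M: "M > 0" "\<And>t f. 0 \<le> t \<Longrightarrow> t \<le> b \<Longrightarrow> f \<in> L2 \<Longrightarrow> L2_norm (S t f) \<le> M * L2_norm f"
    using locally_bounded by blast
  have le: "L2_norm (\<lambda>x. S (r + h) f x - S r f x) \<le> M * L2_norm (\<lambda>x. S h f x - f x)"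
    if "0 \<le> r" "0 \<le> h" "r \<le> b" for r h
  proof -
    have "L2_norm (\<lambda>x. S (r + h) f x - S r f x) = L2_norm (\<lambda>x. S r (S h f) x - S r f x)"
      using comp[OF that(1,2) f] that
      by (intro L2_norm_cong L2_diff closed f) (auto simp: eq_ae_def elim: eventually_mono)
    also have "\<dots> = L2_norm (S r (\<lambda>x. S h f x - f x))"
      using that by (intro norm_diff closed f)
    also have "\<dots> \<le> M * L2_norm (\<lambda>x. S h f x - f x)"
      using that by (intro M L2_diff closed f)
    finally show ?thesis .
  qed
  show "((\<lambda>t. L2_norm (\<lambda>x. S t f x - S s f x)) \<longlongrightarrow> 0) (at s within {0..b})"
  proof (rule tendstoI)
    fix e :: real assume e: "e > 0"
    have "e / M > 0" using e M(1) by simp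
    then obtain d where d: "d > 0" "\<And>t. 0 \<le> t \<Longrightarrow> t < d \<Longrightarrow> L2_norm (\<lambda>x. S t f x - f x) < e / M"
      using continuous_0'[OF f] by metis
    have "L2_norm (\<lambda>x. S t f x - S s f x) < e" if "t \<in> {0..b}" "dist t s < d" for t
    proof -
      have "L2_norm (\<lambda>x. S t f x - S s f x) \<le> M * L2_norm (\<lambda>x. S \<bar>t - s\<bar> f x - f x)"
      proof (cases "s \<le> t")
        case True
        then show ?thesis using le[of s "t - s"] s by simp
      next
        case False
        then show ?thesis using le[of t "s - t"] that L2_norm_minus_commute[of "S t f" "S s f"] by simp
      qed
      also have "\<dots> < M * (e / M)"
        using d(2)[of "\<bar>t - s\<bar>"] that M(1) by (intro mult_strict_left_mono) (auto simp: dist_real_def)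
      finally show ?thesis using M(1) by simp
    qed
    then show "\<forall>\<^sub>F t in at s within {0..b}. dist (L2_norm (\<lambda>x. S t f x - S s f x)) 0 < e"
      unfolding eventually_at using d(1) by (intro exI[of _ d]) auto
  qed
qed (use f closed in auto)

end

section \<open>Gevrey functions of order two\<close>

text \<open>A function is carried as the list \<open>D\<close> of all its derivatives,
  \<open>D 0\<close> being the function itself. Derivatives are two-sided, and the constants are
  uniform on \<open>I\<close>.\<close>

definition gevrey_on :: "real set \<Rightarrow> (nat \<Rightarrow> real \<Rightarrow> real) \<Rightarrow> bool" where
  "gevrey_on I D \<longleftrightarrow> (\<forall>n. \<forall>t\<in>I. (D n has_real_derivative D (Suc n) t) (at t)) \<and>
     (\<exists>C M. 0 \<le> C \<and> 0 \<le> M \<and> (\<forall>n. \<forall>t\<in>I. \<bar>D n t\<bar> \<le> C * M ^ n * (fact n)\<^sup>2))"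

lemma gevrey_onI:
  assumes "\<And>n t. t \<in> I \<Longrightarrow> (D n has_real_derivative D (Suc n) t) (at t)"
    and "\<And>n t. t \<in> I \<Longrightarrow> \<bar>D n t\<bar> \<le> C * M ^ n * (fact n)\<^sup>2" and "0 \<le> C" "0 \<le> M"
  shows "gevrey_on I D"
  unfolding gevrey_on_def using assms by blast

lemma gevrey_on_deriv:
  "gevrey_on I D \<Longrightarrow> t \<in> I \<Longrightarrow> (D n has_real_derivative D (Suc n) t) (at t)"
  by (simp add: gevrey_on_def)

lemma gevrey_on_bound:
  assumes "gevrey_on I D"
  obtains C M where "0 \<le> C" "0 \<le> M" "\<And>n t. t \<in> I \<Longrightarrow> \<bar>D n t\<bar> \<le> C * M ^ n * (fact n)\<^sup>2"
  using assms unfolding gevrey_on_def by blast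

lemma gevrey_on_subset: "gevrey_on I D \<Longrightarrow> J \<subseteq> I \<Longrightarrow> gevrey_on J D"
  unfolding gevrey_on_def by blast

text \<open>The derivative list of the product of \<open>D 0\<close> and \<open>E 0\<close>.\<close>

definition leibniz :: "(nat \<Rightarrow> real \<Rightarrow> real) \<Rightarrow> (nat \<Rightarrow> real \<Rightarrow> real) \<Rightarrow> nat \<Rightarrow> real \<Rightarrow> real" where
  "leibniz D E n t = (\<Sum>j\<le>n. real (n choose j) * (D j t * E (n - j) t))"

lemma leibniz_0: "leibniz D E 0 t = D 0 t * E 0 t"
  by (simp add: leibniz_def)

text \<open>Pascal's rule, for an arbitrary array in place of the products of derivatives.\<close>

lemma leibniz_Suc_aux:
  fixes a :: "nat \<Rightarrow> nat \<Rightarrow> real"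
  shows "(\<Sum>j\<le>n. real (n choose j) * (a (Suc j) (n - j) + a j (Suc (n - j)))) = (\<Sum>j\<le>Suc n. real (Suc n choose j) * a j (Suc n - j))"
proof -
  have "(\<Sum>j\<le>Suc n. real (Suc n choose j) * a j (Suc n - j))
     = a 0 (Suc n) + (\<Sum>j\<le>n. real (Suc n choose Suc j) * a (Suc j) (n - j))"
    by (subst sum.atMost_Suc_shift) simp
  also have "\<dots> = (\<Sum>j\<le>n. real (n choose j) * a (Suc j) (n - j)) + (a 0 (Suc n) + (\<Sum>j\<le>n. real (n choose Suc j) * a (Suc j) (n - j)))"
    by (simp add: distrib_right sum.distrib)
  also have "a 0 (Suc n) + (\<Sum>j\<le>n. real (n choose Suc j) * a (Suc j) (n - j)) = (\<Sum>j\<le>Suc n. real (n choose j) * a j (Suc n - j))"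
    by (subst sum.atMost_Suc_shift) simp
  also have "\<dots> = (\<Sum>j\<le>n. real (n choose j) * a j (Suc (n - j)))"
    by (simp add: Suc_diff_le)
  finally show ?thesis by (simp add: distrib_left sum.distrib)
qed

lemma leibniz_deriv:
  assumes D: "\<And>n. (D n has_real_derivative D (Suc n) t) (at t)" and E: "\<And>n. (E n has_real_derivative E (Suc n) t) (at t)"
  shows "(leibniz D E n has_real_derivative leibniz D E (Suc n) t) (at t)"
proof -
  have "((\<lambda>t. \<Sum>j\<le>n. real (n choose j) * (D j t * E (n - j) t)) has_real_derivative
      (\<Sum>j\<le>n. real (n choose j) * (D (Suc j) t * E (n - j) t + D j t * E (Suc (n - j)) t))) (at t)"
    by (intro DERIV_sum DERIV_cmult) (auto intro!: derivative_eq_intros D E)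
  also have "(\<Sum>j\<le>n. real (n choose j) * (D (Suc j) t * E (n - j) t + D j t * E (Suc (n - j)) t)) = leibniz D E (Suc n) t"
    using leibniz_Suc_aux[of n "\<lambda>i j. D i t * E j t"] by (simp add: leibniz_def)
  finally show ?thesis unfolding leibniz_def[abs_def] .
qed

text \<open>Since j! (n-j)! \<le> n!, the squared factorials of both factors are absorbed by (n!)^2,
  and the sum that remains is the binomial expansion of (M1 + M2)^n.\<close>

lemma gevrey_on_leibniz:
  assumes D: "gevrey_on I D" and E: "gevrey_on I E"
  shows "gevrey_on I (leibniz D E)"
proof -
  obtain C1 M1 where 1: "0 \<le> C1" "0 \<le> M1" "\<And>n t. t \<in> I \<Longrightarrow> \<bar>D n t\<bar> \<le> C1 * M1 ^ n * (fact n)\<^sup>2"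
    using gevrey_on_bound[OF D] by blast
  obtain C2 M2 where 2: "0 \<le> C2" "0 \<le> M2" "\<And>n t. t \<in> I \<Longrightarrow> \<bar>E n t\<bar> \<le> C2 * M2 ^ n * (fact n)\<^sup>2"
    using gevrey_on_bound[OF E] by blast
  show ?thesis
  proof (rule gevrey_onI)
    show "(leibniz D E n has_real_derivative leibniz D E (Suc n) t) (at t)" if "t \<in> I" for n t
      using that by (intro leibniz_deriv gevrey_on_deriv[OF D] gevrey_on_deriv[OF E])
    show "\<bar>leibniz D E n t\<bar> \<le> (C1 * C2) * (M1 + M2) ^ n * (fact n)\<^sup>2" if t: "t \<in> I" for n t
    proof -
      have "\<bar>leibniz D E n t\<bar> \<le> (\<Sum>j\<le>n. real (n choose j) * (\<bar>D j t\<bar> * \<bar>E (n - j) t\<bar>))"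
        unfolding leibniz_def by (rule order_trans[OF sum_abs]) (simp add: abs_mult)
      also have "\<dots> \<le> (\<Sum>j\<le>n. (real (n choose j) * M1 ^ j * M2 ^ (n - j)) * (C1 * C2 * (fact n)\<^sup>2))"
      proof (rule sum_mono)
        fix j assume "j \<in> {..n}"
        then have j: "j \<le> n" by simp
        have "fact j * fact (n - j) * 1 \<le> fact j * fact (n - j) * (n choose j)"
          using zero_less_binomial[OF j] by (intro mult_le_mono2) linarith
        then have "fact j * fact (n - j) \<le> (fact n :: nat)"
          unfolding binomial_fact_lemma[OF j] by simp
        then have "real (fact j * fact (n - j)) \<le> real (fact n)" by (simp only: of_nat_le_iff)
        then have f: "(fact j * fact (n - j))\<^sup>2 \<le> ((fact n)\<^sup>2 :: real)"
          by (intro power_mono) auto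
        have "\<bar>D j t\<bar> * \<bar>E (n - j) t\<bar> \<le> (C1 * M1 ^ j * (fact j)\<^sup>2) * (C2 * M2 ^ (n - j) * (fact (n - j))\<^sup>2)"
          using 1 2 t by (intro mult_mono) auto
        also have "\<dots> = (M1 ^ j * M2 ^ (n - j) * C1 * C2) * (fact j * fact (n - j))\<^sup>2"
          by (simp add: power_mult_distrib)
        also have "\<dots> \<le> (M1 ^ j * M2 ^ (n - j) * C1 * C2) * (fact n)\<^sup>2"
          using f 1 2 by (intro mult_left_mono) auto
        finally have "real (n choose j) * (\<bar>D j t\<bar> * \<bar>E (n - j) t\<bar>) \<le> real (n choose j) * ((M1 ^ j * M2 ^ (n - j) * C1 * C2) * (fact n)\<^sup>2)"
          by (rule mult_left_mono) simp
        then show "real (n choose j) * (\<bar>D j t\<bar> * \<bar>E (n - j) t\<bar>) \<le> (real (n choose j) * M1 ^ j * M2 ^ (n - j)) * (C1 * C2 * (fact n)\<^sup>2)"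
          by (simp add: mult_ac)
      qed
      also have "\<dots> = (M1 + M2) ^ n * (C1 * C2 * (fact n)\<^sup>2)"
        unfolding binomial_ring sum_distrib_right by simp
      finally show ?thesis by (simp add: mult_ac)
    qed
  qed (use 1 2 in auto)
qed

lemma gevrey_on_affine:
  assumes "gevrey_on UNIV D"
  shows "gevrey_on UNIV (\<lambda>n t. q ^ n * D n (p + q * t))"
proof -
  obtain C M where *: "0 \<le> C" "0 \<le> M" "\<And>n t. \<bar>D n t\<bar> \<le> C * M ^ n * (fact n)\<^sup>2"
    by (rule gevrey_on_bound[OF assms]) auto
  show ?thesis
  proof (rule gevrey_onI)
    show "((\<lambda>t. q ^ n * D n (p + q * t)) has_real_derivative q ^ Suc n * D (Suc n) (p + q * t)) (at t)" for n t
    proof -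
      have "((\<lambda>t. p + q * t) has_real_derivative q) (at t)" by (auto intro!: derivative_eq_intros)
      from DERIV_cmult[OF DERIV_chain2[OF gevrey_on_deriv[OF assms UNIV_I] this], of "q ^ n"]
      show ?thesis by (simp add: mult_ac)
    qed
    show "\<bar>q ^ n * D n (p + q * t)\<bar> \<le> C * (\<bar>q\<bar> * M) ^ n * (fact n)\<^sup>2" for n t
      using mult_left_mono[OF *(3)[of n "p + q * t"], of "\<bar>q\<bar> ^ n"]
      by (simp add: abs_mult power_abs power_mult_distrib mult_ac)
  qed (use * in auto)
qed

text \<open>The derivatives of exp(-1/t), extended by 0 to t \<le> 0. They are read off from the
  holomorphic function exp(-1/z) on the right half plane, so that Cauchy estimates bound all of them
  at once.\<close>

definition exp_inverse_deriv :: "nat \<Rightarrow> real \<Rightarrow> real" where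
  "exp_inverse_deriv n t = (if 0 < t then Re ((deriv ^^ n) (\<lambda>z. exp (- 1 / z)) (complex_of_real t)) else 0)"

lemma exp_inverse_holomorphic: "(\<lambda>z. exp (- 1 / z)) holomorphic_on {z. 0 < Re z}"
  by (intro holomorphic_intros) auto

text \<open>Cauchy's inequality on the circle of radius t/2 about t: there Re z \<ge> t/2 and |z|
  \<le> 3t/2, so Re (1/z) = Re z / |z|^2 is at least 2/(9t).\<close>

lemma exp_inverse_deriv_bound:
  assumes t: "0 < t"
  shows "\<bar>exp_inverse_deriv n t\<bar> \<le> fact n * exp (- (2 / (9 * t))) * (2 / t) ^ n"
proof -
  let ?G = "\<lambda>z::complex. exp (- 1 / z)"
  have in_ball: "t / 2 \<le> Re z" if "cmod (of_real t - z) \<le> t / 2" for z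
    using abs_Re_le_cmod[of "of_real t - z"] that by simp
  have sub: "cball (of_real t) (t / 2) \<subseteq> {z. 0 < Re z}"
    using in_ball t by (auto simp: dist_norm) (smt (verit) half_gt_zero)
  have "cmod ((deriv ^^ n) ?G (of_real t)) \<le> fact n * exp (- (2 / (9 * t))) / (t / 2) ^ n"
  proof (rule Cauchy_inequality)
    show "?G holomorphic_on ball (of_real t) (t / 2)"
      by (rule holomorphic_on_subset[OF exp_inverse_holomorphic]) (use sub ball_subset_cball in blast)
    show "continuous_on (cball (of_real t) (t / 2)) ?G"
      by (rule holomorphic_on_imp_continuous_on[OF holomorphic_on_subset[OF exp_inverse_holomorphic sub]])
    show "cmod (?G z) \<le> exp (- (2 / (9 * t)))" if z: "cmod (of_real t - z) = t / 2" for z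
    proof -
      have Re: "t / 2 \<le> Re z" using in_ball z by simp
      have "cmod z \<le> cmod (of_real t) + cmod (of_real t - z)"
        using norm_triangle_ineq4[of "of_real t" "of_real t - z"] by simp
      then have "cmod z \<le> 3 * t / 2" using z t by simp
      then have "(cmod z)\<^sup>2 \<le> (3 * t / 2)\<^sup>2" by (intro power_mono) auto
      moreover have "0 < (cmod z)\<^sup>2" using Re t by auto
      moreover have "2 / (9 * t) = (t / 2) / (3 * t / 2)\<^sup>2" using t by (simp add: field_simps power2_eq_square)
      ultimately have "2 / (9 * t) \<le> Re z / (cmod z)\<^sup>2"
        using frac_le[of "Re z" "t / 2" "(cmod z)\<^sup>2" "(3 * t / 2)\<^sup>2"] Re t by simp
      moreover have "Re (- 1 / z) = - (Re z / (cmod z)\<^sup>2)"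
        by (simp add: Re_divide cmod_power2)
      ultimately show ?thesis by (simp add: norm_exp_eq_Re)
    qed
  qed (use t in auto)
  moreover have "\<bar>exp_inverse_deriv n t\<bar> \<le> cmod ((deriv ^^ n) ?G (of_real t))"
    using t by (simp add: exp_inverse_deriv_def abs_Re_le_cmod)
  moreover have "fact n * exp (- (2 / (9 * t))) / (t / 2) ^ n = fact n * exp (- (2 / (9 * t))) * (2 / t) ^ n"
    by (simp add: power_divide)
  ultimately show ?thesis by linarith
qed

lemma power_div_fact_le_exp:
  fixes x :: real
  assumes "0 \<le> x"
  shows "x ^ n / fact n \<le> exp x"
proof -
  have "(\<Sum>k\<in>{n}. x ^ k /\<^sub>R fact k) \<le> exp x"
    unfolding exp_def
    by (rule sum_le_suminf) (use assms summable_exp_generic[of x] in auto)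
  then show ?thesis by (simp add: divide_inverse mult.commute)
qed

lemma exp_minus_le_fact_div_power:
  fixes x :: real assumes "0 < x" shows "exp (- x) \<le> fact n / x ^ n"
  using power_div_fact_le_exp[of x n] assms by (simp add: exp_minus field_simps)

text \<open>One factorial comes from the Cauchy estimate, the other from exp(-x) \<le> n!/x^n with x
  = 2/(9t). The powers of t cancel, and the constant 9 is the quotient of 2/t by 2/(9t).\<close>

lemma gevrey_exp_inverse: "gevrey_on UNIV exp_inverse_deriv"
proof (rule gevrey_onI[where C=1 and M=9])
  show "\<bar>exp_inverse_deriv n t\<bar> \<le> 1 * 9 ^ n * (fact n)\<^sup>2" for n t
  proof (cases "0 < t")
    case True
    have "fact n * exp (- (2 / (9 * t))) * (2 / t) ^ n \<le> fact n * (fact n / (2 / (9 * t)) ^ n) * (2 / t) ^ n"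
      using True by (intro mult_right_mono mult_left_mono exp_minus_le_fact_div_power) auto
    also have "\<dots> = (fact n)\<^sup>2 * ((2 / t) / (2 / (9 * t))) ^ n"
      by (simp only: power_divide power2_eq_square) simp
    also have "(2 / t) / (2 / (9 * t)) = 9" using True by simp
    finally show ?thesis using exp_inverse_deriv_bound[OF True, of n] by (simp add: mult.commute)
  next
    case False
    then show ?thesis by (simp add: exp_inverse_deriv_def)
  qed
  show "(exp_inverse_deriv n has_real_derivative exp_inverse_deriv (Suc n) t) (at t)" for n t
  proof -
    consider "t > 0" | "t < 0" | "t = 0" by linarith
    then show ?thesis
    proof cases
      case 1
      let ?G = "(deriv ^^ n) (\<lambda>z::complex. exp (- 1 / z))"
      have "?G holomorphic_on {z. 0 < Re z}"
        by (intro holomorphic_higher_deriv exp_inverse_holomorphic open_halfspace_Re_gt)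
      then have "(?G has_field_derivative deriv ?G (of_real t)) (at (of_real t))"
        using 1 by (intro holomorphic_derivI[of _ "{z. 0 < Re z}"] open_halfspace_Re_gt) auto
      then have "((\<lambda>u. ?G (of_real u)) has_vector_derivative deriv ?G (of_real t)) (at t)"
        by (rule has_vector_derivative_real_field)
      from bounded_linear.has_vector_derivative[OF bounded_linear_Re this]
      have "((\<lambda>u. Re (?G (of_real u))) has_real_derivative exp_inverse_deriv (Suc n) t) (at t)"
        using 1 by (simp add: has_real_derivative_iff_has_vector_derivative exp_inverse_deriv_def)
      then show ?thesis
        by (rule has_field_derivative_transform_within_open[where S="{0<..}"]) (use 1 in \<open>auto simp: exp_inverse_deriv_def\<close>)
    next
      case 2
      have "((\<lambda>u. 0) has_real_derivative exp_inverse_deriv (Suc n) t) (at t)"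
        using 2 by (simp add: exp_inverse_deriv_def)
      then show ?thesis
        by (rule has_field_derivative_transform_within_open[where S="{..<0}"]) (use 2 in \<open>auto simp: exp_inverse_deriv_def\<close>)
    next
      case 3
      \<comment> \<open>Taking the exponent n + 2 in exp(-x) \<le> (n+2)!/x^(n+2) leaves two spare
        powers of h, so the difference quotient at 0 is O(|h|). The factor 81/4 is (9/2)^2.\<close>
      let ?C = "fact n * fact (n + 2) * 9 ^ n * (81 / 4) :: real"
      have b: "\<bar>exp_inverse_deriv n h\<bar> \<le> ?C * h\<^sup>2" for h
      proof (cases "0 < h")
        case True
        have "fact n * exp (- (2 / (9 * h))) * (2 / h) ^ n \<le> fact n * (fact (n + 2) / (2 / (9 * h)) ^ (n + 2)) * (2 / h) ^ n"
          using True by (intro mult_right_mono mult_left_mono exp_minus_le_fact_div_power) auto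
        also have "\<dots> = fact n * fact (n + 2) * ((2 / h) / (2 / (9 * h))) ^ n * (1 / (2 / (9 * h)))\<^sup>2"
          by (simp only: power_divide power_add) simp
        also have "(2 / h) / (2 / (9 * h)) = 9" using True by simp
        also have "(1 / (2 / (9 * h)))\<^sup>2 = 81 / 4 * h\<^sup>2" by (simp add: power2_eq_square)
        finally have "fact n * exp (- (2 / (9 * h))) * (2 / h) ^ n \<le> fact n * fact (n + 2) * 9 ^ n * (81 / 4 * h\<^sup>2)" .
        from order_trans[OF exp_inverse_deriv_bound[OF True] this] show ?thesis by (simp only: mult.assoc)
      next
        case False
        then show ?thesis by (simp add: exp_inverse_deriv_def)
      qed
      have "((\<lambda>h. (exp_inverse_deriv n (0 + h) - exp_inverse_deriv n 0) / h) \<longlongrightarrow> 0) (at 0)"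
      proof (rule Lim_null_comparison)
        have "\<bar>exp_inverse_deriv n h / h\<bar> \<le> ?C * \<bar>h\<bar>" if h: "h \<noteq> 0" for h
        proof -
          have "\<bar>exp_inverse_deriv n h / h\<bar> \<le> (?C * h\<^sup>2) / \<bar>h\<bar>"
            unfolding abs_divide by (rule divide_right_mono[OF b]) simp
          also have "h\<^sup>2 = \<bar>h\<bar> * \<bar>h\<bar>" by (simp add: power2_eq_square)
          also have "?C * (\<bar>h\<bar> * \<bar>h\<bar>) / \<bar>h\<bar> = ?C * \<bar>h\<bar>"
          proof -
            have "a * (c * c) / c = a * c" if "c \<noteq> 0" for a c :: real using that by simp
            then show ?thesis using h by (simp only: abs_eq_0 not_False_eq_True)
          qed
          finally show ?thesis .
        qed
        then show "\<forall>\<^sub>F h in at 0. norm ((exp_inverse_deriv n (0 + h) - exp_inverse_deriv n 0) / h) \<le> ?C * \<bar>h\<bar>"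
          unfolding eventually_at by (intro exI[of _ 1]) (simp add: exp_inverse_deriv_def[of n 0])
        show "((\<lambda>h. ?C * \<bar>h\<bar>) \<longlongrightarrow> 0) (at (0::real))"
          by (auto intro!: tendsto_eq_intros)
      qed
      then show ?thesis unfolding 3 DERIV_def by (simp add: exp_inverse_deriv_def[of "Suc n" 0])
    qed
  qed
qed auto

text \<open>The step is one minus the normalised primitive of the bump exp(-1/t) exp(-1/(1-t)) on
  (0, 1), so it inherits the Gevrey bounds with derivatives shifted by one index.\<close>

lemma gevrey_step:
  obtains \<theta> where "gevrey_on UNIV \<theta>" "\<And>t. t \<le> 0 \<Longrightarrow> \<theta> 0 t = 1" "\<And>t. 1 \<le> t \<Longrightarrow> \<theta> 0 t = 0" "\<And>t. \<bar>\<theta> 0 t\<bar> \<le> 1"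
    "\<And>n t. t \<le> 0 \<Longrightarrow> \<theta> (Suc n) t = 0" "\<And>n t. 1 \<le> t \<Longrightarrow> \<theta> (Suc n) t = 0"
proof -
  let ?D = exp_inverse_deriv and ?E = "\<lambda>n t. (-1) ^ n * exp_inverse_deriv n (1 + (-1) * t)"
  define b where "b = leibniz ?D ?E"
  have gb: "gevrey_on UNIV b"
    unfolding b_def by (intro gevrey_on_leibniz gevrey_exp_inverse gevrey_on_affine)
  have bz: "b n t = 0" if "t \<le> 0 \<or> 1 \<le> t" for n t
    using that by (auto simp: b_def leibniz_def exp_inverse_deriv_def)
  have b0: "b 0 t = ?D 0 t * ?D 0 (1 - t)" for t by (simp add: b_def leibniz_0)
  have D0: "?D 0 t = (if 0 < t then exp (- 1 / t) else 0)" for t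
  proof -
    have "exp (- 1 / complex_of_real t) = of_real (exp (- 1 / t))"
      by (simp only: exp_of_real[symmetric] of_real_divide of_real_minus of_real_1)
    then show ?thesis by (simp add: exp_inverse_deriv_def)
  qed
  have bpos: "0 < b 0 t" if "0 < t" "t < 1" for t using that by (simp add: b0 D0)
  have bnn: "0 \<le> b 0 t" for t by (simp add: b0 D0)
  obtain F where F: "\<And>t. (F has_real_derivative b 0 t) (at t)"
  proof -
    have "\<exists>F. \<forall>x::real. -\<infinity> < ereal x \<longrightarrow> ereal x < \<infinity> \<longrightarrow> (F has_vector_derivative b 0 x) (at x)"
      using gevrey_on_deriv[OF gb UNIV_I]
      by (intro einterval_antiderivative) (auto intro: DERIV_isCont)
    then show ?thesis using that by (auto simp: has_real_derivative_iff_has_vector_derivative)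
  qed
  have mono: "F s \<le> F t" if "s \<le> t" for s t
    by (rule DERIV_nonneg_imp_nondecreasing[OF that]) (use F bnn in blast)
  have Fl: "F t = F 0" if "t \<le> 0" for t
  proof (rule antisym[OF mono[OF that]])
    show "F 0 \<le> F t"
    proof (rule DERIV_nonpos_imp_nonincreasing[OF that])
      fix x assume "t \<le> x" "x \<le> 0" then show "\<exists>y. (F has_real_derivative y) (at x) \<and> y \<le> 0"
        using F[of x] bz[of x 0] by auto
    qed
  qed
  have Fr: "F t = F 1" if "1 \<le> t" for t
  proof (rule antisym[OF _ mono[OF that]])
    show "F t \<le> F 1"
    proof (rule DERIV_nonpos_imp_nonincreasing[OF that])
      fix x assume "1 \<le> x" "x \<le> t" then show "\<exists>y. (F has_real_derivative y) (at x) \<and> y \<le> 0"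
        using F[of x] bz[of x 0] by auto
    qed
  qed
  have c: "F 0 < F 1"
  proof -
    obtain z where "0 < z" "z < 1" "F 1 - F 0 = (1 - 0) * b 0 z"
      using MVT2[of 0 1 F "b 0"] F by auto
    with bpos[of z] show ?thesis by simp
  qed
  define d where "d = F 1 - F 0"
  have d: "d > 0" using c by (simp add: d_def)
  \<comment> \<open>All derivatives beyond the function itself are those of the bump, shifted by
    one. The enlarged constants 1 + C/d and 1 + M below cover the index 0 and the shift.\<close>
  define \<theta> where "\<theta> n t = (case n of 0 \<Rightarrow> (F 1 - F t) / d | Suc m \<Rightarrow> - b m t / d)" for n t
  have th1: "\<bar>\<theta> 0 t\<bar> \<le> 1" for t
  proof -
    have "F 0 \<le> F t \<and> F t \<le> F 1"
      using mono[of 0 t] mono[of t 1] Fl[of t] Fr[of t] c by (cases "t \<le> 0"; cases "1 \<le> t") auto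
    then show ?thesis using d by (simp add: \<theta>_def d_def)
  qed
  obtain C M where CM: "0 \<le> C" "0 \<le> M" "\<And>n t. \<bar>b n t\<bar> \<le> C * M ^ n * (fact n)\<^sup>2"
    by (rule gevrey_on_bound[OF gb]) auto
  have "gevrey_on UNIV \<theta>"
  proof (rule gevrey_onI)
    show "(\<theta> n has_real_derivative \<theta> (Suc n) t) (at t)" for n t
    proof (cases n)
      case 0
      have "((\<lambda>t. (F 1 - F t) / d) has_real_derivative (0 - b 0 t) / d) (at t)"
        by (intro DERIV_cdivide DERIV_diff DERIV_const F)
      then show ?thesis by (simp add: 0 \<theta>_def[abs_def])
    next
      case (Suc m)
      have "((\<lambda>t. - b m t / d) has_real_derivative - b (Suc m) t / d) (at t)"
        by (intro DERIV_cdivide DERIV_minus gevrey_on_deriv[OF gb UNIV_I])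
      then show ?thesis by (simp add: Suc \<theta>_def[abs_def])
    qed
    show "\<bar>\<theta> n t\<bar> \<le> (1 + C / d) * (1 + M) ^ n * (fact n)\<^sup>2" for n t
    proof (cases n)
      case 0
      then show ?thesis using th1[of t] CM d by (simp add: add_increasing2)
    next
      case (Suc m)
      have "(fact m :: real) \<le> fact (Suc m)" by (rule fact_mono) simp
      then have f: "(fact m)\<^sup>2 \<le> ((fact (Suc m))\<^sup>2 :: real)" by (intro power_mono) auto
      have "M ^ m \<le> (1 + M) ^ m" using CM by (intro power_mono) auto
      also have "\<dots> \<le> (1 + M) ^ Suc m" using CM by (intro power_increasing) auto
      finally have m: "M ^ m \<le> (1 + M) ^ Suc m" .
      have "\<bar>\<theta> n t\<bar> = \<bar>b m t\<bar> / d" using d by (simp add: Suc \<theta>_def)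
      also have "\<dots> \<le> (C * M ^ m * (fact m)\<^sup>2) / d" using CM d by (intro divide_right_mono) auto
      also have "\<dots> = (C / d) * M ^ m * (fact m)\<^sup>2" by simp
      also have "\<dots> \<le> (1 + C / d) * (1 + M) ^ Suc m * (fact (Suc m))\<^sup>2"
        using CM d f m by (intro mult_mono) auto
      finally show ?thesis by (simp only: Suc)
    qed
  qed (use CM d in auto)
  then show ?thesis
  proof (rule that)
    show "\<theta> 0 t = 1" if "t \<le> 0" for t using Fl[OF that] d by (simp add: \<theta>_def d_def)
    show "\<theta> 0 t = 0" if "1 \<le> t" for t using Fr[OF that] by (simp add: \<theta>_def)
    show "\<theta> (Suc n) t = 0" if "t \<le> 0" for n t using bz[of t n] that by (simp add: \<theta>_def)
    show "\<theta> (Suc n) t = 0" if "1 \<le> t" for n t using bz[of t n] that by (simp add: \<theta>_def)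
  qed (rule th1)
qed

section \<open>The convolution kernel\<close>

text \<open>The mean value inequality dominates the difference quotients by the bound
  \<open>g\<close> on the derivative, and dominated convergence applies along every sequence of
  parameters tending to t0.\<close>

lemma has_real_derivative_integral:
  fixes f f' :: "real \<Rightarrow> 'a \<Rightarrow> real"
  assumes r: "r > 0"
    and deriv: "\<And>t x. \<bar>t - t0\<bar> < r \<Longrightarrow> x \<in> space M \<Longrightarrow> ((\<lambda>t. f t x) has_real_derivative f' t x) (at t)"
    and int: "\<And>t. \<bar>t - t0\<bar> < r \<Longrightarrow> integrable M (f t)"
    and meas: "f' t0 \<in> borel_measurable M"
    and bound: "\<And>t x. \<bar>t - t0\<bar> < r \<Longrightarrow> x \<in> space M \<Longrightarrow> \<bar>f' t x\<bar> \<le> g x"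
    and g: "integrable M g"
  shows "((\<lambda>t. integral\<^sup>L M (f t)) has_real_derivative integral\<^sup>L M (f' t0)) (at t0)"
  unfolding has_field_derivative_iff
proof (subst tendsto_at_iff_sequentially, intro allI impI)
  fix X :: "nat \<Rightarrow> real" assume X: "\<forall>i. X i \<in> UNIV - {t0}" and lim: "X \<longlonglongrightarrow> t0"
  have "\<forall>\<^sub>F n in sequentially. dist (X n) t0 < r" using tendstoD[OF lim r] .
  then obtain N where N: "\<And>n. n \<ge> N \<Longrightarrow> \<bar>X n - t0\<bar> < r"
    by (auto simp: eventually_sequentially dist_real_def)
  define Y where "Y n = X (n + N)" for n
  have Y: "\<bar>Y n - t0\<bar> < r" "Y n \<noteq> t0" for n using N X by (auto simp: Y_def)
  have Ylim: "Y \<longlonglongrightarrow> t0" unfolding Y_def using lim by (rule LIMSEQ_ignore_initial_segment)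
  have "(\<lambda>n. integral\<^sup>L M (\<lambda>x. (f (Y n) x - f t0 x) / (Y n - t0))) \<longlonglongrightarrow> integral\<^sup>L M (f' t0)"
  proof (rule integral_dominated_convergence[where w=g])
    show "(\<lambda>x. (f (Y n) x - f t0 x) / (Y n - t0)) \<in> borel_measurable M" for n
    proof -
      have [measurable]: "f (Y n) \<in> borel_measurable M" "f t0 \<in> borel_measurable M"
        using int[OF Y(1)[of n]] int[of t0] r by auto
      show ?thesis by measurable
    qed
    show "AE x in M. (\<lambda>n. (f (Y n) x - f t0 x) / (Y n - t0)) \<longlonglongrightarrow> f' t0 x"
    proof (rule AE_I2)
      fix x assume "x \<in> space M"
      from deriv[OF _ this, of t0] r have "((\<lambda>t. (f t x - f t0 x) / (t - t0)) \<longlongrightarrow> f' t0 x) (at t0)"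
        by (simp add: has_field_derivative_iff)
      with Y Ylim show "(\<lambda>n. (f (Y n) x - f t0 x) / (Y n - t0)) \<longlonglongrightarrow> f' t0 x"
        unfolding tendsto_at_iff_sequentially by (auto simp: o_def)
    qed
    show "AE x in M. norm ((f (Y n) x - f t0 x) / (Y n - t0)) \<le> g x" for n
    proof (rule AE_I2)
      fix x assume x: "x \<in> space M"
      have "norm (f (Y n) x - f t0 x) \<le> g x * norm (Y n - t0)"
      proof (rule field_differentiable_bound[where S="{t. \<bar>t - t0\<bar> < r}" and f'="\<lambda>t. f' t x"])
        have "{t. \<bar>t - t0\<bar> < r} = ball t0 r" by (auto simp: dist_real_def)
        then show "convex {t. \<bar>t - t0\<bar> < r}" by simp
        show "((\<lambda>t. f t x) has_field_derivative f' z x) (at z within {t. \<bar>t - t0\<bar> < r})"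
          if "z \<in> {t. \<bar>t - t0\<bar> < r}" for z
          using deriv[OF _ x, of z] that by (auto intro: has_field_derivative_at_within)
      qed (use bound x Y r in auto)
      then show "norm ((f (Y n) x - f t0 x) / (Y n - t0)) \<le> g x"
        using Y(2)[of n] by (simp add: divide_simps)
    qed
  qed (use meas g in auto)
  then have "(\<lambda>n. (integral\<^sup>L M (f (Y n)) - integral\<^sup>L M (f t0)) / (Y n - t0)) \<longlonglongrightarrow> integral\<^sup>L M (f' t0)"
    using int Y(1) r by simp
  then show "((\<lambda>t. (integral\<^sup>L M (f t) - integral\<^sup>L M (f t0)) / (t - t0)) \<circ> X) \<longlonglongrightarrow> integral\<^sup>L M (f' t0)"
    unfolding Y_def o_def by (rule LIMSEQ_offset)
qed

section \<open>Gaussian moments\<close>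

lemma Gaussian_integral:
  assumes "p > 0"
  shows "integrable lborel (\<lambda>x::real. exp (- (p * x\<^sup>2)))"
    and "integral\<^sup>L lborel (\<lambda>x::real. exp (- (p * x\<^sup>2))) = sqrt (pi / p)"
proof -
  \<comment> \<open>The standard deviation for which the normal density is proportional to the given
    Gaussian.\<close>
  let ?s = "sqrt (1 / (2 * p))"
  have s2: "?s\<^sup>2 = 1 / (2 * p)" using assms by simp
  have "has_bochner_integral lborel (\<lambda>x. normal_density 0 ?s x * (x - 0)^(2 * 0)) (fact (2 * 0) / ((2 / ?s\<^sup>2)^0 * fact 0))"
    by (rule normal_moment_even) (use assms in simp)
  then have "has_bochner_integral lborel (\<lambda>x. normal_density 0 ?s x) 1" by simp
  then have "has_bochner_integral lborel (\<lambda>x. sqrt (pi / p) * normal_density 0 ?s x) (sqrt (pi / p) * 1)"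
    by (rule has_bochner_integral_mult_right)
  moreover have "sqrt (pi / p) * normal_density 0 ?s x = exp (- (p * x\<^sup>2))" for x
    unfolding normal_density_def s2 using assms by (simp add: field_simps real_sqrt_divide real_sqrt_mult)
  ultimately have "has_bochner_integral lborel (\<lambda>x. exp (- (p * x\<^sup>2))) (sqrt (pi / p))"
    by simp
  then show "integrable lborel (\<lambda>x::real. exp (- (p * x\<^sup>2)))"
    and "integral\<^sup>L lborel (\<lambda>x::real. exp (- (p * x\<^sup>2))) = sqrt (pi / p)"
    by (auto simp: has_bochner_integral_iff)
qed

text \<open>Half of the Gaussian exponent is spent on the power of \<xi>, the other half is
  integrated. The growth like sqrt(k!) is what makes the convolution entire in x.\<close>

definition moment_bound :: "nat \<Rightarrow> real \<Rightarrow> real" where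
  "moment_bound k p = sqrt (fact k) / sqrt p ^ k * sqrt (pi / (p / 2))"

lemma moment_bound_nonneg: "p > 0 \<Longrightarrow> 0 \<le> moment_bound k p"
  by (simp add: moment_bound_def)

text \<open>This is the square root of y^k \<le> k! exp(y) at y = p \<xi>^2.\<close>

lemma power_mult_Gaussian_le:
  fixes \<xi> p :: real
  assumes p: "p > 0"
  shows "\<bar>\<xi>\<bar> ^ k * exp (- (p * \<xi>\<^sup>2)) \<le> sqrt (fact k) / sqrt p ^ k * exp (- (p / 2 * \<xi>\<^sup>2))"
proof -
  have "(p * \<xi>\<^sup>2) ^ k \<le> fact k * exp (p * \<xi>\<^sup>2)"
    using power_div_fact_le_exp[of "p * \<xi>\<^sup>2" k] p by (simp add: divide_simps mult.commute)
  then have "sqrt ((p * \<xi>\<^sup>2) ^ k) \<le> sqrt (fact k * exp (p * \<xi>\<^sup>2))" by simp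
  moreover have "sqrt ((p * \<xi>\<^sup>2) ^ k) = sqrt p ^ k * \<bar>\<xi>\<bar> ^ k"
  proof -
    have "sqrt (p * \<xi>\<^sup>2) = sqrt p * \<bar>\<xi>\<bar>" by (simp only: real_sqrt_mult real_sqrt_abs)
    then have "sqrt (p * \<xi>\<^sup>2) ^ k = sqrt p ^ k * \<bar>\<xi>\<bar> ^ k" by (simp only: power_mult_distrib)
    then show ?thesis by (simp only: real_sqrt_power)
  qed
  moreover have "sqrt (exp (p * \<xi>\<^sup>2)) = exp (p / 2 * \<xi>\<^sup>2)"
    by (rule real_sqrt_unique) (auto simp: power2_eq_square exp_add[symmetric] field_simps)
  ultimately have "sqrt p ^ k * \<bar>\<xi>\<bar> ^ k \<le> sqrt (fact k) * exp (p / 2 * \<xi>\<^sup>2)"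
    by (simp add: real_sqrt_mult)
  then have "\<bar>\<xi>\<bar> ^ k \<le> sqrt (fact k) / sqrt p ^ k * exp (p / 2 * \<xi>\<^sup>2)"
    using p by (simp add: field_simps)
  then have "\<bar>\<xi>\<bar> ^ k * exp (- (p * \<xi>\<^sup>2)) \<le> (sqrt (fact k) / sqrt p ^ k * exp (p / 2 * \<xi>\<^sup>2)) * exp (- (p * \<xi>\<^sup>2))"
    by (rule mult_right_mono) simp
  also have "\<dots> = sqrt (fact k) / sqrt p ^ k * exp (- (p / 2 * \<xi>\<^sup>2))"
    by (simp add: mult.assoc exp_add[symmetric] del: exp_add)
  finally show ?thesis .
qed

lemma Gaussian_moment:
  assumes "p > 0"
  shows "integrable lborel (\<lambda>\<xi>::real. \<bar>\<xi>\<bar> ^ k * exp (- (p * \<xi>\<^sup>2)))"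
    and "integral\<^sup>L lborel (\<lambda>\<xi>::real. \<bar>\<xi>\<bar> ^ k * exp (- (p * \<xi>\<^sup>2))) \<le> moment_bound k p"
proof -
  have i: "integrable lborel (\<lambda>\<xi>::real. sqrt (fact k) / sqrt p ^ k * exp (- (p / 2 * \<xi>\<^sup>2)))"
    using Gaussian_integral(1)[of "p / 2"] assms by (intro integrable_mult_right) simp
  show 1: "integrable lborel (\<lambda>\<xi>::real. \<bar>\<xi>\<bar> ^ k * exp (- (p * \<xi>\<^sup>2)))"
    by (rule Bochner_Integration.integrable_bound[OF i])
       (use power_mult_Gaussian_le[OF assms] assms in \<open>auto simp: abs_mult power_abs\<close>)
  have "integral\<^sup>L lborel (\<lambda>\<xi>::real. \<bar>\<xi>\<bar> ^ k * exp (- (p * \<xi>\<^sup>2))) \<le> integral\<^sup>L lborel (\<lambda>\<xi>::real. sqrt (fact k) / sqrt p ^ k * exp (- (p / 2 * \<xi>\<^sup>2)))"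
    using power_mult_Gaussian_le[OF assms] by (intro integral_mono 1 i)
  also have "\<dots> = moment_bound k p"
    unfolding moment_bound_def using Gaussian_integral(2)[of "p / 2"] assms by simp
  finally show "integral\<^sup>L lborel (\<lambda>\<xi>::real. \<bar>\<xi>\<bar> ^ k * exp (- (p * \<xi>\<^sup>2))) \<le> moment_bound k p" .
qed

text \<open>
  \<open>ekernel k p s\<close> is the \<open>k\<close>-th derivative of the function with Fourier transform
  \<open>exp (- p \<xi>\<^sup>2 + \<i> s \<xi>\<^sup>3)\<close>, so \<open>ekernel 0 t t\<close> is the convolution kernel of the semigroup.
\<close>

definition kernel_integrand :: "nat \<Rightarrow> real \<Rightarrow> real \<Rightarrow> real \<Rightarrow> real \<Rightarrow> real" where
  "kernel_integrand k p s x \<xi> = \<xi> ^ k * cos (x * \<xi> + s * \<xi> ^ 3 + real k * (pi / 2)) * exp (- (p * \<xi>\<^sup>2))"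

definition ekernel :: "nat \<Rightarrow> real \<Rightarrow> real \<Rightarrow> real \<Rightarrow> real" where
  "ekernel k p s x = integral\<^sup>L lborel (kernel_integrand k p s x) / (2 * pi)"

lemma kernel_integrand_measurable [measurable]: "kernel_integrand k p s x \<in> borel_measurable borel"
  unfolding kernel_integrand_def by measurable

lemma kernel_integrand_bound: "\<bar>kernel_integrand k p s x \<xi>\<bar> \<le> \<bar>\<xi>\<bar> ^ k * exp (- (p * \<xi>\<^sup>2))"
  by (auto simp: kernel_integrand_def abs_mult power_abs intro!: mult_right_mono mult_left_le)

lemma kernel_integrand_integrable:
  assumes "p > 0" shows "integrable lborel (kernel_integrand k p s x)"
  by (rule Bochner_Integration.integrable_bound[OF Gaussian_moment(1)[OF assms, of k]])
     (use kernel_integrand_bound[of k p s x] in \<open>auto simp: abs_mult power_abs\<close>)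

lemma kernel_integrand_Suc_Suc: "kernel_integrand (k + 2) p s x \<xi> = - (\<xi>\<^sup>2 * kernel_integrand k p s x \<xi>)"
proof -
  have "cos (a + real (k + 2) * (pi / 2)) = - cos (a + real k * (pi / 2))" for a
  proof -
    have "a + real (k + 2) * (pi / 2) = (a + real k * (pi / 2)) + pi" by (simp add: field_simps)
    then show ?thesis by (simp only: cos_periodic_pi)
  qed
  then show ?thesis by (simp add: kernel_integrand_def power_add power2_eq_square del: of_nat_add)
qed

lemma minus_sin_quarter: "- sin (a + real k * (pi / 2)) = cos (a + real (Suc k) * (pi / 2))"
proof -
  have "a + real (Suc k) * (pi / 2) = (a + real k * (pi / 2)) + pi / 2" by (simp add: field_simps)
  then show ?thesis by (simp only: cos_add cos_pi_half sin_pi_half)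
qed

lemma kernel_integrand_deriv_x:
  "((\<lambda>x. kernel_integrand k p s x \<xi>) has_real_derivative kernel_integrand (Suc k) p s x \<xi>) (at x)"
  unfolding kernel_integrand_def minus_sin_quarter[symmetric]
  by (auto intro!: derivative_eq_intros)

text \<open>The derivative in p multiplies by -\<xi>^2, which is two space derivatives; the
  derivative in s is minus three space derivatives. Along a general line in the (p, s) plane, b = e
  = 1 gives the equation itself and b = 1, e = 0 the heat equation.\<close>

lemma kernel_integrand_deriv_t:
  "((\<lambda>t. kernel_integrand k (a + b * t) (c + e * t) x \<xi>) has_real_derivative
     b * kernel_integrand (k + 2) (a + b * t) (c + e * t) x \<xi> - e * kernel_integrand (k + 3) (a + b * t) (c + e * t) x \<xi>) (at t)"
proof -
  have 3: "kernel_integrand (k + 3) p s x \<xi> = - (\<xi>\<^sup>2 * kernel_integrand (Suc k) p s x \<xi>)" for p s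
    using kernel_integrand_Suc_Suc[of "Suc k" p s x \<xi>] by (simp add: numeral_eq_Suc)
  show ?thesis
    unfolding kernel_integrand_Suc_Suc 3
    unfolding kernel_integrand_def minus_sin_quarter[symmetric]
    by (auto intro!: derivative_eq_intros simp: algebra_simps power2_eq_square power3_eq_cube)
qed

lemma kernel_abs_le_moment:
  assumes "p > 0" shows "\<bar>ekernel k p s x\<bar> \<le> moment_bound k p"
proof -
  have "\<bar>integral\<^sup>L lborel (kernel_integrand k p s x)\<bar> \<le> integral\<^sup>L lborel (\<lambda>\<xi>::real. \<bar>\<xi>\<bar> ^ k * exp (- (p * \<xi>\<^sup>2)))"
    by (rule order_trans[OF integral_abs_bound])
       (intro integral_mono integrable_abs kernel_integrand_integrable Gaussian_moment kernel_integrand_bound assms)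
  also have "\<dots> \<le> moment_bound k p" by (rule Gaussian_moment(2)[OF assms])
  finally have *: "\<bar>integral\<^sup>L lborel (kernel_integrand k p s x)\<bar> \<le> moment_bound k p" .
  have "\<bar>ekernel k p s x\<bar> = \<bar>integral\<^sup>L lborel (kernel_integrand k p s x)\<bar> / (2 * pi)"
    by (simp add: ekernel_def abs_mult)
  also have "\<dots> \<le> \<bar>integral\<^sup>L lborel (kernel_integrand k p s x)\<bar> / 1"
    using pi_gt3 by (intro divide_left_mono) auto
  finally show ?thesis using * by simp
qed

lemma kernel_deriv_x:
  assumes p: "p > 0"
  shows "(ekernel k p s has_real_derivative ekernel (Suc k) p s x) (at x)"
  unfolding ekernel_def
  by (intro DERIV_cdivide has_real_derivative_integral[where r=1 and g="\<lambda>\<xi>. \<bar>\<xi>\<bar> ^ Suc k * exp (- (p * \<xi>\<^sup>2))"]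
      kernel_integrand_deriv_x kernel_integrand_integrable kernel_integrand_bound Gaussian_moment p) auto

lemma kernel_deriv_t:
  assumes p: "a + b * t > 0"
  shows "((\<lambda>t. ekernel k (a + b * t) (c + e * t) x) has_real_derivative
     b * ekernel (k + 2) (a + b * t) (c + e * t) x - e * ekernel (k + 3) (a + b * t) (c + e * t) x) (at t)"
proof -
  \<comment> \<open>Half of the current p stays a lower bound for p at all times within r, so one
    Gaussian moment dominates the derivatives near t.\<close>
  define p0 where "p0 = (a + b * t) / 2"
  define r where "r = p0 / (\<bar>b\<bar> + 1)"
  have p0: "p0 > 0" using p by (simp add: p0_def)
  have r: "r > 0" using p0 by (simp add: r_def)
  have near: "p0 \<le> a + b * u" if "\<bar>u - t\<bar> < r" for u
  proof -
    have "\<bar>b * (u - t)\<bar> \<le> (\<bar>b\<bar> + 1) * r" unfolding abs_mult using that by (intro mult_mono) auto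
    also have "\<dots> = p0" by (simp add: r_def)
    finally have "b * (u - t) \<ge> - p0" by linarith
    moreover have "- ((a + X) / 2) \<le> Y - X \<Longrightarrow> (a + X) / 2 \<le> a + Y" for X Y by (simp add: field_simps)
    ultimately show ?thesis unfolding p0_def right_diff_distrib by blast
  qed
  have bd: "\<bar>kernel_integrand k (a + b * u) s x \<xi>\<bar> \<le> \<bar>\<xi>\<bar> ^ k * exp (- (p0 * \<xi>\<^sup>2))"
    if "\<bar>u - t\<bar> < r" for k u s \<xi>
  proof (rule order_trans[OF kernel_integrand_bound])
    show "\<bar>\<xi>\<bar> ^ k * exp (- ((a + b * u) * \<xi>\<^sup>2)) \<le> \<bar>\<xi>\<bar> ^ k * exp (- (p0 * \<xi>\<^sup>2))"
      using near[OF that] by (intro mult_left_mono) (auto intro: mult_right_mono)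
  qed
  let ?g = "\<lambda>\<xi>. \<bar>b\<bar> * (\<bar>\<xi>\<bar> ^ (k + 2) * exp (- (p0 * \<xi>\<^sup>2))) + \<bar>e\<bar> * (\<bar>\<xi>\<bar> ^ (k + 3) * exp (- (p0 * \<xi>\<^sup>2)))"
  have "((\<lambda>t. integral\<^sup>L lborel (kernel_integrand k (a + b * t) (c + e * t) x)) has_real_derivative
     integral\<^sup>L lborel (\<lambda>\<xi>. b * kernel_integrand (k + 2) (a + b * t) (c + e * t) x \<xi> - e * kernel_integrand (k + 3) (a + b * t) (c + e * t) x \<xi>)) (at t)"
  proof (rule has_real_derivative_integral[where r=r and g="?g", OF r kernel_integrand_deriv_t])
    show "integrable lborel (kernel_integrand k (a + b * u) (c + e * u) x)" if "\<bar>u - t\<bar> < r" for u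
      using near[OF that] p0 by (intro kernel_integrand_integrable) simp
    show "\<bar>b * kernel_integrand (k + 2) (a + b * u) (c + e * u) x \<xi> - e * kernel_integrand (k + 3) (a + b * u) (c + e * u) x \<xi>\<bar> \<le> ?g \<xi>"
      if "\<bar>u - t\<bar> < r" for u \<xi>
      using mult_left_mono[OF bd[OF that, of "k + 2" "c + e * u" \<xi>] abs_ge_zero[of b]]
        mult_left_mono[OF bd[OF that, of "k + 3" "c + e * u" \<xi>] abs_ge_zero[of e]]
      unfolding abs_mult[symmetric] by linarith
    show "integrable lborel ?g"
      by (intro Bochner_Integration.integrable_add integrable_mult_right Gaussian_moment p0)
  qed auto
  then have "((\<lambda>t. integral\<^sup>L lborel (kernel_integrand k (a + b * t) (c + e * t) x) / (2 * pi)) has_real_derivative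
     integral\<^sup>L lborel (\<lambda>\<xi>. b * kernel_integrand (k + 2) (a + b * t) (c + e * t) x \<xi> - e * kernel_integrand (k + 3) (a + b * t) (c + e * t) x \<xi>) / (2 * pi)) (at t)"
    by (rule DERIV_cdivide)
  then show ?thesis unfolding ekernel_def
    using kernel_integrand_integrable[OF p] by (simp add: diff_divide_distrib)
qed

lemma integral_deriv_eq_0:
  fixes F f :: "real \<Rightarrow> real"
  assumes F: "\<And>x. (F has_real_derivative f x) (at x)" and cont: "continuous_on UNIV f"
    and int: "integrable lborel f"
    and lim: "(\<lambda>n. F (real n)) \<longlonglongrightarrow> 0" "(\<lambda>n. F (- real n)) \<longlonglongrightarrow> 0"
  shows "integral\<^sup>L lborel f = 0"
proof -
  have "(\<lambda>n. integral\<^sup>L lborel (\<lambda>x. indicator {- real n..real n} x *\<^sub>R f x)) \<longlonglongrightarrow> integral\<^sup>L lborel f"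
  proof (rule integral_dominated_convergence[where w="\<lambda>x. \<bar>f x\<bar>"])
    show "AE x in lborel. (\<lambda>n. indicator {- real n..real n} x *\<^sub>R f x) \<longlonglongrightarrow> f x"
    proof (intro AE_I2 Lim_transform_eventually[OF tendsto_const])
      fix x :: real
      obtain N :: nat where N: "\<bar>x\<bar> \<le> N" using real_arch_simple by blast
      show "\<forall>\<^sub>F n in sequentially. f x = indicator {- real n..real n} x *\<^sub>R f x"
        using eventually_ge_at_top[of N] by eventually_elim (use N in \<open>auto split: split_indicator\<close>)
    qed
  qed (use int in \<open>auto split: split_indicator\<close>)
  moreover have "integral\<^sup>L lborel (\<lambda>x. indicator {- real n..real n} x *\<^sub>R f x) = F (real n) - F (- real n)" for n
    by (rule integral_FTC_atLeastAtMost)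
       (auto intro!: has_vector_derivative_at_within F[unfolded has_real_derivative_iff_has_vector_derivative]
          continuous_on_subset[OF cont])
  moreover have "(\<lambda>n. F (real n) - F (- real n)) \<longlonglongrightarrow> 0 - 0"
    by (intro tendsto_diff lim)
  ultimately show ?thesis using LIMSEQ_unique by fastforce
qed

text \<open>Integration by parts in \<xi>: the derivative of \<xi>^k sin(phase) exp(-p \<xi>^2) has
  integral zero. A factor x is thereby traded for derivatives of the kernel, which is the source of
  its spatial decay.\<close>

lemma kernel_recursion:
  assumes p: "p > 0"
  shows "x * ekernel k p s x = - real k * ekernel (k - 1) p s x + 3 * s * ekernel (k + 2) p s x - 2 * p * ekernel (k + 1) p s x"
proof -
  define \<alpha> where "\<alpha> \<xi> = x * \<xi> + s * \<xi> ^ 3 + real k * (pi / 2)" for \<xi>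
  define F where "F \<xi> = \<xi> ^ k * sin (\<alpha> \<xi>) * exp (- (p * \<xi>\<^sup>2))" for \<xi>
  define f where "f \<xi> = real k * kernel_integrand (k - 1) p s x \<xi> + x * kernel_integrand k p s x \<xi>
     - 3 * s * kernel_integrand (k + 2) p s x \<xi> + 2 * p * kernel_integrand (k + 1) p s x \<xi>" for \<xi>
  have k1: "kernel_integrand (k + 1) p s x \<xi> = - (\<xi> * \<xi> ^ k * sin (\<alpha> \<xi>) * exp (- (p * \<xi>\<^sup>2)))" for \<xi>
    unfolding kernel_integrand_def \<alpha>_def Suc_eq_plus1[symmetric] minus_sin_quarter[symmetric] by simp
  \<comment> \<open>For k = 0 the index k - 1 truncates to 0, harmlessly, as the coefficient
    \<open>real k\<close> vanishes.\<close>
  have km: "real k * kernel_integrand (k - 1) p s x \<xi> = real k * \<xi> ^ (k - 1) * sin (\<alpha> \<xi>) * exp (- (p * \<xi>\<^sup>2))" for \<xi>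
  proof (cases k)
    case (Suc j)
    have "\<alpha> \<xi> = (x * \<xi> + s * \<xi> ^ 3 + real j * (pi / 2)) + pi / 2"
      unfolding \<alpha>_def Suc by (simp add: field_simps)
    then have "sin (\<alpha> \<xi>) = cos (x * \<xi> + s * \<xi> ^ 3 + real j * (pi / 2))"
      by (simp only: sin_add cos_pi_half sin_pi_half)
    then show ?thesis by (simp add: Suc kernel_integrand_def)
  qed simp
  have F: "(F has_real_derivative f \<xi>) (at \<xi>)" for \<xi>
  proof -
    have "((\<lambda>\<xi>. \<xi> ^ k * sin (x * \<xi> + s * \<xi> ^ 3 + real k * (pi / 2)) * exp (- (p * \<xi>\<^sup>2))) has_real_derivative
        real k * \<xi> ^ (k - 1) * sin (\<alpha> \<xi>) * exp (- (p * \<xi>\<^sup>2))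
      + (x + 3 * s * \<xi>\<^sup>2) * (\<xi> ^ k * cos (\<alpha> \<xi>) * exp (- (p * \<xi>\<^sup>2)))
      - 2 * p * (\<xi> * \<xi> ^ k * sin (\<alpha> \<xi>) * exp (- (p * \<xi>\<^sup>2)))) (at \<xi>)"
      unfolding \<alpha>_def by (auto intro!: derivative_eq_intros simp: algebra_simps)
    then show ?thesis
      unfolding F_def f_def km k1 kernel_integrand_Suc_Suc
      unfolding \<alpha>_def kernel_integrand_def by (simp add: algebra_simps)
  qed
  have "integral\<^sup>L lborel f = 0"
  proof (rule integral_deriv_eq_0[OF F])
    show "continuous_on UNIV f"
      unfolding f_def kernel_integrand_def by (intro continuous_intros)
    show "integrable lborel f"
      unfolding f_def by (intro Bochner_Integration.integrable_add Bochner_Integration.integrable_diff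
          integrable_mult_right kernel_integrand_integrable p)
    let ?C = "sqrt (fact k) / sqrt p ^ k"
    have b: "\<bar>F \<xi>\<bar> \<le> ?C * exp (- (p / 2 * \<xi>\<^sup>2))" for \<xi>
    proof -
      have "\<bar>F \<xi>\<bar> \<le> \<bar>\<xi>\<bar> ^ k * exp (- (p * \<xi>\<^sup>2))"
        by (auto simp: F_def abs_mult power_abs intro!: mult_right_mono mult_left_le)
      also note power_mult_Gaussian_le[OF p]
      finally show ?thesis .
    qed
    have l: "(\<lambda>n. ?C * exp (- (p / 2 * (real n)\<^sup>2))) \<longlonglongrightarrow> 0"
      using p by real_asymp
    show "(\<lambda>n. F (real n)) \<longlonglongrightarrow> 0" "(\<lambda>n. F (- real n)) \<longlonglongrightarrow> 0"
      by (rule Lim_null_comparison[OF _ l]; use b[of "real _"] b[of "- real _"] in simp)+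
  qed
  moreover have "integral\<^sup>L lborel f = 2 * pi * (real k * ekernel (k - 1) p s x + x * ekernel k p s x
     - 3 * s * ekernel (k + 2) p s x + 2 * p * ekernel (k + 1) p s x)"
    unfolding f_def ekernel_def
    using kernel_integrand_integrable[OF p] by (simp add: distrib_left right_diff_distrib)
  ultimately show ?thesis by simp
qed

definition kernel_bound :: "nat \<Rightarrow> real \<Rightarrow> real \<Rightarrow> real" where
  "kernel_bound k p R = moment_bound k p + real k * moment_bound (k - 1) p
     + 3 * R * moment_bound (k + 2) p + 2 * R * moment_bound (k + 1) p"

lemma moment_bound_antimono:
  assumes "0 < p" "p \<le> q" shows "moment_bound k q \<le> moment_bound k p"
  unfolding moment_bound_def
  using assms by (intro mult_mono divide_left_mono power_mono real_sqrt_le_mono) auto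

lemma kernel_bound_nonneg: "0 < p \<Longrightarrow> 0 \<le> R \<Longrightarrow> 0 \<le> kernel_bound k p R"
  unfolding kernel_bound_def by (auto intro!: add_nonneg_nonneg mult_nonneg_nonneg moment_bound_nonneg)

text \<open>The recursion bounds |x| times the kernel by kernels without the factor x, each
  controlled by its moment bound; \<open>kernel_bound\<close> collects these terms for p \<ge> p0
  and p, |s| \<le> R. A single power of decay is enough for square integrability.\<close>

lemma kernel_decay:
  assumes p: "0 < p0" "p0 \<le> p" "p \<le> R" and s: "\<bar>s\<bar> \<le> R"
  shows "\<bar>ekernel k p s x\<bar> \<le> kernel_bound k p0 R / (1 + \<bar>x\<bar>)"
proof -
  have p': "p > 0" using p by simp
  have m: "\<bar>ekernel k p s x\<bar> \<le> moment_bound k p0" for k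
    using kernel_abs_le_moment[OF p'] moment_bound_antimono[OF p(1,2)] order_trans by blast
  have "\<bar>x * ekernel k p s x\<bar> \<le> real k * \<bar>ekernel (k - 1) p s x\<bar> + 3 * \<bar>s\<bar> * \<bar>ekernel (k + 2) p s x\<bar> + 2 * p * \<bar>ekernel (k + 1) p s x\<bar>"
  proof -
    have "\<bar>a + b - c\<bar> \<le> \<bar>a\<bar> + \<bar>b\<bar> + \<bar>c\<bar>" for a b c :: real by linarith
    from this[of "- real k * ekernel (k - 1) p s x" "3 * s * ekernel (k + 2) p s x" "2 * p * ekernel (k + 1) p s x"]
    show ?thesis unfolding kernel_recursion[OF p'] using p' by (simp add: abs_mult)
  qed
  also have "\<dots> \<le> real k * moment_bound (k - 1) p0 + 3 * R * moment_bound (k + 2) p0 + 2 * R * moment_bound (k + 1) p0"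
    using p s p' by (intro add_mono mult_mono m mult_nonneg_nonneg) auto
  finally have "\<bar>x * ekernel k p s x\<bar> + \<bar>ekernel k p s x\<bar> \<le> kernel_bound k p0 R"
    using m[of k] unfolding kernel_bound_def by linarith
  then have "\<bar>ekernel k p s x\<bar> * (1 + \<bar>x\<bar>) \<le> kernel_bound k p0 R"
    by (simp add: abs_mult algebra_simps)
  then show ?thesis by (simp add: pos_le_divide_eq)
qed

text \<open>For s = 0 and k = 0 the recursion is the differential equation K' = -x/(2p) K, so K
  exp(x^2/(4p)) is constant; its value at 0 is a Gaussian integral.\<close>

lemma kernel_Gaussian:
  assumes p: "p > 0"
  shows "ekernel 0 p 0 x = exp (- (x\<^sup>2 / (4 * p))) / sqrt (4 * pi * p)"
proof -
  let ?h = "\<lambda>x. ekernel 0 p 0 x * exp (x\<^sup>2 / (4 * p))"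
  have K1: "ekernel (Suc 0) p 0 y = - y / (2 * p) * ekernel 0 p 0 y" for y
    using kernel_recursion[OF p, of y 0 0] p by (simp add: field_simps)
  have "(?h has_real_derivative 0) (at y)" for y
    using p by (auto intro!: derivative_eq_intros kernel_deriv_x simp: K1 field_simps)
  then have "?h x = ?h 0" using DERIV_isconst_all by blast
  moreover have "ekernel 0 p 0 0 = sqrt (pi / p) / (2 * pi)"
  proof -
    have "kernel_integrand 0 p 0 0 = (\<lambda>\<xi>. exp (- (p * \<xi>\<^sup>2)))"
      by (simp add: fun_eq_iff kernel_integrand_def)
    then show ?thesis using Gaussian_integral(2)[OF p] by (simp add: ekernel_def)
  qed
  moreover have "sqrt (pi / p) / (2 * pi) = 1 / sqrt (4 * pi * p)"
  proof -
    have "sqrt (4 * pi * p) * sqrt (pi / p) = sqrt ((2 * pi)\<^sup>2)"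
      unfolding real_sqrt_mult[symmetric] using p by (simp add: power2_eq_square)
    then have "sqrt (4 * pi * p) * sqrt (pi / p) = \<bar>2 * pi\<bar>" by (simp only: real_sqrt_abs)
    then show ?thesis using p by (simp add: field_simps)
  qed
  ultimately have "ekernel 0 p 0 x * exp (x\<^sup>2 / (4 * p)) = 1 / sqrt (4 * pi * p)" by simp
  then have "ekernel 0 p 0 x * exp (x\<^sup>2 / (4 * p)) * exp (- (x\<^sup>2 / (4 * p))) = exp (- (x\<^sup>2 / (4 * p))) / sqrt (4 * pi * p)"
    by simp
  then show ?thesis by (simp only: mult.assoc exp_add[symmetric]) simp
qed

section \<open>The square integrable majorant 1/(1+|x|) and convolution with the kernel\<close>

definition weight :: "real \<Rightarrow> real" where "weight x = 1 / (1 + \<bar>x\<bar>)"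

lemma weight_nonneg: "0 \<le> weight x" by (simp add: weight_def)

lemma weight_measurable [measurable]: "weight \<in> borel_measurable borel"
  unfolding weight_def by measurable

lemma integrable_lebesgue_iff_lborel:
  "f \<in> borel_measurable borel \<Longrightarrow> integrable lebesgue f \<longleftrightarrow> integrable lborel (f :: 'a::euclidean_space \<Rightarrow> real)"
  by (rule integrable_completion) simp

lemma integral_lebesgue_eq_lborel:
  "f \<in> borel_measurable borel \<Longrightarrow> integral\<^sup>L lebesgue f = integral\<^sup>L lborel (f :: 'a::euclidean_space \<Rightarrow> real)"
  by (rule integral_completion) simp

lemma borel_measurable_lebesgue: "f \<in> borel_measurable borel \<Longrightarrow> f \<in> borel_measurable (lebesgue :: 'a::euclidean_space measure)"
  by (intro measurable_completion) simp

lemma L2_borel_I: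
  "f \<in> borel_measurable borel \<Longrightarrow> integrable lborel (\<lambda>x. (f x)\<^sup>2) \<Longrightarrow> f \<in> L2"
  by (intro L2_I) (auto simp: integrable_lebesgue_iff_lborel borel_measurable_lebesgue)

lemma L2_reflect:
  fixes f :: "real \<Rightarrow> real"
  assumes [measurable]: "f \<in> borel_measurable borel" and f: "f \<in> L2"
  shows "(\<lambda>y. f (x - y)) \<in> L2" "L2_norm (\<lambda>y. f (x - y)) = L2_norm f"
proof -
  have i: "integrable lborel (\<lambda>y. (f y)\<^sup>2)"
    using L2_square_integrable[OF f] by (subst (asm) integrable_lebesgue_iff_lborel) measurable
  from lborel_integrable_real_affine[OF i, of "-1" x] have "integrable lborel (\<lambda>y. (f (x - y))\<^sup>2)" by simp
  then show "(\<lambda>y. f (x - y)) \<in> L2" by (intro L2_borel_I) measurable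
  have "integral\<^sup>L lborel (\<lambda>y. (f y)\<^sup>2) = integral\<^sup>L lborel (\<lambda>y. (f (x - y))\<^sup>2)"
    using lborel_integral_real_affine[of "-1" "\<lambda>y. (f y)\<^sup>2" x] by simp
  then show "L2_norm (\<lambda>y. f (x - y)) = L2_norm f"
    unfolding L2_norm_def by (simp add: integral_lebesgue_eq_lborel)
qed

text \<open>Comparison with 1/(1+x^2), as (1+|x|)^2 \<ge> 1+x^2.\<close>

lemma weight_L2: "weight \<in> L2"
proof (rule L2_borel_I)
  have "integrable lborel (\<lambda>x::real. inverse (1 + x\<^sup>2))"
    using integrable_inverse_1_plus_square by (simp add: set_integrable_def einterval_def)
  then show "integrable lborel (\<lambda>x. (weight x)\<^sup>2)"
  proof (rule Bochner_Integration.integrable_bound)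
    have "(weight x)\<^sup>2 \<le> inverse (1 + x\<^sup>2)" for x
    proof -
      have "1 + x\<^sup>2 \<le> (1 + \<bar>x\<bar>)\<^sup>2" by (simp add: power2_sum)
      then have "inverse ((1 + \<bar>x\<bar>)\<^sup>2) \<le> inverse (1 + x\<^sup>2)"
        by (intro le_imp_inverse_le) (auto intro: add_pos_nonneg)
      then show ?thesis by (simp add: weight_def power_divide inverse_eq_divide)
    qed
    then show "AE x in lborel. norm ((weight x)\<^sup>2) \<le> norm (inverse (1 + x\<^sup>2))"
      by (intro AE_I2) (simp add: abs_of_nonneg add_nonneg_nonneg)
  qed measurable
qed measurable

lemma weight_reflect_L2: "(\<lambda>y. weight (x - y)) \<in> L2" "L2_norm (\<lambda>y. weight (x - y)) = L2_norm weight"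
  using L2_reflect[OF weight_measurable weight_L2] by auto

lemma ekernel_continuous: "p > 0 \<Longrightarrow> continuous_on UNIV (ekernel k p s)"
  by (intro continuous_at_imp_continuous_on ballI DERIV_isCont[OF kernel_deriv_x])

lemma ekernel_measurable: "p > 0 \<Longrightarrow> ekernel k p s \<in> borel_measurable borel"
  using ekernel_continuous by (rule borel_measurable_continuous_onI)

lemma ekernel_reflect_measurable: "p > 0 \<Longrightarrow> (\<lambda>y. ekernel k p s (x - y)) \<in> borel_measurable borel"
  using ekernel_measurable[of p k s] by measurable

lemma ekernel_weight:
  assumes "0 < p0" "p0 \<le> p" "p \<le> R" "\<bar>s\<bar> \<le> R"
  shows "\<bar>ekernel k p s x\<bar> \<le> kernel_bound k p0 R * weight x"
  using kernel_decay[OF assms] by (simp add: weight_def)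

lemma ekernel_reflect_L2:
  assumes "0 < p" shows "(\<lambda>y. ekernel k p s (x - y)) \<in> L2"
proof (rule L2_bound)
  let ?R = "max p \<bar>s\<bar>"
  show "(\<lambda>y. kernel_bound k p ?R * weight (x - y)) \<in> L2" by (intro L2_cmult weight_reflect_L2)
  show "\<bar>ekernel k p s (x - y)\<bar> \<le> \<bar>kernel_bound k p ?R * weight (x - y)\<bar>" for y
    using ekernel_weight[of p p ?R s k "x - y"] assms by (intro order_trans[OF _ abs_ge_self]) auto
qed (use ekernel_reflect_measurable[OF assms] borel_measurable_lebesgue in blast)

lemma ekernel_reflect_L2_norm:
  assumes "0 < p0" "p0 \<le> p" "p \<le> R" "\<bar>s\<bar> \<le> R"
  shows "L2_norm (\<lambda>y. ekernel k p s (x - y)) \<le> kernel_bound k p0 R * L2_norm weight"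
proof -
  have B0: "0 \<le> kernel_bound k p0 R" by (rule kernel_bound_nonneg) (use assms in auto)
  have "L2_norm (\<lambda>y. ekernel k p s (x - y)) \<le> L2_norm (\<lambda>y. kernel_bound k p0 R * weight (x - y))"
  proof (rule L2_norm_mono)
    show "(\<lambda>y. kernel_bound k p0 R * weight (x - y)) \<in> L2" by (intro L2_cmult weight_reflect_L2)
    show "\<bar>ekernel k p s (x - y)\<bar> \<le> \<bar>kernel_bound k p0 R * weight (x - y)\<bar>" for y
      using ekernel_weight[OF assms, of k "x - y"] by (intro order_trans[OF _ abs_ge_self])
    have "0 < p" using assms by simp
    then show "(\<lambda>y. ekernel k p s (x - y)) \<in> borel_measurable lebesgue"
      using ekernel_reflect_measurable borel_measurable_lebesgue by blast
  qed
  then show ?thesis using B0 by (simp add: L2_norm_cmult weight_reflect_L2)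
qed

text \<open>As an L2 pairing with a reflected kernel this is defined at every point x, not just
  almost everywhere; raising \<open>k\<close> differentiates in x.\<close>

definition conv :: "nat \<Rightarrow> real \<Rightarrow> real \<Rightarrow> (real \<Rightarrow> real) \<Rightarrow> real \<Rightarrow> real" where
  "conv k p s f x = L2_inner f (\<lambda>y. ekernel k p s (x - y))"

lemma conv_bound:
  assumes "f \<in> L2" "0 < p0" "p0 \<le> p" "p \<le> R" "\<bar>s\<bar> \<le> R"
  shows "\<bar>conv k p s f x\<bar> \<le> L2_norm f * (kernel_bound k p0 R * L2_norm weight)"
proof -
  have "\<bar>conv k p s f x\<bar> \<le> L2_norm f * L2_norm (\<lambda>y. ekernel k p s (x - y))"
    unfolding conv_def using assms by (intro L2_Cauchy_Schwarz ekernel_reflect_L2) auto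
  also have "\<dots> \<le> L2_norm f * (kernel_bound k p0 R * L2_norm weight)"
    by (intro mult_left_mono ekernel_reflect_L2_norm assms) simp
  finally show ?thesis .
qed

text \<open>1+|x0-y| \<le> 2+|x-y| \<le> 2(1+|x-y|). It gives a majorant independent of x in a unit
  neighbourhood, as differentiation under the integral requires.\<close>

lemma weight_shift:
  assumes "\<bar>x - x0\<bar> < 1" shows "weight (x - y) \<le> 2 * weight (x0 - y)"
proof -
  have *: "a < 1 \<Longrightarrow> c \<le> a + b \<Longrightarrow> 0 \<le> b \<Longrightarrow> 0 \<le> c \<Longrightarrow> 1 / (1 + b) \<le> 2 * (1 / (1 + c))" for a b c :: real
    by (simp add: divide_simps)
  have "\<bar>x0 - y\<bar> \<le> \<bar>x - x0\<bar> + \<bar>x - y\<bar>"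
    using abs_triangle_ineq[of "x0 - x" "x - y"] by (simp add: abs_minus_commute)
  from *[OF assms this abs_ge_zero abs_ge_zero] show ?thesis unfolding weight_def .
qed

lemma conv_deriv_x:
  assumes f: "f \<in> L2" and p: "0 < p"
  shows "(conv k p s f has_real_derivative conv (Suc k) p s f x) (at x)"
  unfolding conv_def L2_inner_def
proof (rule has_real_derivative_integral[where r=1])
  let ?R = "max p \<bar>s\<bar>"
  let ?g = "\<lambda>y. \<bar>f y\<bar> * (kernel_bound (Suc k) p ?R * (2 * weight (x - y)))"
  have [measurable]: "f \<in> borel_measurable lebesgue" using f by (rule L2_measurable)
  note [measurable] = borel_measurable_lebesgue[OF ekernel_reflect_measurable[OF p]]
  show "((\<lambda>x. f y * ekernel k p s (x - y)) has_real_derivative f y * ekernel (Suc k) p s (u - y)) (at u)" for u y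
  proof (rule DERIV_cmult)
    have "((\<lambda>x. x - y) has_real_derivative 1) (at u)" by (auto intro!: derivative_eq_intros)
    from DERIV_chain2[OF kernel_deriv_x[OF p] this]
    show "((\<lambda>x. ekernel k p s (x - y)) has_real_derivative ekernel (Suc k) p s (u - y)) (at u)" by simp
  qed
  show "integrable lebesgue (\<lambda>y. f y * ekernel k p s (u - y))" for u
    by (intro L2_mult_integrable f ekernel_reflect_L2 p)
  show "(\<lambda>y. f y * ekernel (Suc k) p s (x - y)) \<in> borel_measurable lebesgue" by measurable
  have B0: "0 \<le> kernel_bound (Suc k) p ?R" by (rule kernel_bound_nonneg) (use p in auto)
  show "\<bar>f y * ekernel (Suc k) p s (u - y)\<bar> \<le> ?g y" if "\<bar>u - x\<bar> < 1" for u y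
    unfolding abs_mult
  proof (intro mult_left_mono)
    have "\<bar>ekernel (Suc k) p s (u - y)\<bar> \<le> kernel_bound (Suc k) p ?R * weight (u - y)"
      by (rule ekernel_weight) (use p in auto)
    also have "\<dots> \<le> kernel_bound (Suc k) p ?R * (2 * weight (x - y))"
      by (intro mult_left_mono weight_shift that B0)
    finally show "\<bar>ekernel (Suc k) p s (u - y)\<bar> \<le> kernel_bound (Suc k) p ?R * (2 * weight (x - y))" .
  qed simp
  have "(\<lambda>y. \<bar>f y\<bar>) \<in> L2" by (rule L2_bound[OF f]) auto
  then show "integrable lebesgue ?g"
    by (rule L2_mult_integrable) (intro L2_cmult weight_reflect_L2)
qed simp

lemma conv_deriv_t:
  assumes f: "f \<in> L2" and p: "a + b * t > 0"
  shows "((\<lambda>t. conv k (a + b * t) (c + e * t) f x) has_real_derivative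
     b * conv (k + 2) (a + b * t) (c + e * t) f x - e * conv (k + 3) (a + b * t) (c + e * t) f x) (at t)"
proof -
  define p0 where "p0 = (a + b * t) / 2"
  define r where "r = p0 / (\<bar>b\<bar> + 1)"
  \<comment> \<open>A common upper bound for p = a + b u and |s| = |c + e u| over the whole
    neighbourhood |u - t| < r.\<close>
  define R where "R = \<bar>a\<bar> + \<bar>b\<bar> * (\<bar>t\<bar> + r) + \<bar>c\<bar> + \<bar>e\<bar> * (\<bar>t\<bar> + r)"
  have p0: "p0 > 0" using p by (simp add: p0_def)
  have r: "r > 0" using p0 by (simp add: r_def)
  have near: "p0 \<le> a + b * u" "a + b * u \<le> R" "\<bar>c + e * u\<bar> \<le> R" if "\<bar>u - t\<bar> < r" for u
  proof -
    have "\<bar>b * (u - t)\<bar> \<le> (\<bar>b\<bar> + 1) * r" unfolding abs_mult using that by (intro mult_mono) auto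
    also have "\<dots> = p0" by (simp add: r_def)
    finally have "b * (u - t) \<ge> - p0" by linarith
    moreover have "- ((a + X) / 2) \<le> Y - X \<Longrightarrow> (a + X) / 2 \<le> a + Y" for X Y by (simp add: field_simps)
    ultimately show "p0 \<le> a + b * u" unfolding p0_def right_diff_distrib by blast
    have m: "\<bar>q * u\<bar> \<le> \<bar>q\<bar> * (\<bar>t\<bar> + r)" for q
      unfolding abs_mult using that by (intro mult_left_mono) auto
    have "0 \<le> \<bar>q\<bar> * (\<bar>t\<bar> + r)" for q using r by simp
    from m[of b] m[of e] this[of b] this[of e] show "a + b * u \<le> R" "\<bar>c + e * u\<bar> \<le> R"
      unfolding R_def by linarith+
  qed
  let ?B = "\<bar>b\<bar> * kernel_bound (k + 2) p0 R + \<bar>e\<bar> * kernel_bound (k + 3) p0 R"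
  let ?g = "\<lambda>y. \<bar>f y\<bar> * (?B * weight (x - y))"
  have [measurable]: "f \<in> borel_measurable lebesgue" using f by (rule L2_measurable)
  have "((\<lambda>t. integral\<^sup>L lebesgue (\<lambda>y. f y * ekernel k (a + b * t) (c + e * t) (x - y))) has_real_derivative
     integral\<^sup>L lebesgue (\<lambda>y. f y * (b * ekernel (k + 2) (a + b * t) (c + e * t) (x - y) - e * ekernel (k + 3) (a + b * t) (c + e * t) (x - y)))) (at t)"
  proof (rule has_real_derivative_integral[where r=r and g="?g", OF r])
    show "((\<lambda>t. f y * ekernel k (a + b * t) (c + e * t) (x - y)) has_real_derivative
        f y * (b * ekernel (k + 2) (a + b * u) (c + e * u) (x - y) - e * ekernel (k + 3) (a + b * u) (c + e * u) (x - y))) (at u)"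
      if "\<bar>u - t\<bar> < r" for u y
      using near(1)[OF that] p0 by (intro DERIV_cmult kernel_deriv_t) auto
    show "integrable lebesgue (\<lambda>y. f y * ekernel k (a + b * u) (c + e * u) (x - y))" if "\<bar>u - t\<bar> < r" for u
      using near(1)[OF that] p0 by (intro L2_mult_integrable f ekernel_reflect_L2) auto
    note [measurable] = borel_measurable_lebesgue[OF ekernel_reflect_measurable[OF p]]
    show "(\<lambda>y. f y * (b * ekernel (k + 2) (a + b * t) (c + e * t) (x - y) - e * ekernel (k + 3) (a + b * t) (c + e * t) (x - y))) \<in> borel_measurable lebesgue"
      by measurable
    show "\<bar>f y * (b * ekernel (k + 2) (a + b * u) (c + e * u) (x - y) - e * ekernel (k + 3) (a + b * u) (c + e * u) (x - y))\<bar> \<le> ?g y"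
      if "\<bar>u - t\<bar> < r" for u y
      unfolding abs_mult[of "f y"]
    proof (rule mult_left_mono)
      have "\<bar>b * ekernel (k + 2) (a + b * u) (c + e * u) (x - y)\<bar> \<le> \<bar>b\<bar> * (kernel_bound (k + 2) p0 R * weight (x - y))"
        unfolding abs_mult by (intro mult_left_mono ekernel_weight near that p0) simp
      moreover have "\<bar>e * ekernel (k + 3) (a + b * u) (c + e * u) (x - y)\<bar> \<le> \<bar>e\<bar> * (kernel_bound (k + 3) p0 R * weight (x - y))"
        unfolding abs_mult by (intro mult_left_mono ekernel_weight near that p0) simp
      ultimately show "\<bar>b * ekernel (k + 2) (a + b * u) (c + e * u) (x - y) - e * ekernel (k + 3) (a + b * u) (c + e * u) (x - y)\<bar> \<le> ?B * weight (x - y)"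
        by (simp add: distrib_right mult.assoc)
    qed simp
    have "(\<lambda>y. \<bar>f y\<bar>) \<in> L2" by (rule L2_bound[OF f]) auto
    then show "integrable lebesgue ?g"
      by (rule L2_mult_integrable) (intro L2_cmult weight_reflect_L2)
  qed
  moreover have "integral\<^sup>L lebesgue (\<lambda>y. f y * (b * ekernel (k + 2) (a + b * t) (c + e * t) (x - y) - e * ekernel (k + 3) (a + b * t) (c + e * t) (x - y)))
     = L2_inner f (\<lambda>y. b * ekernel (k + 2) (a + b * t) (c + e * t) (x - y) - e * ekernel (k + 3) (a + b * t) (c + e * t) (x - y))"
    by (simp add: L2_inner_def)
  moreover have "\<dots> = b * conv (k + 2) (a + b * t) (c + e * t) f x - e * conv (k + 3) (a + b * t) (c + e * t) f x"
    unfolding conv_def using L2_inner_diff_right[OF L2_cmult[OF ekernel_reflect_L2[OF p]] L2_cmult[OF ekernel_reflect_L2[OF p]] f]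
    by (simp add: L2_inner_cmult_right)
  ultimately show ?thesis unfolding conv_def L2_inner_def by simp
qed

section \<open>Test functions and weak derivatives\<close>

lemma test_function_Ck: "\<phi> \<in> test_functions \<Omega> \<Longrightarrow> Ck k \<phi>"
  by (simp add: test_functions_def)

lemma test_function_continuous: "\<phi> \<in> test_functions \<Omega> \<Longrightarrow> continuous_on UNIV \<phi>"
  using test_function_Ck[of \<phi> \<Omega> 0] by simp

lemma has_real_derivative_line_shift:
  fixes x e :: "'a::real_normed_vector"
  assumes "((\<lambda>s. f ((x + s0 *\<^sub>R e) + s *\<^sub>R e)) has_real_derivative D) (at 0)"
  shows "((\<lambda>s. f (x + s *\<^sub>R e)) has_real_derivative D) (at s0)"
proof -
  have "((\<lambda>s. f (x + (s + s0) *\<^sub>R e)) has_real_derivative D) (at 0)"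
    using assms by (simp add: algebra_simps)
  then show ?thesis using DERIV_shift[of "\<lambda>s. f (x + s *\<^sub>R e)" D 0 s0] by simp
qed

lemma Ck_Suc_deriv:
  assumes "Ck (Suc k) \<phi>" "e \<in> Basis"
  shows "((\<lambda>s. \<phi> (x + s *\<^sub>R e)) has_real_derivative partial e \<phi> (x + s *\<^sub>R e)) (at s)"
proof (rule has_real_derivative_line_shift)
  have "(\<lambda>h. \<phi> ((x + s *\<^sub>R e) + h *\<^sub>R e)) differentiable (at 0)"
    using assms by auto
  then show "((\<lambda>h. \<phi> ((x + s *\<^sub>R e) + h *\<^sub>R e)) has_real_derivative partial e \<phi> (x + s *\<^sub>R e)) (at 0)"
    unfolding partial_def by (simp add: DERIV_deriv_iff_real_differentiable)
qed

lemma test_function_deriv: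
  assumes "\<phi> \<in> test_functions \<Omega>" "e \<in> Basis"
  shows "((\<lambda>s. \<phi> (x + s *\<^sub>R e)) has_real_derivative partial e \<phi> (x + s *\<^sub>R e)) (at s)"
  using Ck_Suc_deriv[OF test_function_Ck[OF assms(1)] assms(2)] .

lemma partial_eq_0_outside_support:
  assumes "x \<notin> closure {x. \<phi> x \<noteq> 0}"
  shows "partial e \<phi> x = 0"
proof -
  let ?U = "- closure {x. \<phi> x \<noteq> 0}"
  have "open ((\<lambda>h. x + h *\<^sub>R e) -` ?U)"
    by (intro open_vimage continuous_intros) auto
  moreover have "0 \<in> (\<lambda>h. x + h *\<^sub>R e) -` ?U" using assms by simp
  moreover have "\<phi> (x + h *\<^sub>R e) = 0" if "h \<in> (\<lambda>h. x + h *\<^sub>R e) -` ?U" for h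
    using that closure_subset[of "{x. \<phi> x \<noteq> 0}"] by auto
  ultimately have "((\<lambda>h. \<phi> (x + h *\<^sub>R e)) has_real_derivative 0) (at 0)"
    by (intro has_field_derivative_transform_within_open[OF DERIV_const[of 0]]) auto
  then show ?thesis unfolding partial_def by (rule DERIV_imp_deriv)
qed

lemma test_function_partial:
  assumes "\<phi> \<in> test_functions \<Omega>" "e \<in> Basis"
  shows "partial e \<phi> \<in> test_functions \<Omega>"
proof -
  have "Ck k (partial e \<phi>)" for k
    using test_function_Ck[OF assms(1), of "Suc k"] assms(2) by simp
  moreover have "{x. partial e \<phi> x \<noteq> 0} \<subseteq> closure {x. \<phi> x \<noteq> 0}"
    using partial_eq_0_outside_support by blast
  then have s: "closure {x. partial e \<phi> x \<noteq> 0} \<subseteq> closure {x. \<phi> x \<noteq> 0}"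
    by (rule closure_minimal) simp
  moreover have "compact (closure {x. partial e \<phi> x \<noteq> 0})"
    using compact_Int_closed[of "closure {x. \<phi> x \<noteq> 0}" "closure {x. partial e \<phi> x \<noteq> 0}"] s assms(1)
    by (simp add: test_functions_def Int_absorb1)
  ultimately show ?thesis using assms(1) by (auto simp: test_functions_def)
qed

lemma integral_lborel_translate:
  fixes f :: "'a::euclidean_space \<Rightarrow> real"
  assumes [measurable]: "f \<in> borel_measurable borel"
  shows "integral\<^sup>L lborel (\<lambda>x. f (x + c)) = integral\<^sup>L lborel f"
proof -
  have "integral\<^sup>L lborel f = integral\<^sup>L (distr lborel borel ((+) c)) f" by (simp add: lborel_distr_plus)
  also have "\<dots> = integral\<^sup>L lborel (\<lambda>x. f (c + x))" by (rule integral_distr) measurable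
  finally show ?thesis by (simp add: add.commute)
qed

lemma integrable_continuous_bounded_support:
  fixes f :: "'a::euclidean_space \<Rightarrow> real"
  assumes cont: "continuous_on UNIV f" and supp: "\<And>x. f x \<noteq> 0 \<Longrightarrow> norm x \<le> R"
  shows "integrable lborel f"
proof -
  have "integrable lborel (\<lambda>x. indicator (cball 0 R) x *\<^sub>R f x)"
    by (rule borel_integrable_compact) (auto intro: continuous_on_subset[OF cont])
  moreover have "(\<lambda>x. indicator (cball 0 R) x *\<^sub>R f x) = f"
    using supp by (auto simp: fun_eq_iff split: split_indicator)
  ultimately show ?thesis by simp
qed

lemma integral_directional_deriv_eq_0:
  fixes h g :: "'a::euclidean_space \<Rightarrow> real"
  assumes h: "continuous_on UNIV h" and g: "continuous_on UNIV g"
    and deriv: "\<And>x s. ((\<lambda>s. h (x + s *\<^sub>R e)) has_real_derivative g (x + s *\<^sub>R e)) (at s)"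
    and supp: "\<And>x. h x \<noteq> 0 \<Longrightarrow> norm x \<le> R" "\<And>x. g x \<noteq> 0 \<Longrightarrow> norm x \<le> R"
  shows "integral\<^sup>L lborel g = 0"
proof -
  have [measurable]: "h \<in> borel_measurable borel" "g \<in> borel_measurable borel"
    using h g by (auto intro: borel_measurable_continuous_onI)
  let ?R = "R + norm e"
  have "compact (g ` cball 0 R)"
    by (intro compact_continuous_image continuous_on_subset[OF g]) auto
  then obtain B where B: "\<forall>y\<in>g ` cball 0 R. norm y \<le> B"
    using compact_imp_bounded[of "g ` cball 0 R"] unfolding bounded_iff by blast
  have gB: "\<bar>g x\<bar> \<le> \<bar>B\<bar>" for x
  proof (cases "g x = 0")
    case False
    then have "g x \<in> g ` cball 0 R" using supp(2) by simp
    then have "norm (g x) \<le> B" using B by blast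
    then show ?thesis by simp
  qed simp
  have "((\<lambda>s. integral\<^sup>L lborel (\<lambda>x. h (x + s *\<^sub>R e))) has_real_derivative integral\<^sup>L lborel (\<lambda>x. g (x + 0 *\<^sub>R e))) (at 0)"
  proof (rule has_real_derivative_integral[where r=1 and g="\<lambda>x. indicator (cball 0 ?R) x * \<bar>B\<bar>"])
    show "integrable lborel (\<lambda>x. h (x + s *\<^sub>R e))" for s
    proof (rule integrable_continuous_bounded_support)
      show "continuous_on UNIV (\<lambda>x. h (x + s *\<^sub>R e))"
        by (intro continuous_on_compose2[OF h] continuous_intros) auto
      show "norm x \<le> R + norm (s *\<^sub>R e)" if "h (x + s *\<^sub>R e) \<noteq> 0" for x
        using supp(1)[OF that] norm_triangle_ineq4[of "x + s *\<^sub>R e" "s *\<^sub>R e"] by simp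
    qed
    show "\<bar>g (x + s *\<^sub>R e)\<bar> \<le> indicator (cball 0 ?R) x * \<bar>B\<bar>" if s: "\<bar>s - 0\<bar> < 1" for s x
    proof (cases "g (x + s *\<^sub>R e) = 0")
      case False
      have "norm (s *\<^sub>R e) \<le> norm e" using s mult_right_mono[of "\<bar>s\<bar>" 1 "norm e"] by simp
      then have "norm x \<le> ?R"
        using supp(2)[OF False] norm_triangle_ineq4[of "x + s *\<^sub>R e" "s *\<^sub>R e"] by simp
      then show ?thesis using gB by simp
    qed auto
    show "integrable lborel (\<lambda>x. indicator (cball (0::'a) ?R) x * \<bar>B\<bar>)"
      by (intro integrable_mult_left integrable_real_indicator) (use emeasure_bounded_finite[OF bounded_cball, of "0::'a" ?R] in \<open>simp_all add: top.not_eq_extremum\<close>)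
  qed (auto intro: deriv)
  moreover have "(\<lambda>s. integral\<^sup>L lborel (\<lambda>x. h (x + s *\<^sub>R e))) = (\<lambda>s. integral\<^sup>L lborel h)"
    by (rule ext, rule integral_lborel_translate) measurable
  ultimately show ?thesis using DERIV_unique[OF _ DERIV_const] by fastforce
qed

text \<open>The open sets \<Omega> and the complement of the support cover the space. The product is
  continuous on the first and vanishes on the second, where nothing is known about
  \<open>v\<close>.\<close>

lemma continuous_on_mult_support:
  fixes v \<phi> :: "'a::euclidean_space \<Rightarrow> real"
  assumes \<Omega>: "open \<Omega>" and v: "continuous_on \<Omega> v" and \<phi>: "continuous_on UNIV \<phi>" "closure {x. \<phi> x \<noteq> 0} \<subseteq> \<Omega>"
  shows "continuous_on UNIV (\<lambda>x. v x * \<phi> x)"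
proof -
  let ?U = "- closure {x. \<phi> x \<noteq> 0}"
  have z: "\<phi> x = 0" if "x \<in> ?U" for x using that closure_subset[of "{x. \<phi> x \<noteq> 0}"] by auto
  have "continuous_on \<Omega> (\<lambda>x. v x * \<phi> x)"
    by (intro continuous_intros v continuous_on_subset[OF \<phi>(1)]) auto
  moreover have "continuous_on ?U (\<lambda>x. v x * \<phi> x)"
    by (rule continuous_on_cong[THEN iffD2, OF refl _ continuous_on_const[where c=0]]) (drule z, simp)
  ultimately have "continuous_on (\<Omega> \<union> ?U) (\<lambda>x. v x * \<phi> x)"
    using \<Omega> by (intro continuous_on_open_Un) auto
  moreover have "\<Omega> \<union> ?U = UNIV" using \<phi>(2) by auto
  ultimately show ?thesis by simp
qed

text \<open>The derivative of \<open>v \<phi>\<close> has integral zero because the integral of \<open>v \<phi>\<close> is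
  invariant under translations.\<close>

lemma distr_partial_regular:
  fixes v w :: "'a::euclidean_space \<Rightarrow> real"
  assumes \<Omega>: "open \<Omega>" and \<phi>: "\<phi> \<in> test_functions \<Omega>" and e: "e \<in> Basis"
    and v: "continuous_on \<Omega> v" and w: "continuous_on \<Omega> w"
    and deriv: "\<And>x. x \<in> \<Omega> \<Longrightarrow> ((\<lambda>s. v (x + s *\<^sub>R e)) has_real_derivative w x) (at 0)"
  shows "distr_partial e (regular_distribution v) \<phi> = regular_distribution w \<phi>"
proof -
  let ?K = "closure {x. \<phi> x \<noteq> 0}"
  have K: "compact ?K" "?K \<subseteq> \<Omega>" using \<phi> by (auto simp: test_functions_def)
  note p = test_function_partial[OF \<phi> e]
  have K': "closure {x. partial e \<phi> x \<noteq> 0} \<subseteq> \<Omega>" using p by (auto simp: test_functions_def)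
  obtain R where R: "\<And>x. x \<in> ?K \<Longrightarrow> norm x \<le> R"
    using compact_imp_bounded[OF K(1)] unfolding bounded_iff by blast
  have z: "\<phi> x = 0" "partial e \<phi> x = 0" if "x \<notin> ?K" for x
    using that closure_subset[of "{x. \<phi> x \<noteq> 0}"] partial_eq_0_outside_support by auto
  have c1: "continuous_on UNIV (\<lambda>x. v x * \<phi> x)" and c2: "continuous_on UNIV (\<lambda>x. w x * \<phi> x)"
    by (intro continuous_on_mult_support[OF \<Omega>] v w test_function_continuous[OF \<phi>] K)+
  have c3: "continuous_on UNIV (\<lambda>x. v x * partial e \<phi> x)"
    by (intro continuous_on_mult_support[OF \<Omega>] v test_function_continuous[OF p] K')
  have i2: "integrable lborel (\<lambda>x. w x * \<phi> x)" and i3: "integrable lborel (\<lambda>x. v x * partial e \<phi> x)"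
  proof -
    have "norm x \<le> R" if "w x * \<phi> x \<noteq> 0" for x
      using that z(1)[of x] R[of x] by (cases "x \<in> ?K") simp_all
    then show "integrable lborel (\<lambda>x. w x * \<phi> x)"
      by (rule integrable_continuous_bounded_support[OF c2])
    have "norm x \<le> R" if "v x * partial e \<phi> x \<noteq> 0" for x
      using that z(2)[of x] R[of x] by (cases "x \<in> ?K") simp_all
    then show "integrable lborel (\<lambda>x. v x * partial e \<phi> x)"
      by (rule integrable_continuous_bounded_support[OF c3])
  qed
  \<comment> \<open>Outside \<Omega> the point lies in the open complement of the support, and the
    product vanishes identically near it along the line.\<close>
  have d0: "((\<lambda>s. v (x + s *\<^sub>R e) * \<phi> (x + s *\<^sub>R e)) has_real_derivative w x * \<phi> x + v x * partial e \<phi> x) (at 0)" for x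
  proof (cases "x \<in> \<Omega>")
    case True
    have "((\<lambda>s. \<phi> (x + s *\<^sub>R e)) has_real_derivative partial e \<phi> x) (at 0)"
      using test_function_deriv[OF \<phi> e, of x 0] by simp
    from DERIV_mult[OF deriv[OF True] this] show ?thesis by (simp add: add.commute mult.commute)
  next
    case False
    then have x: "x \<notin> ?K" using K by auto
    have "open ((\<lambda>h. x + h *\<^sub>R e) -` (- ?K))"
      by (intro open_vimage continuous_intros) auto
    moreover have "0 \<in> (\<lambda>h. x + h *\<^sub>R e) -` (- ?K)" using x by simp
    moreover have "0 = v (x + h *\<^sub>R e) * \<phi> (x + h *\<^sub>R e)" if "h \<in> (\<lambda>h. x + h *\<^sub>R e) -` (- ?K)" for h
      using that z(1)[of "x + h *\<^sub>R e"] by simp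
    ultimately have "((\<lambda>s. v (x + s *\<^sub>R e) * \<phi> (x + s *\<^sub>R e)) has_real_derivative 0) (at 0)"
      by (rule has_field_derivative_transform_within_open[OF DERIV_const])
    then show ?thesis using z[OF x] by simp
  qed
  have "integral\<^sup>L lborel (\<lambda>x. w x * \<phi> x + v x * partial e \<phi> x) = 0"
  proof (rule integral_directional_deriv_eq_0[OF c1])
    show "continuous_on UNIV (\<lambda>x. w x * \<phi> x + v x * partial e \<phi> x)" by (intro continuous_intros c2 c3)
    show "((\<lambda>s. v (x + s *\<^sub>R e) * \<phi> (x + s *\<^sub>R e)) has_real_derivative
        w (x + s *\<^sub>R e) * \<phi> (x + s *\<^sub>R e) + v (x + s *\<^sub>R e) * partial e \<phi> (x + s *\<^sub>R e)) (at s)" for x s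
      by (rule has_real_derivative_line_shift[where f="\<lambda>y. v y * \<phi> y"]) (rule d0)
    show "norm x \<le> R" if "v x * \<phi> x \<noteq> 0" for x
      using that z(1)[of x] R[of x] by (cases "x \<in> ?K") simp_all
    show "norm x \<le> R" if "w x * \<phi> x + v x * partial e \<phi> x \<noteq> 0" for x
      using that z[of x] R[of x] by (cases "x \<in> ?K") simp_all
  qed
  then have "integral\<^sup>L lborel (\<lambda>x. v x * partial e \<phi> x) = - integral\<^sup>L lborel (\<lambda>x. w x * \<phi> x)"
    using i2 i3 by simp
  then show ?thesis
    unfolding distr_partial_def regular_distribution_def
    using c2 c3 by (simp add: integral_lebesgue_eq_lborel borel_measurable_continuous_onI)
qed

text \<open>\<open>U k\<close> plays the role of the k-th x-derivative of \<open>U 0\<close>.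
  Derivatives are moved off the test function one at a time, its partial derivatives being again
  test functions on \<Omega>; the remaining integrand vanishes pointwise.\<close>

lemma classical_solution_solves_equation:
  fixes U :: "nat \<Rightarrow> real \<times> real \<Rightarrow> real"
  assumes \<Omega>: "open \<Omega>" and cont: "\<And>k. continuous_on \<Omega> (U k)"
    and dx: "\<And>k x t. (x, t) \<in> \<Omega> \<Longrightarrow> ((\<lambda>x. U k (x, t)) has_real_derivative U (Suc k) (x, t)) (at x)"
    and dt: "\<And>x t. (x, t) \<in> \<Omega> \<Longrightarrow> ((\<lambda>t. U 0 (x, t)) has_real_derivative U 2 (x, t) - U 3 (x, t)) (at t)"
    and u: "\<And>z. z \<in> \<Omega> \<Longrightarrow> u z = U 0 z"
  shows "solves_equation_in \<Omega> u"
proof -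
  let ?dx = "distr_partial (1, 0)" and ?dt = "distr_partial (0, 1)"
  have B: "(1, 0) \<in> (Basis :: (real \<times> real) set)" "(0, 1) \<in> (Basis :: (real \<times> real) set)"
    by (auto simp: Basis_prod_def)
  have sx: "?dx (regular_distribution (U k)) \<phi> = regular_distribution (U (Suc k)) \<phi>" if "\<phi> \<in> test_functions \<Omega>" for k \<phi>
  proof (rule distr_partial_regular[OF \<Omega> that B(1) cont cont])
    fix z :: "real \<times> real" assume z: "z \<in> \<Omega>"
    obtain x t where zz: "z = (x, t)" by fastforce
    show "((\<lambda>s. U k (z + s *\<^sub>R (1, 0))) has_real_derivative U (Suc k) z) (at 0)"
      using dx[of x t k] z zz DERIV_shift[of "\<lambda>x. U k (x, t)" "U (Suc k) (x, t)" 0 x] by (simp add: add.commute)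
  qed
  have st: "?dt (regular_distribution (U 0)) \<phi> = regular_distribution (\<lambda>z. U 2 z - U 3 z) \<phi>" if "\<phi> \<in> test_functions \<Omega>" for \<phi>
  proof (rule distr_partial_regular[OF \<Omega> that B(2) cont])
    fix z :: "real \<times> real" assume z: "z \<in> \<Omega>"
    obtain x t where zz: "z = (x, t)" by fastforce
    show "((\<lambda>s. U 0 (z + s *\<^sub>R (0, 1))) has_real_derivative U 2 z - U 3 z) (at 0)"
      using dt[of x t] z zz DERIV_shift[of "\<lambda>t. U 0 (x, t)" "U 2 (x, t) - U 3 (x, t)" 0 t] by (simp add: add.commute)
  qed (intro continuous_intros cont)
  have uU: "regular_distribution u \<phi> = regular_distribution (U 0) \<phi>" if "\<phi> \<in> test_functions \<Omega>" for \<phi>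
  proof -
    have "u z * \<phi> z = U 0 z * \<phi> z" for z
      using u[of z] that closure_subset[of "{x. \<phi> x \<noteq> 0}"] by (cases "z \<in> \<Omega>") (auto simp: test_functions_def)
    then show ?thesis by (simp only: regular_distribution_def)
  qed
  have "?dt (regular_distribution u) \<phi> - (?dx ^^ 2) (regular_distribution u) \<phi> + (?dx ^^ 3) (regular_distribution u) \<phi> = 0"
    if \<phi>: "\<phi> \<in> test_functions \<Omega>" for \<phi>
  proof -
    let ?p = "partial (1, 0) :: (real \<times> real \<Rightarrow> real) \<Rightarrow> _"
    have p: "?p \<phi> \<in> test_functions \<Omega>" "?p (?p \<phi>) \<in> test_functions \<Omega>" "?p (?p (?p \<phi>)) \<in> test_functions \<Omega>"
      "partial (0, 1) \<phi> \<in> test_functions \<Omega>"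
      by (intro test_function_partial \<phi> B)+
    have t: "?dt (regular_distribution u) \<phi> = regular_distribution (\<lambda>z. U 2 z - U 3 z) \<phi>"
      using st[OF \<phi>] uU[OF p(4)] by (simp add: distr_partial_def)
    have 1: "regular_distribution (U k) (?p \<psi>) = - regular_distribution (U (Suc k)) \<psi>" if "\<psi> \<in> test_functions \<Omega>" for k \<psi>
      using sx[OF that, of k] by (simp add: distr_partial_def)
    have x2: "(?dx ^^ 2) (regular_distribution u) \<phi> = regular_distribution (U 2) \<phi>"
      using uU[OF p(2)] 1[OF p(1), of 0] 1[OF \<phi>, of 1] by (simp add: distr_partial_def numeral_eq_Suc)
    have x3: "(?dx ^^ 3) (regular_distribution u) \<phi> = regular_distribution (U 3) \<phi>"
      using uU[OF p(3)] 1[OF p(2), of 0] 1[OF p(1), of 1] 1[OF \<phi>, of 2] by (simp add: distr_partial_def numeral_eq_Suc)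
    have i: "integrable lebesgue (\<lambda>z. U k z * \<phi> z)" for k
    proof -
      have c: "continuous_on UNIV (\<lambda>x. U k x * \<phi> x)"
        using \<phi> by (intro continuous_on_mult_support[OF \<Omega>] cont test_function_continuous[OF \<phi>]) (simp add: test_functions_def)
      have "compact (closure {x. \<phi> x \<noteq> 0})" using \<phi> by (simp add: test_functions_def)
      then obtain R where R: "\<forall>x\<in>closure {x. \<phi> x \<noteq> 0}. norm x \<le> R"
        using compact_imp_bounded[of "closure {x. \<phi> x \<noteq> 0}"] unfolding bounded_iff by blast
      have "norm x \<le> R" if "U k x * \<phi> x \<noteq> 0" for x
        using that R closure_subset[of "{x. \<phi> x \<noteq> 0}"] by auto
      then have "integrable lborel (\<lambda>x. U k x * \<phi> x)"
        by (rule integrable_continuous_bounded_support[OF c])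
      then show ?thesis using c by (simp add: integrable_lebesgue_iff_lborel borel_measurable_continuous_onI)
    qed
    show ?thesis unfolding t x2 x3
      unfolding regular_distribution_def using i by (simp add: left_diff_distrib)
  qed
  then show ?thesis unfolding solves_equation_in_def distr_eq_def Let_def by blast
qed

section \<open>Smooth functions on the line, cutoffs and the operator\<close>

lemma partial_of_deriv:
  fixes f :: "real \<Rightarrow> real"
  assumes "\<And>x. (f has_real_derivative f' x) (at x)"
  shows "((\<lambda>h. f (x + h *\<^sub>R 1)) has_real_derivative f' x) (at 0)" and "partial 1 f = f'"
proof -
  show d: "((\<lambda>h. f (x + h *\<^sub>R 1)) has_real_derivative f' x) (at 0)" for x
    using DERIV_shift[of f "f' x" 0 x] assms[of x] by (simp add: add.commute)
  show "partial 1 f = f'"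
    using DERIV_imp_deriv[OF d] by (auto simp: partial_def fun_eq_iff)
qed

lemma Ck_of_derivs:
  fixes D :: "nat \<Rightarrow> real \<Rightarrow> real"
  assumes D: "\<And>n x. (D n has_real_derivative D (Suc n) x) (at x)"
  shows "Ck k (D n)"
proof (induction k arbitrary: n)
  case 0
  show ?case using D by (auto intro!: continuous_at_imp_continuous_on DERIV_isCont)
next
  case (Suc k)
  have "continuous_on UNIV (D n)" using D by (auto intro!: continuous_at_imp_continuous_on DERIV_isCont)
  moreover have "(\<lambda>h. D n (x + h *\<^sub>R 1)) differentiable (at 0)" for x
    unfolding real_differentiable_def using partial_of_deriv(1)[OF D] by blast
  moreover have "Ck k (partial 1 (D n))" using Suc partial_of_deriv(2)[of "D n", OF D] by simp
  ultimately show ?case by simp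
qed

lemma test_function_of_derivs:
  fixes D :: "nat \<Rightarrow> real \<Rightarrow> real"
  assumes D: "\<And>n x. (D n has_real_derivative D (Suc n) x) (at x)" and supp: "\<And>x. R < \<bar>x\<bar> \<Longrightarrow> D 0 x = 0"
  shows "D 0 \<in> test_functions UNIV"
proof -
  have "{x. D 0 x \<noteq> 0} \<subseteq> cball 0 R" using supp by (auto simp: not_less[symmetric])
  then have "closure {x. D 0 x \<noteq> 0} \<subseteq> cball 0 R" by (rule closure_minimal) simp
  then have "bounded (closure {x. D 0 x \<noteq> 0})" using bounded_subset[OF bounded_cball] by blast
  then have "compact (closure {x. D 0 x \<noteq> 0})" by (simp add: compact_eq_bounded_closed)
  then show ?thesis unfolding test_functions_def using Ck_of_derivs[of D, OF D] by simp
qed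

lemma distr_deriv_smooth:
  fixes D :: "nat \<Rightarrow> real \<Rightarrow> real"
  assumes D: "\<And>n x. (D n has_real_derivative D (Suc n) x) (at x)" and \<phi>: "\<phi> \<in> test_functions UNIV"
  shows "distr_deriv j (D 0) \<phi> = regular_distribution (D j) \<phi>"
  using \<phi> unfolding distr_deriv_def
proof (induction j arbitrary: \<phi>)
  case (Suc j)
  have c: "continuous_on UNIV (D n)" for n
    using D by (auto intro!: continuous_at_imp_continuous_on DERIV_isCont)
  have "(distr_partial 1 ^^ Suc j) (regular_distribution (D 0)) \<phi> = - (distr_partial 1 ^^ j) (regular_distribution (D 0)) (partial 1 \<phi>)"
    by (simp add: distr_partial_def)
  also have "(distr_partial 1 ^^ j) (regular_distribution (D 0)) (partial 1 \<phi>) = regular_distribution (D j) (partial 1 \<phi>)"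
    by (rule Suc.IH[OF test_function_partial[OF Suc.prems]]) simp
  also have "- regular_distribution (D j) (partial 1 \<phi>) = distr_partial 1 (regular_distribution (D j)) \<phi>"
    by (simp add: distr_partial_def)
  also have "\<dots> = regular_distribution (D (Suc j)) \<phi>"
    by (rule distr_partial_regular[OF open_UNIV Suc.prems _ c c]) (simp, rule partial_of_deriv(1)[OF D])
  finally show ?case .
qed simp

lemma L2_continuous_bounded_support:
  fixes f :: "real \<Rightarrow> real"
  assumes c: "continuous_on UNIV f" and supp: "\<And>x. R < \<bar>x\<bar> \<Longrightarrow> f x = 0"
  shows "f \<in> L2"
proof (rule L2_borel_I)
  show "f \<in> borel_measurable borel" using c by (rule borel_measurable_continuous_onI)
  have "norm x \<le> R" if "(f x)\<^sup>2 \<noteq> 0" for x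
    using that supp[of x] by (cases "R < \<bar>x\<bar>") auto
  moreover have "continuous_on UNIV (\<lambda>x. (f x)\<^sup>2)" by (intro continuous_intros c)
  ultimately show "integrable lborel (\<lambda>x. (f x)\<^sup>2)"
    by (rule integrable_continuous_bounded_support[rotated])
qed

text \<open>Supplies explicit elements of the domain: with compact support every derivative is
  square integrable, and distributional derivatives are the classical ones. Density of the domain
  rests on these.\<close>

lemma operator_A_smooth:
  fixes D :: "nat \<Rightarrow> real \<Rightarrow> real"
  assumes D: "\<And>n x. (D n has_real_derivative D (Suc n) x) (at x)"
    and supp: "\<And>n x. R < \<bar>x\<bar> \<Longrightarrow> D n x = 0"
  shows "(D 0, \<lambda>x. D 2 x - D 3 x) \<in> operator_A"
proof -
  have L: "D n \<in> L2" for n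
    by (rule L2_continuous_bounded_support[of _ R])
       (use D supp in \<open>auto intro!: continuous_at_imp_continuous_on DERIV_isCont\<close>)
  have "D 0 \<in> sobolev_H 3"
    unfolding sobolev_H_def distr_eq_def using L distr_deriv_smooth[of D, OF D] by (auto intro!: bexI[OF _ L])
  moreover have "regular_distribution (\<lambda>x. D 2 x - D 3 x) \<phi> = distr_deriv 2 (D 0) \<phi> - distr_deriv 3 (D 0) \<phi>"
    if \<phi>: "\<phi> \<in> test_functions UNIV" for \<phi> :: "real \<Rightarrow> real"
  proof -
    have "compact (closure {x. \<phi> x \<noteq> 0})" using \<phi> by (simp add: test_functions_def)
    then obtain R' where R': "\<forall>x\<in>closure {x. \<phi> x \<noteq> 0}. norm x \<le> R'"
      using compact_imp_bounded[of "closure {x. \<phi> x \<noteq> 0}"] unfolding bounded_iff by blast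
    have "\<phi> x = 0" if "R' < \<bar>x\<bar>" for x
      using that R' closure_subset[of "{x. \<phi> x \<noteq> 0}"] by force
    then have "\<phi> \<in> L2" by (rule L2_continuous_bounded_support[OF test_function_continuous[OF \<phi>]])
    then show ?thesis
      unfolding distr_deriv_smooth[of D, OF D \<phi>] unfolding regular_distribution_def
      using L by (simp add: left_diff_distrib L2_mult_integrable)
  qed
  ultimately show ?thesis unfolding operator_A_def distr_eq_def using L2_diff[OF L L] by auto
qed

text \<open>The product of a step on the right and its mirror image on the left, both stretched by N
  + 1. Stretching only shrinks derivatives, so the bounds \<open>B k\<close> do not depend on
  N.\<close>

lemma smooth_cutoff:
  obtains \<zeta> :: "nat \<Rightarrow> nat \<Rightarrow> real \<Rightarrow> real" and B :: "nat \<Rightarrow> real"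
  where "\<And>N k x. (\<zeta> N k has_real_derivative \<zeta> N (Suc k) x) (at x)"
    and "\<And>N k x. \<bar>\<zeta> N k x\<bar> \<le> B k"
    and "\<And>N x. \<bar>x\<bar> \<le> real N \<Longrightarrow> \<zeta> N 0 x = 1"
    and "\<And>N k x. \<bar>x\<bar> \<le> real N \<Longrightarrow> 0 < k \<Longrightarrow> \<zeta> N k x = 0"
    and "\<And>N x. 2 * real (Suc N) < \<bar>x\<bar> \<Longrightarrow> \<zeta> N 0 x = 0"
proof -
  obtain \<theta> where g: "gevrey_on UNIV \<theta>" and l: "\<And>t. t \<le> 0 \<Longrightarrow> \<theta> 0 t = 1" and r: "\<And>t. 1 \<le> t \<Longrightarrow> \<theta> 0 t = 0"
    and "\<And>t. \<bar>\<theta> 0 t\<bar> \<le> 1" and lS: "\<And>n t. t \<le> 0 \<Longrightarrow> \<theta> (Suc n) t = 0" and "\<And>n t. 1 \<le> t \<Longrightarrow> \<theta> (Suc n) t = 0"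
    using gevrey_step by blast
  obtain C M where CM: "0 \<le> C" "0 \<le> M" "\<And>n t. \<bar>\<theta> n t\<bar> \<le> C * M ^ n * (fact n)\<^sup>2"
    by (rule gevrey_on_bound[OF g]) auto
  \<comment> \<open>N + 1 rather than N avoids division by zero at N = 0. The argument -1 + x/(N+1)
    is at most 0 up to x = N + 1 and at least 1 from x = 2(N+1) on.\<close>
  define q where "q N = 1 / real (Suc N)" for N
  define a where "a N k x = q N ^ k * \<theta> k (- 1 + q N * x)" for N k x
  define b where "b N k x = (- q N) ^ k * \<theta> k (- 1 + (- q N) * x)" for N k x
  have ga: "gevrey_on UNIV (a N)" and gb: "gevrey_on UNIV (b N)" for N
    unfolding a_def b_def by (intro gevrey_on_affine g)+
  have q: "0 < q N" "q N \<le> 1" for N by (auto simp: q_def)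
  have qn: "q N * x \<le> 1" "(- q N) * x \<le> 1" if "\<bar>x\<bar> \<le> real N" for N x
  proof -
    have "\<bar>x\<bar> \<le> real (Suc N)" using that by simp
    then have "\<bar>q N * x\<bar> \<le> 1" by (simp add: q_def abs_mult field_simps)
    then show "q N * x \<le> 1" "(- q N) * x \<le> 1" by auto
  qed
  have bd: "\<bar>a N k x\<bar> \<le> C * M ^ k * (fact k)\<^sup>2" "\<bar>b N k x\<bar> \<le> C * M ^ k * (fact k)\<^sup>2" for N k x
  proof -
    have "\<bar>q N ^ k\<bar> \<le> 1" "\<bar>(- q N) ^ k\<bar> \<le> 1" using q[of N] by (auto simp: power_abs power_le_one)
    then have "\<bar>q N ^ k\<bar> * \<bar>\<theta> k t\<bar> \<le> 1 * (C * M ^ k * (fact k)\<^sup>2)" "\<bar>(- q N) ^ k\<bar> * \<bar>\<theta> k t\<bar> \<le> 1 * (C * M ^ k * (fact k)\<^sup>2)" for t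
      by (intro mult_mono CM; simp)+
    then show "\<bar>a N k x\<bar> \<le> C * M ^ k * (fact k)\<^sup>2" "\<bar>b N k x\<bar> \<le> C * M ^ k * (fact k)\<^sup>2"
      unfolding a_def b_def abs_mult by simp_all
  qed
  have S0: "\<theta> k t = 0" if "t \<le> 0" "0 < k" for k t using lS[OF that(1), of "k - 1"] that(2) by simp
  define \<zeta> where "\<zeta> N = leibniz (a N) (b N)" for N
  define B where "B k = (\<Sum>j\<le>k. real (k choose j) * ((C * M ^ j * (fact j)\<^sup>2) * (C * M ^ (k - j) * (fact (k - j))\<^sup>2)))" for k
  show ?thesis
  proof (rule that)
    show "(\<zeta> N k has_real_derivative \<zeta> N (Suc k) x) (at x)" for N k x
      unfolding \<zeta>_def by (rule leibniz_deriv; rule gevrey_on_deriv[OF ga] gevrey_on_deriv[OF gb]; simp)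
    show "\<bar>\<zeta> N k x\<bar> \<le> B k" for N k x
    proof -
      have "\<bar>\<zeta> N k x\<bar> \<le> (\<Sum>j\<le>k. \<bar>real (k choose j) * (a N j x * b N (k - j) x)\<bar>)"
        unfolding \<zeta>_def leibniz_def by (rule sum_abs)
      also have "\<dots> \<le> B k"
        unfolding B_def
      proof (rule sum_mono)
        fix j
        show "\<bar>real (k choose j) * (a N j x * b N (k - j) x)\<bar> \<le> real (k choose j) * ((C * M ^ j * (fact j)\<^sup>2) * (C * M ^ (k - j) * (fact (k - j))\<^sup>2))"
          unfolding abs_mult using CM by (intro mult_mono bd mult_nonneg_nonneg) auto
      qed
      finally show ?thesis .
    qed
    show "\<zeta> N 0 x = 1" if "\<bar>x\<bar> \<le> real N" for N x
      using qn[OF that] l[of "- 1 + q N * x"] l[of "- 1 + (- q N) * x"] by (simp add: \<zeta>_def leibniz_0 a_def b_def)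
    show "\<zeta> N k x = 0" if x: "\<bar>x\<bar> \<le> real N" and k: "0 < k" for N k x
      unfolding \<zeta>_def leibniz_def
    proof (rule sum.neutral, rule ballI)
      fix j
      have "a N j x * b N (k - j) x = 0"
      proof (cases "j = 0")
        case True
        have "\<theta> k (- 1 + (- q N) * x) = 0" by (rule S0[OF _ k]) (use qn[OF x] in linarith)
        then have "b N k x = 0" by (simp add: b_def)
        then show ?thesis using True by simp
      next
        case False
        have "\<theta> j (- 1 + q N * x) = 0" by (rule S0) (use qn[OF x] False in \<open>linarith, simp\<close>)
        then have "a N j x = 0" by (simp add: a_def)
        then show ?thesis by simp
      qed
      then show "real (k choose j) * (a N j x * b N (k - j) x) = 0" by simp
    qed
    show "\<zeta> N 0 x = 0" if x: "2 * real (Suc N) < \<bar>x\<bar>" for N x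
    proof (cases "0 \<le> x")
      case True
      then have "1 \<le> - 1 + q N * x" using x by (simp add: q_def field_simps)
      from r[OF this] show ?thesis by (simp add: \<zeta>_def leibniz_0 a_def)
    next
      case False
      then have "1 \<le> - 1 + (- q N) * x" using x by (simp add: q_def field_simps)
      from r[OF this] show ?thesis by (simp add: \<zeta>_def leibniz_0 b_def)
    qed
  qed
qed

section \<open>Pairing with the operator and density of its domain\<close>

lemma L2_inner_tendsto:
  assumes f: "f \<in> L2" and s: "\<And>n::nat. s n \<in> L2" and h: "h \<in> L2"
    and lim: "(\<lambda>n. L2_norm (\<lambda>x. s n x - h x)) \<longlonglongrightarrow> 0"
  shows "(\<lambda>n. L2_inner f (s n)) \<longlonglongrightarrow> L2_inner f h"
proof (rule LIM_zero_cancel, rule Lim_null_comparison)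
  show "\<forall>\<^sub>F n in sequentially. norm (L2_inner f (s n) - L2_inner f h) \<le> L2_norm f * L2_norm (\<lambda>x. s n x - h x)"
    using L2_Cauchy_Schwarz[OF f L2_diff[OF s h]] L2_inner_diff_right[OF s h f] by simp
  show "(\<lambda>n. L2_norm f * L2_norm (\<lambda>x. s n x - h x)) \<longlonglongrightarrow> 0"
    using tendsto_mult_right_zero[OF lim] .
qed

text \<open>The odd order changes sign under integration by parts: the formal adjoint of the second
  minus the third derivative is their sum.\<close>

lemma operator_A_pairing_test:
  fixes D :: "nat \<Rightarrow> real \<Rightarrow> real"
  assumes fg: "(f, g) \<in> operator_A"
    and D: "\<And>n x. (D n has_real_derivative D (Suc n) x) (at x)" and supp: "\<And>x. R < \<bar>x\<bar> \<Longrightarrow> D 0 x = 0"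
  shows "L2_inner g (D 0) = L2_inner f (D 2) + L2_inner f (D 3)"
proof -
  have "D 0 \<in> test_functions UNIV" by (rule test_function_of_derivs[OF D supp])
  then have "regular_distribution g (D 0) = distr_deriv 2 f (D 0) - distr_deriv 3 f (D 0)"
    using fg unfolding operator_A_def distr_eq_def by blast
  moreover have "partial 1 (D n) = D (Suc n)" for n by (rule partial_of_deriv(2)[OF D])
  ultimately show ?thesis
    by (simp add: regular_distribution_def L2_inner_def distr_deriv_def distr_partial_def numeral_eq_Suc)
qed

text \<open>The kernels to be paired with lack compact support, so the identity for test functions
  is applied to products with cutoffs. These and their derivatives converge in L2, because the
  cutoff bounds are independent of N.\<close>

lemma operator_A_pairing:
  fixes \<Psi> :: "nat \<Rightarrow> real \<Rightarrow> real"
  assumes fg: "(f, g) \<in> operator_A"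
    and D: "\<And>n x. (\<Psi> n has_real_derivative \<Psi> (Suc n) x) (at x)" and L: "\<And>n. \<Psi> n \<in> L2"
  shows "L2_inner g (\<Psi> 0) = L2_inner f (\<Psi> 2) + L2_inner f (\<Psi> 3)"
proof -
  have f: "f \<in> L2" and g: "g \<in> L2" using fg by (auto simp: operator_A_def sobolev_H_def)
  obtain \<zeta> B where \<zeta>: "\<And>N k x. (\<zeta> N k has_real_derivative \<zeta> N (Suc k) x) (at x)"
    and B: "\<And>N k x. \<bar>\<zeta> N k x\<bar> \<le> B k"
    and \<zeta>1: "\<And>N x. \<bar>x\<bar> \<le> real N \<Longrightarrow> \<zeta> N 0 x = 1"
    and \<zeta>0: "\<And>N k x. \<bar>x\<bar> \<le> real N \<Longrightarrow> 0 < k \<Longrightarrow> \<zeta> N k x = 0"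
    and \<zeta>s: "\<And>N x. 2 * real (Suc N) < \<bar>x\<bar> \<Longrightarrow> \<zeta> N 0 x = 0"
    by (rule smooth_cutoff, rule that) assumption+
  define F where "F N = leibniz (\<zeta> N) \<Psi>" for N :: nat
  have FD: "(F N k has_real_derivative F N (Suc k) x) (at x)" for N k x
    unfolding F_def by (rule leibniz_deriv, rule \<zeta>, rule D)
  have Fc: "F N k \<in> borel_measurable lebesgue" for N k
    using FD by (intro borel_measurable_lebesgue borel_measurable_continuous_onI continuous_at_imp_continuous_on)
      (auto intro: DERIV_isCont)
  have eq: "L2_inner g (F N 0) = L2_inner f (F N 2) + L2_inner f (F N 3)" for N
    by (rule operator_A_pairing_test[where D="F N" and R="2 * real (Suc N)", OF fg FD])
       (simp add: F_def leibniz_0 \<zeta>s)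
  have FN: "F N k x = \<Psi> k x" if "\<bar>x\<bar> \<le> real N" for N k x
  proof -
    have "F N k x = (\<Sum>j\<in>{0}. real (k choose j) * (\<zeta> N j x * \<Psi> (k - j) x))"
      unfolding F_def leibniz_def by (rule sum.mono_neutral_right) (auto simp: \<zeta>0[OF that])
    then show ?thesis by (simp add: \<zeta>1[OF that])
  qed
  have conv: "F N k \<in> L2" "(\<lambda>N. L2_norm (\<lambda>x. F N k x - \<Psi> k x)) \<longlonglongrightarrow> 0" for N k
  proof -
    \<comment> \<open>The Leibniz sum with every cutoff derivative replaced by its bound: a majorant
      for all N.\<close>
    define w where "w x = (\<Sum>j\<le>k. real (k choose j) * B j * \<bar>\<Psi> (k - j) x\<bar>)" for x
    have "(\<lambda>x. \<bar>\<Psi> n x\<bar>) \<in> L2" for n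
      by (rule L2_bound[OF L[of n]]) (use L2_measurable[OF L[of n]] in auto)
    then have w: "w \<in> L2" unfolding w_def by (intro L2_sum L2_cmult) auto
    have bd: "\<bar>F N k x\<bar> \<le> w x" for N x
    proof -
      have "\<bar>F N k x\<bar> \<le> (\<Sum>j\<le>k. \<bar>real (k choose j) * (\<zeta> N j x * \<Psi> (k - j) x)\<bar>)"
        unfolding F_def leibniz_def by (rule sum_abs)
      also have "\<dots> \<le> w x" unfolding w_def
      proof (rule sum_mono)
        fix j
        show "\<bar>real (k choose j) * (\<zeta> N j x * \<Psi> (k - j) x)\<bar> \<le> real (k choose j) * B j * \<bar>\<Psi> (k - j) x\<bar>"
          unfolding abs_mult mult.assoc
          using order_trans[OF abs_ge_zero B] by (intro mult_mono B mult_nonneg_nonneg) auto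
      qed
      finally show ?thesis .
    qed
    have lim: "(\<lambda>N. F N k x) \<longlonglongrightarrow> \<Psi> k x" for x
    proof (rule Lim_transform_eventually[OF tendsto_const])
      obtain N0 :: nat where "\<bar>x\<bar> \<le> real N0" using real_arch_simple by blast
      then show "\<forall>\<^sub>F N in sequentially. \<Psi> k x = F N k x"
        using eventually_ge_at_top[of N0] by (elim eventually_mono) (simp add: FN)
    qed
    show "F N k \<in> L2" "(\<lambda>N. L2_norm (\<lambda>x. F N k x - \<Psi> k x)) \<longlonglongrightarrow> 0"
      by (rule L2_dominated_convergence(2)[OF w Fc AE_I2[OF lim] L2_measurable[OF L] AE_I2[OF bd]],
          rule L2_dominated_convergence(3)[OF w Fc AE_I2[OF lim] L2_measurable[OF L] AE_I2[OF bd]])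
  qed
  have "(\<lambda>N. L2_inner g (F N 0)) \<longlonglongrightarrow> L2_inner g (\<Psi> 0)"
    by (rule L2_inner_tendsto[OF g conv(1) L conv(2)])
  moreover have "(\<lambda>N. L2_inner g (F N 0)) \<longlonglongrightarrow> L2_inner f (\<Psi> 2) + L2_inner f (\<Psi> 3)"
    unfolding eq by (intro tendsto_add L2_inner_tendsto[OF f conv(1) L conv(2)])
  ultimately show ?thesis by (rule LIMSEQ_unique)
qed

text \<open>Two opposite steps of width 1/(n+1), placed just inside the endpoints, multiply to a
  smooth function between 0 and the indicator in absolute value. Pointwise convergence can fail only
  at the endpoints.\<close>

lemma indicator_approx_operator_A:
  obtains s where "\<And>n::nat. \<exists>g. (s n, g) \<in> operator_A" "(\<lambda>n. L2_norm (\<lambda>x. s n x - indicator {a..b} x)) \<longlonglongrightarrow> 0"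
proof -
  obtain \<theta> where g: "gevrey_on UNIV \<theta>" and l: "\<And>t. t \<le> 0 \<Longrightarrow> \<theta> 0 t = 1" and r: "\<And>t. 1 \<le> t \<Longrightarrow> \<theta> 0 t = 0"
    and m: "\<And>t. \<bar>\<theta> 0 t\<bar> \<le> 1" and "\<And>n t. t \<le> 0 \<Longrightarrow> \<theta> (Suc n) t = 0" and rS: "\<And>n t. 1 \<le> t \<Longrightarrow> \<theta> (Suc n) t = 0"
    using gevrey_step by blast
  define q where "q n = real (Suc n)" for n
  define u where "u n k x = (- q n) ^ k * \<theta> k ((1 + q n * a) + (- q n) * x)" for n k x
  define v where "v n k x = q n ^ k * \<theta> k ((1 - q n * b) + q n * x)" for n k x
  have gu: "gevrey_on UNIV (u n)" and gv: "gevrey_on UNIV (v n)" for n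
    unfolding u_def v_def by (intro gevrey_on_affine g)+
  have q: "0 < q n" for n by (simp add: q_def)
  have z: "\<theta> k t = 0" if "1 \<le> t" for k t using r[OF that] rS[OF that] by (cases k) auto
  have u0: "u n k x = 0" if "x \<le> a" for n k x
  proof -
    have "1 \<le> (1 + q n * a) + (- q n) * x" using that mult_left_mono[OF that, of "q n"] q[of n] by simp
    then show ?thesis by (simp only: u_def z mult_zero_right)
  qed
  have v0: "v n k x = 0" if "b \<le> x" for n k x
  proof -
    have "1 \<le> (1 - q n * b) + q n * x" using that mult_left_mono[OF that, of "q n"] q[of n] by simp
    then show ?thesis by (simp only: v_def z mult_zero_right)
  qed
  define D where "D n = leibniz (u n) (v n)" for n
  have DD: "(D n k has_real_derivative D n (Suc k) x) (at x)" for n k x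
    unfolding D_def by (rule leibniz_deriv; rule gevrey_on_deriv[OF gu] gevrey_on_deriv[OF gv]; simp)
  have D0: "D n k x = 0" if "x \<le> a \<or> b \<le> x" for n k x
    using that by (auto simp: D_def leibniz_def u0 v0)
  have op: "\<exists>g. (D n 0, g) \<in> operator_A" for n
  proof -
    have "D n k x = 0" if "\<bar>a\<bar> + \<bar>b\<bar> < \<bar>x\<bar>" for k x
    proof (rule D0)
      show "x \<le> a \<or> b \<le> x" using that by (cases "0 \<le> x") auto
    qed
    from operator_A_smooth[of "D n", OF DD this] show ?thesis by blast
  qed
  have lim: "(\<lambda>n. D n 0 x) \<longlonglongrightarrow> indicator {a..b} x" if x: "x \<noteq> a" "x \<noteq> b" for x
  proof (cases "a < x \<and> x < b")
    case True
    define d where "d = min (x - a) (b - x)"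
    have d: "0 < d" using True by (simp add: d_def)
    obtain n0 :: nat where n0: "1 / d \<le> real n0" using real_arch_simple by blast
    have "D n 0 x = 1" if "n0 \<le> n" for n
    proof -
      have "1 / d \<le> q n" using n0 that by (simp add: q_def)
      then have "1 \<le> q n * d" using d by (simp add: field_simps)
      moreover have "q n * d \<le> q n * (x - a)" "q n * d \<le> q n * (b - x)"
        using q[of n] by (auto intro!: mult_left_mono simp: d_def)
      ultimately have "(1 + q n * a) + (- q n) * x \<le> 0" "(1 - q n * b) + q n * x \<le> 0"
        by (simp_all add: algebra_simps)
      then show ?thesis using l by (simp add: D_def leibniz_0 u_def v_def)
    qed
    then have "\<forall>\<^sub>F n in sequentially. indicator {a..b} x = D n 0 x"
      using True by (auto simp: eventually_sequentially)
    then show ?thesis by (rule Lim_transform_eventually[OF tendsto_const])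
  next
    case False
    then have "x \<le> a \<or> b \<le> x" by linarith
    moreover have "x \<notin> {a..b}" using False x by auto
    ultimately show ?thesis using D0 by simp
  qed
  have "(\<lambda>n. L2_norm (\<lambda>x. D n 0 x - indicator {a..b} x)) \<longlonglongrightarrow> 0"
  proof (rule L2_dominated_convergence(3)[OF L2_indicator_interval[of a b]])
    show "D n 0 \<in> borel_measurable lebesgue" for n
      using DD by (intro borel_measurable_lebesgue borel_measurable_continuous_onI continuous_at_imp_continuous_on)
        (auto intro: DERIV_isCont)
    show "indicat_real {a..b} \<in> borel_measurable lebesgue" by (rule L2_measurable[OF L2_indicator_interval])
    have "AE x in lebesgue. x \<noteq> a \<and> x \<noteq> b"
      by (intro AE_completion AE_conjI AE_lborel_singleton)
    then show "AE x in lebesgue. (\<lambda>n. D n 0 x) \<longlonglongrightarrow> indicat_real {a..b} x"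
      by (rule eventually_mono) (use lim in blast)
    have "\<bar>D n 0 x\<bar> \<le> indicat_real {a..b} x" for n x
    proof (cases "x \<in> {a..b}")
      case True
      have "\<bar>u n 0 x\<bar> * \<bar>v n 0 x\<bar> \<le> 1 * 1" unfolding u_def v_def using m by (intro mult_mono) auto
      then show ?thesis using True by (simp add: D_def leibniz_0 abs_mult)
    next
      case False
      then have "x \<le> a \<or> b \<le> x" by auto
      then show ?thesis using D0 False by simp
    qed
    then show "AE x in lebesgue. \<bar>D n 0 x\<bar> \<le> indicat_real {a..b} x" for n by simp
  qed
  with op show ?thesis by (rule that[of "\<lambda>n. D n 0"])
qed

text \<open>Density of the domain in the form of an induction rule; it extends identities between
  continuous linear functionals of \<open>f\<close> from the domain to L2.\<close>

lemma L2_operator_A_induct [consumes 1, case_names domain add cmult limit]: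
  fixes P :: "(real \<Rightarrow> real) \<Rightarrow> bool"
  assumes f: "f \<in> L2"
    and dom: "\<And>f g. (f, g) \<in> operator_A \<Longrightarrow> P f"
    and add: "\<And>f g. f \<in> L2 \<Longrightarrow> g \<in> L2 \<Longrightarrow> P f \<Longrightarrow> P g \<Longrightarrow> P (\<lambda>x. f x + g x)"
    and cmult: "\<And>f c. f \<in> L2 \<Longrightarrow> P f \<Longrightarrow> P (\<lambda>x. c * f x)"
    and lim: "\<And>s f. (\<And>n::nat. s n \<in> L2) \<Longrightarrow> f \<in> L2 \<Longrightarrow> (\<And>n. P (s n)) \<Longrightarrow>
      (\<lambda>n. L2_norm (\<lambda>x. s n x - f x)) \<longlonglongrightarrow> 0 \<Longrightarrow> P f"
  shows "P f"
  using f
proof (induction rule: L2_interval_induct)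
  case (interval a b)
  obtain s where s: "\<And>n::nat. \<exists>g. (s n, g) \<in> operator_A" "(\<lambda>n. L2_norm (\<lambda>x. s n x - indicator {a..b} x)) \<longlonglongrightarrow> 0"
    by (rule indicator_approx_operator_A[of a b], rule that) assumption+
  show ?case
  proof (rule lim[OF _ L2_indicator_interval _ s(2)])
    show "s n \<in> L2" for n using s(1)[of n] by (auto simp: operator_A_def sobolev_H_def)
    show "P (s n)" for n using s(1)[of n] dom by blast
  qed
next
  case (limit s f)
  then show ?case by (intro lim[of s f])
qed (use add cmult in blast)+

section \<open>Representation of the semigroup by convolution\<close>

lemma ekernel_curve_deriv:
  assumes "0 < \<delta> + t"
  shows "((\<lambda>t. ekernel k (\<delta> + t) t z) has_real_derivative ekernel (k + 2) (\<delta> + t) t z - ekernel (k + 3) (\<delta> + t) t z) (at t)"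
  using kernel_deriv_t[of \<delta> 1 t k 0 1 z] assms by simp

text \<open>Two applications of the mean value theorem. The orders 4, 5, 6 with weights 1, 2, 1 come
  from squaring the second minus the third derivative. The bound is quadratic in the step and
  uniform along the curve.\<close>

lemma ekernel_curve_remainder:
  assumes d: "0 < \<delta>" and \<sigma>: "0 \<le> \<sigma>" "\<sigma> < \<tau>" "\<tau> \<le> t"
  shows "\<bar>ekernel 0 (\<delta> + \<tau>) \<tau> z - ekernel 0 (\<delta> + \<sigma>) \<sigma> z - (\<tau> - \<sigma>) * (ekernel 2 (\<delta> + \<sigma>) \<sigma> z - ekernel 3 (\<delta> + \<sigma>) \<sigma> z)\<bar>
    \<le> (\<tau> - \<sigma>)\<^sup>2 * ((kernel_bound 4 \<delta> (\<delta> + t) + 2 * kernel_bound 5 \<delta> (\<delta> + t) + kernel_bound 6 \<delta> (\<delta> + t)) * weight z)"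
proof -
  let ?g = "\<lambda>k s. ekernel k (\<delta> + s) s z"
  let ?B = "\<lambda>k. kernel_bound k \<delta> (\<delta> + t) * weight z"
  have der: "(?g k has_real_derivative ?g (k + 2) s - ?g (k + 3) s) (at s)" if "0 \<le> s" for k s
    by (rule ekernel_curve_deriv) (use d that in simp)
  have der0: "(?g 0 has_real_derivative ?g 2 s - ?g 3 s) (at s)" if "0 \<le> s" for s
    using der[OF that, of 0] by (simp add: numeral_eq_Suc)
  have der1: "((\<lambda>s. ?g 2 s - ?g 3 s) has_real_derivative (?g 4 s - ?g 5 s) - (?g 5 s - ?g 6 s)) (at s)" if "0 \<le> s" for s
    using DERIV_diff[OF der[OF that, of 2] der[OF that, of 3]] by simp
  obtain s1 where s1: "\<sigma> < s1" "s1 < \<tau>" and e1: "?g 0 \<tau> - ?g 0 \<sigma> = (\<tau> - \<sigma>) * (?g 2 s1 - ?g 3 s1)"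
  proof -
    have "\<exists>z>\<sigma>. z < \<tau> \<and> ?g 0 \<tau> - ?g 0 \<sigma> = (\<tau> - \<sigma>) * (?g 2 z - ?g 3 z)"
      by (rule MVT2[OF \<sigma>(2)], rule der0) (use \<sigma>(1) in linarith)
    then show ?thesis using that by blast
  qed
  obtain s2 where s2: "\<sigma> < s2" "s2 < s1"
    and e2: "(?g 2 s1 - ?g 3 s1) - (?g 2 \<sigma> - ?g 3 \<sigma>) = (s1 - \<sigma>) * ((?g 4 s2 - ?g 5 s2) - (?g 5 s2 - ?g 6 s2))"
  proof -
    have "\<exists>z>\<sigma>. z < s1 \<and> (?g 2 s1 - ?g 3 s1) - (?g 2 \<sigma> - ?g 3 \<sigma>) = (s1 - \<sigma>) * ((?g 4 z - ?g 5 z) - (?g 5 z - ?g 6 z))"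
      by (rule MVT2[OF s1(1)], rule der1) (use \<sigma>(1) in linarith)
    then show ?thesis using that by blast
  qed
  have b: "\<bar>?g k s2\<bar> \<le> ?B k" for k
    by (rule ekernel_weight) (use d \<sigma> s1 s2 in auto)
  have b2: "\<bar>(?g 4 s2 - ?g 5 s2) - (?g 5 s2 - ?g 6 s2)\<bar> \<le> ?B 4 + 2 * ?B 5 + ?B 6"
    using b[of 4] b[of 5] b[of 6] by linarith
  have "?g 0 \<tau> - ?g 0 \<sigma> - (\<tau> - \<sigma>) * (?g 2 \<sigma> - ?g 3 \<sigma>) = (\<tau> - \<sigma>) * ((?g 2 s1 - ?g 3 s1) - (?g 2 \<sigma> - ?g 3 \<sigma>))"
    unfolding e1 by (simp add: right_diff_distrib)
  also have "\<bar>\<dots>\<bar> = (\<tau> - \<sigma>) * ((s1 - \<sigma>) * \<bar>(?g 4 s2 - ?g 5 s2) - (?g 5 s2 - ?g 6 s2)\<bar>)"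
    unfolding e2 using \<sigma> s1 by (simp add: abs_mult)
  also have "\<dots> \<le> (\<tau> - \<sigma>) * ((\<tau> - \<sigma>) * (?B 4 + 2 * ?B 5 + ?B 6))"
    using \<sigma> s1 b2 by (intro mult_mono mult_nonneg_nonneg) auto
  also have "\<dots> = (\<tau> - \<sigma>)\<^sup>2 * ((kernel_bound 4 \<delta> (\<delta> + t) + 2 * kernel_bound 5 \<delta> (\<delta> + t) + kernel_bound 6 \<delta> (\<delta> + t)) * weight z)"
    by (simp add: power2_eq_square algebra_simps)
  finally show ?thesis .
qed

text \<open>Reflection y to a - y gives the n-th derivative in y the sign (-1)^n. Thus the adjoint
  sum of second and third derivatives in y becomes a difference of kernels, which is also the time
  derivative along the curve.\<close>

lemma operator_A_pairing_ekernel: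
  assumes fg: "(f, g) \<in> operator_A" and p: "0 < p"
  shows "L2_inner g (\<lambda>y. ekernel 0 p s (a - y)) = L2_inner f (\<lambda>y. ekernel 2 p s (a - y) - ekernel 3 p s (a - y))"
proof -
  define \<Psi> where "\<Psi> n y = (- 1) ^ n * ekernel n p s (a - y)" for n y
  have f: "f \<in> L2" using fg by (auto simp: operator_A_def sobolev_H_def)
  have "(\<Psi> n has_real_derivative \<Psi> (Suc n) y) (at y)" for n y
  proof -
    have "((\<lambda>y. a - y) has_real_derivative - 1) (at y)" by (auto intro!: derivative_eq_intros)
    from DERIV_cmult[OF DERIV_chain2[OF kernel_deriv_x[OF p] this], of "(- 1) ^ n" n s]
    show ?thesis by (simp add: \<Psi>_def[abs_def])
  qed
  moreover have "\<Psi> n \<in> L2" for n unfolding \<Psi>_def by (intro L2_cmult ekernel_reflect_L2 p)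
  ultimately have "L2_inner g (\<Psi> 0) = L2_inner f (\<Psi> 2) + L2_inner f (\<Psi> 3)"
    by (rule operator_A_pairing[OF fg])
  also have "\<Psi> 3 = (\<lambda>y. (- 1) * ekernel 3 p s (a - y))" by (simp add: \<Psi>_def fun_eq_iff)
  also have "\<Psi> 2 = (\<lambda>y. ekernel 2 p s (a - y))" by (simp add: \<Psi>_def fun_eq_iff)
  also have "\<Psi> 0 = (\<lambda>y. ekernel 0 p s (a - y))" by (simp add: \<Psi>_def fun_eq_iff)
  finally show ?thesis
    unfolding L2_inner_cmult_right using L2_inner_diff_right[OF ekernel_reflect_L2[OF p] ekernel_reflect_L2[OF p] f] by simp
qed

lemma bounded_linear_L2_cmult:
  "bounded_linear_L2 B \<Longrightarrow> f \<in> L2 \<Longrightarrow> B (\<lambda>x. c * f x) =\<^sub>a (\<lambda>x. c * B f x)"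
  unfolding bounded_linear_L2_def by blast

locale kdvb_semigroup = L2_semigroup +
  assumes generator: "infinitesimal_generator S = operator_A"
begin

lemma domain_L2: "(f, g) \<in> operator_A \<Longrightarrow> f \<in> L2 \<and> g \<in> L2"
  by (auto simp: operator_A_def sobolev_H_def)

text \<open>The error of the difference quotient at time 0. It depends on h alone; errors at later
  times are compared with it.\<close>

definition quotient_error :: "(real \<Rightarrow> real) \<Rightarrow> (real \<Rightarrow> real) \<Rightarrow> real \<Rightarrow> real" where
  "quotient_error f g h = L2_norm (\<lambda>x. (S h f x - f x) / h - g x)"

lemma quotient_error_tendsto:
  "(f, g) \<in> operator_A \<Longrightarrow> (quotient_error f g \<longlongrightarrow> 0) (at_right 0)"
  using generator unfolding infinitesimal_generator_def quotient_error_def[abs_def] by blast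

lemma quotient_error_shift:
  assumes fg: "(f, g) \<in> operator_A" and s: "0 \<le> s" and h: "0 < h"
    and M: "\<And>f. f \<in> L2 \<Longrightarrow> L2_norm (S s f) \<le> M * L2_norm f"
  shows "L2_norm (\<lambda>x. (S (s + h) f x - S s f x) / h - S s g x) \<le> M * quotient_error f g h"
proof -
  have f: "f \<in> L2" and g: "g \<in> L2" using domain_L2[OF fg] by auto
  have Sf: "S h f \<in> L2" "S s f \<in> L2" "S s g \<in> L2" "S s (S h f) \<in> L2" "S (s + h) f \<in> L2"
    using s h f g by (auto intro!: closed)
  let ?c = "1 / h"
  have dL: "(\<lambda>x. S h f x - f x) \<in> L2" by (intro L2_diff Sf f)
  have 1: "S s (\<lambda>x. ?c * (S h f x - f x) + (- 1) * g x) =\<^sub>a (\<lambda>x. S s (\<lambda>x. ?c * (S h f x - f x)) x + (- 1) * S s g x)"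
    by (intro bounded_linear_L2_combination bl s L2_cmult dL g)
  have 2: "S s (\<lambda>x. ?c * (S h f x - f x)) =\<^sub>a (\<lambda>x. ?c * S s (\<lambda>x. S h f x - f x) x)"
    by (rule bounded_linear_L2_cmult[OF bl[OF s] dL])
  have 3: "S s (\<lambda>x. S h f x - f x) =\<^sub>a (\<lambda>x. S s (S h f) x - S s f x)"
    by (intro bounded_linear_L2_diff bl s Sf f)
  have 4: "S (s + h) f =\<^sub>a S s (S h f)" using s h f by (intro comp) auto
  have eq: "(\<lambda>x. (S (s + h) f x - S s f x) / h - S s g x) =\<^sub>a S s (\<lambda>x. ?c * (S h f x - f x) + (- 1) * g x)"
    using 1 2 3 4 unfolding eq_ae_def by eventually_elim simp
  have L: "(\<lambda>x. ?c * (S h f x - f x) + (- 1) * g x) \<in> L2" by (intro L2_add L2_cmult dL g)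
  have L': "(\<lambda>x. (S (s + h) f x - S s f x) / h - S s g x) \<in> L2"
    using L2_diff[OF L2_cmult[OF L2_diff[OF Sf(5) Sf(2)], of ?c] Sf(3)] by simp
  have "L2_norm (\<lambda>x. (S (s + h) f x - S s f x) / h - S s g x) = L2_norm (S s (\<lambda>x. ?c * (S h f x - f x) + (- 1) * g x))"
    by (rule L2_norm_cong[OF eq L' closed[OF s L]])
  also have "\<dots> \<le> M * L2_norm (\<lambda>x. ?c * (S h f x - f x) + (- 1) * g x)" by (rule M[OF L])
  finally show ?thesis by (simp add: quotient_error_def)
qed

text \<open>The difference quotient of \<open>S s f\<close> is, up to null sets, \<open>S s\<close>
  applied to that of \<open>f\<close>, so it converges to \<open>S s g\<close>; the identity of the
  generator with \<open>operator_A\<close> then applies in reverse.\<close>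

lemma domain_invariant:
  assumes fg: "(f, g) \<in> operator_A" and s: "0 \<le> s"
  shows "(S s f, S s g) \<in> operator_A"
proof -
  have f: "f \<in> L2" and g: "g \<in> L2" using domain_L2[OF fg] by auto
  obtain M where M: "\<And>f. f \<in> L2 \<Longrightarrow> L2_norm (S s f) \<le> M * L2_norm f"
    by (rule bounded_linear_L2_bound[OF bl[OF s]]) auto
  have le: "L2_norm (\<lambda>x. (S h (S s f) x - S s f x) / h - S s g x) \<le> M * quotient_error f g h" if h: "0 < h" for h
  proof -
    have e: "S h (S s f) =\<^sub>a S (s + h) f"
      using comp[of h s f] s h f by (simp add: add.commute eq_ae_def) (erule eventually_mono, simp)
    have L: "(\<lambda>x. (u x - S s f x) / h - S s g x) \<in> L2" if "u \<in> L2" for u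
      using L2_diff[OF L2_cmult[OF L2_diff[OF that closed[OF s f]], of "1 / h"] closed[OF s g]] by simp
    have "L2_norm (\<lambda>x. (S h (S s f) x - S s f x) / h - S s g x) = L2_norm (\<lambda>x. (S (s + h) f x - S s f x) / h - S s g x)"
    proof (rule L2_norm_cong)
      show "(\<lambda>x. (S h (S s f) x - S s f x) / h - S s g x) =\<^sub>a (\<lambda>x. (S (s + h) f x - S s f x) / h - S s g x)"
        using e unfolding eq_ae_def by eventually_elim simp
    qed (use s h f in \<open>auto intro!: L closed\<close>)
    then show ?thesis using quotient_error_shift[OF fg s h M] by simp
  qed
  have "((\<lambda>h. L2_norm (\<lambda>x. (S h (S s f) x - S s f x) / h - S s g x)) \<longlongrightarrow> 0) (at_right 0)"
  proof (rule Lim_null_comparison)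
    show "\<forall>\<^sub>F h in at_right 0. norm (L2_norm (\<lambda>x. (S h (S s f) x - S s f x) / h - S s g x)) \<le> M * quotient_error f g h"
      using le by (auto simp: eventually_at_right_less[of 0] intro: eventually_mono[OF eventually_at_right_less])
    show "((\<lambda>h. M * quotient_error f g h) \<longlongrightarrow> 0) (at_right 0)"
      using tendsto_mult_right_zero[OF quotient_error_tendsto[OF fg]] .
  qed
  then have "(S s f, S s g) \<in> infinitesimal_generator S"
    using closed[OF s f] closed[OF s g] by (simp add: infinitesimal_generator_def)
  then show ?thesis by (simp add: generator)
qed

text \<open>The pairing of \<open>S s f\<close> with a solution of the adjoint equation running backwards is
  constant: its increments over a step \<open>h\<close> are \<open>o(h)\<close> uniformly in \<open>s\<close>.\<close>

lemma duality_domain: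
  assumes fg: "(f, g) \<in> operator_A" and t: "0 \<le> t" and d: "0 < \<delta>"
  shows "L2_inner (S t f) (\<lambda>y. ekernel 0 \<delta> 0 (a - y)) = L2_inner f (\<lambda>y. ekernel 0 (\<delta> + t) t (a - y))"
proof -
  have f: "f \<in> L2" and g: "g \<in> L2" using domain_L2[OF fg] by auto
  define \<psi> where "\<psi> k \<tau> = (\<lambda>y. ekernel k (\<delta> + \<tau>) \<tau> (a - y))" for k \<tau>
  \<comment> \<open>F 0 and F t are the two sides of the claim; at s = t the kernel is the pure
    Gaussian.\<close>
  define F where "F s = L2_inner (S s f) (\<psi> 0 (t - s))" for s
  obtain M where M0: "M > 0" and M: "\<And>s f. 0 \<le> s \<Longrightarrow> s \<le> t \<Longrightarrow> f \<in> L2 \<Longrightarrow> L2_norm (S s f) \<le> M * L2_norm f"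
    using locally_bounded by blast
  define C0 where "C0 = kernel_bound 0 \<delta> (\<delta> + t) * L2_norm weight"
  define Q where "Q = kernel_bound 4 \<delta> (\<delta> + t) + 2 * kernel_bound 5 \<delta> (\<delta> + t) + kernel_bound 6 \<delta> (\<delta> + t)"
  have Q0: "0 \<le> Q" unfolding Q_def using d t by (intro add_nonneg_nonneg mult_nonneg_nonneg kernel_bound_nonneg) auto
  define C2 where "C2 = M * L2_norm f * (Q * L2_norm weight)"
  have \<psi>L: "\<psi> k \<tau> \<in> L2" if "0 \<le> \<tau>" for k \<tau>
    unfolding \<psi>_def by (rule ekernel_reflect_L2) (use that d in simp)
  have inc: "\<bar>F (s + h) - F s\<bar> \<le> h * (M * quotient_error f g h * C0 + C2 * h)" if s: "0 \<le> s" and h: "0 < h" and sh: "s + h \<le> t" for s h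
  proof -
    define \<sigma> where "\<sigma> = t - (s + h)"
    have \<sigma>: "0 \<le> \<sigma>" "\<sigma> < t - s" "t - s \<le> t" "(t - s) - \<sigma> = h" using s h sh by (auto simp: \<sigma>_def)
    have Sf: "S s f \<in> L2" "S s g \<in> L2" "S (s + h) f \<in> L2" using s h f g by (auto intro!: closed)
    note P = \<psi>L[OF \<sigma>(1)]
    have P': "\<psi> 0 (t - s) \<in> L2" by (rule \<psi>L) (use \<sigma> in linarith)
    \<comment> \<open>\<open>e\<close> is the first-order error of the semigroup at time s,
      \<open>r\<close> below that of the kernel. The former is small uniformly in s, the latter is
      O(h^2).\<close>
    define e where "e x = (S (s + h) f x - S s f x) / h - S s g x" for x
    define r where "r y = \<psi> 0 (t - s) y - \<psi> 0 \<sigma> y - h * (\<psi> 2 \<sigma> y - \<psi> 3 \<sigma> y)" for y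
    have eL: "e \<in> L2" unfolding e_def
      using L2_diff[OF L2_cmult[OF L2_diff[OF Sf(3,1)], of "1 / h"] Sf(2)] by simp
    have rL: "r \<in> L2" unfolding r_def by (intro L2_diff L2_cmult P P')
    \<comment> \<open>The first-order terms of the two factors cancel by this adjoint
      relation.\<close>
    have pair: "L2_inner (S s g) (\<psi> 0 \<sigma>) = L2_inner (S s f) (\<psi> 2 \<sigma>) - L2_inner (S s f) (\<psi> 3 \<sigma>)"
    proof -
      have "L2_inner (S s g) (\<psi> 0 \<sigma>) = L2_inner (S s f) (\<lambda>y. \<psi> 2 \<sigma> y - \<psi> 3 \<sigma> y)"
        unfolding \<psi>_def by (rule operator_A_pairing_ekernel[OF domain_invariant[OF fg s]]) (use d \<sigma> in simp)
      then show ?thesis by (simp add: L2_inner_diff_right[OF P P Sf(1)])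
    qed
    have e1: "h * L2_inner e (\<psi> 0 \<sigma>) = L2_inner (S (s + h) f) (\<psi> 0 \<sigma>) - L2_inner (S s f) (\<psi> 0 \<sigma>) - h * L2_inner (S s g) (\<psi> 0 \<sigma>)"
    proof -
      have "e = (\<lambda>x. (1 / h) * (S (s + h) f x - S s f x) - S s g x)" by (auto simp: e_def)
      then have "L2_inner e (\<psi> 0 \<sigma>) = (1 / h) * (L2_inner (S (s + h) f) (\<psi> 0 \<sigma>) - L2_inner (S s f) (\<psi> 0 \<sigma>)) - L2_inner (S s g) (\<psi> 0 \<sigma>)"
        by (simp only: L2_inner_diff_left[OF L2_cmult[OF L2_diff[OF Sf(3,1)]] Sf(2) P] L2_inner_cmult_left L2_inner_diff_left[OF Sf(3,1) P])
      then show ?thesis using h by (simp add: right_diff_distrib)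
    qed
    have e2: "L2_inner (S s f) r = L2_inner (S s f) (\<psi> 0 (t - s)) - L2_inner (S s f) (\<psi> 0 \<sigma>) - h * (L2_inner (S s f) (\<psi> 2 \<sigma>) - L2_inner (S s f) (\<psi> 3 \<sigma>))"
      unfolding r_def
      by (simp only: L2_inner_diff_right[OF L2_diff[OF P' P] L2_cmult[OF L2_diff[OF P P]] Sf(1)]
          L2_inner_diff_right[OF P' P Sf(1)] L2_inner_cmult_right L2_inner_diff_right[OF P P Sf(1)])
    have "F (s + h) - F s = h * L2_inner e (\<psi> 0 \<sigma>) - L2_inner (S s f) r"
    proof -
      have Fs: "F (s + h) = L2_inner (S (s + h) f) (\<psi> 0 \<sigma>)" "F s = L2_inner (S s f) (\<psi> 0 (t - s))"
        by (simp_all add: F_def \<sigma>_def)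
      show ?thesis unfolding e1 e2 pair Fs by simp
    qed
    moreover have "\<bar>L2_inner e (\<psi> 0 \<sigma>)\<bar> \<le> M * quotient_error f g h * C0"
    proof -
      have "\<bar>L2_inner e (\<psi> 0 \<sigma>)\<bar> \<le> L2_norm e * L2_norm (\<psi> 0 \<sigma>)" by (rule L2_Cauchy_Schwarz[OF eL P])
      also have "\<dots> \<le> (M * quotient_error f g h) * C0"
      proof (rule mult_mono)
        show "L2_norm e \<le> M * quotient_error f g h" unfolding e_def
          by (rule quotient_error_shift[OF fg s h]) (use M s h sh in simp)
        show "L2_norm (\<psi> 0 \<sigma>) \<le> C0" unfolding \<psi>_def C0_def
          by (rule ekernel_reflect_L2_norm) (use d \<sigma> s h in auto)
        show "0 \<le> M * quotient_error f g h" using M0 by (simp add: quotient_error_def)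
      qed simp
      finally show ?thesis .
    qed
    then have "\<bar>h * L2_inner e (\<psi> 0 \<sigma>)\<bar> \<le> h * (M * quotient_error f g h * C0)"
      unfolding abs_mult using h by (simp add: mult_left_mono)
    moreover have "\<bar>L2_inner (S s f) r\<bar> \<le> h * (C2 * h)"
    proof -
      have "L2_norm r \<le> L2_norm (\<lambda>y. h\<^sup>2 * Q * weight (a - y))"
      proof (rule L2_norm_mono)
        show "(\<lambda>y. h\<^sup>2 * Q * weight (a - y)) \<in> L2" by (intro L2_cmult weight_reflect_L2)
        show "r \<in> borel_measurable lebesgue" by (rule L2_measurable[OF rL])
        show "\<bar>r y\<bar> \<le> \<bar>h\<^sup>2 * Q * weight (a - y)\<bar>" for y
        proof -
          have "\<bar>r y\<bar> \<le> h\<^sup>2 * (Q * weight (a - y))"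
            using ekernel_curve_remainder[OF d \<sigma>(1,2,3), of "a - y"] unfolding \<sigma>(4) Q_def[symmetric] r_def \<psi>_def .
          then show ?thesis using order_trans[OF _ abs_ge_self] by (simp only: mult.assoc)
        qed
      qed
      also have "\<dots> = h\<^sup>2 * Q * L2_norm weight" using Q0 by (simp add: L2_norm_cmult weight_reflect_L2 abs_mult)
      finally have rn: "L2_norm r \<le> h\<^sup>2 * Q * L2_norm weight" .
      have "\<bar>L2_inner (S s f) r\<bar> \<le> L2_norm (S s f) * L2_norm r" by (rule L2_Cauchy_Schwarz[OF Sf(1) rL])
      also have "\<dots> \<le> (M * L2_norm f) * (h\<^sup>2 * Q * L2_norm weight)"
        using M0 M[OF s _ f] h sh rn by (intro mult_mono) auto
      finally show ?thesis by (simp add: C2_def power2_eq_square mult_ac)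
    qed
    ultimately have "\<bar>F (s + h) - F s\<bar> \<le> h * (M * quotient_error f g h * C0) + h * (C2 * h)" by linarith
    then show ?thesis by (simp only: distrib_left)
  qed
  have "F t = F 0"
  proof (cases "t = 0")
    case False
    then have t0: "0 < t" using t by simp
    \<comment> \<open>n + 1 equal steps: the increments add up to at most t times a quantity that
      tends to 0.\<close>
    define h where "h n = t / real (Suc n)" for n
    have h: "0 < h n" for n using t0 by (simp add: h_def)
    have le: "\<bar>F t - F 0\<bar> \<le> t * (M * quotient_error f g (h n) * C0 + C2 * h n)" for n
    proof -
      let ?c = "h n * (M * quotient_error f g (h n) * C0 + C2 * h n)"
      have "\<bar>F (real i * h n) - F 0\<bar> \<le> real i * ?c" if "i \<le> Suc n" for i
        using that
      proof (induction i)
        case (Suc i)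
        have "real i * h n + h n = real (Suc i) * h n" by (simp add: algebra_simps)
        also have "\<dots> \<le> real (Suc n) * h n" using Suc.prems h[of n] by (intro mult_right_mono) auto
        also have "\<dots> = t" by (simp add: h_def)
        finally have "\<bar>F (real i * h n + h n) - F (real i * h n)\<bar> \<le> ?c"
          using h[of n] by (intro inc) auto
        moreover have "\<bar>F (real i * h n) - F 0\<bar> \<le> real i * ?c" using Suc by simp
        moreover have "\<bar>A - B\<bar> \<le> c \<Longrightarrow> \<bar>B - D\<bar> \<le> X \<Longrightarrow> \<bar>A - D\<bar> \<le> X + c" for A B D c X :: real
          by linarith
        ultimately have "\<bar>F (real i * h n + h n) - F 0\<bar> \<le> real i * ?c + ?c" by blast
        moreover have "real (Suc i) * h n = real i * h n + h n" by (simp add: algebra_simps)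
        moreover have "real (Suc i) * ?c = real i * ?c + ?c" by (simp add: algebra_simps)
        ultimately show ?case by (simp only:)
      qed simp
      from this[of "Suc n"] have "\<bar>F (real (Suc n) * h n) - F 0\<bar> \<le> real (Suc n) * ?c" by simp
      moreover have "real (Suc n) * h n = t" by (simp add: h_def)
      ultimately show ?thesis by (simp only: mult.assoc[symmetric])
    qed
    have hlim: "filterlim h (at_right 0) sequentially"
      unfolding filterlim_at
    proof
      show "h \<longlonglongrightarrow> 0" unfolding h_def by (rule LIMSEQ_Suc[OF lim_const_over_n])
      show "\<forall>\<^sub>F n in sequentially. h n \<in> {0<..} \<and> h n \<noteq> 0" using h by (simp add: less_imp_neq[symmetric])
    qed
    have q: "(\<lambda>n. quotient_error f g (h n)) \<longlonglongrightarrow> 0"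
      using filterlim_compose[OF quotient_error_tendsto[OF fg] hlim] .
    have h0: "h \<longlonglongrightarrow> 0" using hlim unfolding filterlim_at by blast
    have "(\<lambda>n. t * (M * quotient_error f g (h n) * C0 + C2 * h n)) \<longlonglongrightarrow> t * (M * 0 * C0 + C2 * 0)"
      by (intro tendsto_intros q h0)
    then have "\<bar>F t - F 0\<bar> \<le> 0" by (intro LIMSEQ_le_const) (use le in auto)
    then show ?thesis by simp
  qed simp
  moreover have "F 0 = L2_inner f (\<psi> 0 t)"
    unfolding F_def using L2_inner_cong[OF at_0[OF f] closed[OF _ f] f \<psi>L[OF t]] by simp
  ultimately show ?thesis by (simp add: F_def \<psi>_def)
qed

text \<open>Both sides are continuous linear functionals of \<open>f\<close>, so the identity on the
  dense domain extends to all of L2.\<close>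

theorem duality:
  assumes f: "f \<in> L2" and t: "0 \<le> t" and d: "0 < \<delta>"
  shows "L2_inner (S t f) (\<lambda>y. ekernel 0 \<delta> 0 (a - y)) = conv 0 (\<delta> + t) t f a"
  unfolding conv_def using f
proof (induction rule: L2_operator_A_induct)
  case (domain f g)
  then show ?case by (rule duality_domain[OF _ t d])
next
  case (add f g)
  have k: "(\<lambda>y. ekernel 0 \<delta> 0 (a - y)) \<in> L2" "(\<lambda>y. ekernel 0 (\<delta> + t) t (a - y)) \<in> L2"
    using d t by (auto intro!: ekernel_reflect_L2)
  have "S t (\<lambda>x. f x + g x) =\<^sub>a (\<lambda>x. S t f x + S t g x)"
    using bounded_linear_L2_combination[OF bl[OF t] add(1,2), of 1] by simp
  then have "L2_inner (S t (\<lambda>x. f x + g x)) (\<lambda>y. ekernel 0 \<delta> 0 (a - y)) = L2_inner (\<lambda>x. S t f x + S t g x) (\<lambda>y. ekernel 0 \<delta> 0 (a - y))"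
    by (intro L2_inner_cong L2_add closed t add k)
  then show ?case
    using L2_inner_add_left[OF closed[OF t add(1)] closed[OF t add(2)] k(1)] L2_inner_add_left[OF add(1,2) k(2)] add(3,4) by simp
next
  case (cmult f c)
  have k: "(\<lambda>y. ekernel 0 \<delta> 0 (a - y)) \<in> L2" using d by (auto intro!: ekernel_reflect_L2)
  have "S t (\<lambda>x. c * f x) =\<^sub>a (\<lambda>x. c * S t f x)"
    by (rule bounded_linear_L2_cmult[OF bl[OF t] cmult(1)])
  then have "L2_inner (S t (\<lambda>x. c * f x)) (\<lambda>y. ekernel 0 \<delta> 0 (a - y)) = L2_inner (\<lambda>x. c * S t f x) (\<lambda>y. ekernel 0 \<delta> 0 (a - y))"
    by (intro L2_inner_cong L2_cmult closed t cmult k)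
  then show ?case using cmult(2) by (simp only: L2_inner_cmult_left)
next
  case (limit s f)
  have k: "(\<lambda>y. ekernel 0 \<delta> 0 (a - y)) \<in> L2" "(\<lambda>y. ekernel 0 (\<delta> + t) t (a - y)) \<in> L2"
    using d t by (auto intro!: ekernel_reflect_L2)
  obtain K where K: "\<And>f. f \<in> L2 \<Longrightarrow> L2_norm (S t f) \<le> K * L2_norm f"
    by (rule bounded_linear_L2_bound[OF bl[OF t]]) auto
  have "(\<lambda>n. L2_norm (\<lambda>x. S t (s n) x - S t f x)) \<longlonglongrightarrow> 0"
  proof (rule Lim_null_comparison)
    show "\<forall>\<^sub>F n in sequentially. norm (L2_norm (\<lambda>x. S t (s n) x - S t f x)) \<le> K * L2_norm (\<lambda>x. s n x - f x)"
      using K[OF L2_diff[OF limit(1,2)]] norm_diff[OF t limit(1,2)] by simp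
    show "(\<lambda>n. K * L2_norm (\<lambda>x. s n x - f x)) \<longlonglongrightarrow> 0" using tendsto_mult_right_zero[OF limit(3)] .
  qed
  from L2_inner_tendsto[OF k(1) closed[OF t limit(1)] closed[OF t limit(2)] this]
  have "(\<lambda>n. L2_inner (S t (s n)) (\<lambda>y. ekernel 0 \<delta> 0 (a - y))) \<longlonglongrightarrow> L2_inner (S t f) (\<lambda>y. ekernel 0 \<delta> 0 (a - y))"
    by (simp only: L2_inner_commute)
  moreover from L2_inner_tendsto[OF k(2) limit(1,2,3)]
  have "(\<lambda>n. L2_inner (s n) (\<lambda>y. ekernel 0 (\<delta> + t) t (a - y))) \<longlonglongrightarrow> L2_inner f (\<lambda>y. ekernel 0 (\<delta> + t) t (a - y))"
    by (simp only: L2_inner_commute)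
  ultimately show ?case unfolding limit(4) by (rule LIMSEQ_unique)
qed

end

section \<open>Gaussian mollification of interval indicators\<close>

lemma ekernel_Gaussian_nonneg: "0 < \<delta> \<Longrightarrow> 0 \<le> ekernel 0 \<delta> 0 z"
  by (simp add: kernel_Gaussian)

lemma ekernel_Gaussian_integral:
  assumes d: "0 < \<delta>"
  shows "integrable lborel (ekernel 0 \<delta> 0)" and "integral\<^sup>L lborel (ekernel 0 \<delta> 0) = 1"
proof -
  let ?p = "1 / (4 * \<delta>)"
  have p: "0 < ?p" using d by simp
  have e: "ekernel 0 \<delta> 0 = (\<lambda>z. exp (- (?p * z\<^sup>2)) / sqrt (4 * pi * \<delta>))"
    using kernel_Gaussian[OF d] by (simp add: fun_eq_iff)
  show "integrable lborel (ekernel 0 \<delta> 0)"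
    unfolding e by (intro integrable_divide Gaussian_integral p)
  have "pi / ?p = 4 * pi * \<delta>" by simp
  then have "integral\<^sup>L lborel (\<lambda>z. exp (- (?p * z\<^sup>2))) = sqrt (4 * pi * \<delta>)"
    using Gaussian_integral(2)[OF p] by (simp only:)
  then show "integral\<^sup>L lborel (ekernel 0 \<delta> 0) = 1"
    unfolding e integral_divide_zero using d by simp
qed

text \<open>With u = |z|/(2 sqrt \<delta>) one has 2u \<le> 1 + u^2 \<le> exp(u^2). The bound does
  not involve \<delta>, as needed for a majorant uniform in the mollification.\<close>

lemma ekernel_Gaussian_decay:
  assumes d: "0 < \<delta>" and z: "z \<noteq> 0"
  shows "ekernel 0 \<delta> 0 z \<le> 1 / \<bar>z\<bar>"
proof -
  let ?u = "\<bar>z\<bar> / (2 * sqrt \<delta>)"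
  have sd: "0 < sqrt \<delta>" using d by simp
  have "?u\<^sup>2 = z\<^sup>2 / (4 * \<delta>)" using d by (simp add: power_divide power_mult_distrib)
  then have "\<bar>z\<bar> / sqrt \<delta> \<le> 1 + z\<^sup>2 / (4 * \<delta>)"
    using sum_squares_bound[of 1 ?u] by simp
  also have "\<dots> \<le> exp (z\<^sup>2 / (4 * \<delta>))" by (rule exp_ge_add_one_self)
  finally have "\<bar>z\<bar> \<le> sqrt \<delta> * exp (z\<^sup>2 / (4 * \<delta>))" using sd by (simp add: field_simps)
  then have "\<bar>z\<bar> * exp (- (z\<^sup>2 / (4 * \<delta>))) \<le> sqrt \<delta> * exp (z\<^sup>2 / (4 * \<delta>)) * exp (- (z\<^sup>2 / (4 * \<delta>)))"
    by (rule mult_right_mono) simp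
  also have "\<dots> = sqrt \<delta>" by (simp only: mult.assoc exp_add[symmetric]) simp
  also have "\<dots> \<le> sqrt (4 * pi * \<delta>)"
  proof (rule real_sqrt_le_mono)
    have "1 * \<delta> \<le> (4 * pi) * \<delta>" using d pi_gt3 by (intro mult_right_mono) auto
    then show "\<delta> \<le> 4 * pi * \<delta>" by simp
  qed
  finally have "\<bar>z\<bar> * exp (- (z\<^sup>2 / (4 * \<delta>))) \<le> sqrt (4 * pi * \<delta>)" .
  moreover have "0 < sqrt (4 * pi * \<delta>)" using d by simp
  ultimately have "\<bar>z\<bar> * (exp (- (z\<^sup>2 / (4 * \<delta>))) / sqrt (4 * pi * \<delta>)) \<le> 1" by (simp add: field_simps)
  then show ?thesis unfolding kernel_Gaussian[OF d] using z by (simp add: field_simps)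
qed

text \<open>The convolution of the indicator with a Gaussian of variance 2 \<delta>. Integrating the
  Gaussian pairings over their centres turns them into a pairing with this function.\<close>

definition mollified_indicator :: "real \<Rightarrow> real \<Rightarrow> real \<Rightarrow> real \<Rightarrow> real" where
  "mollified_indicator c d \<delta> y = integral\<^sup>L lborel (\<lambda>a. indicator {c..d} a * ekernel 0 \<delta> 0 (a - y))"

lemma ekernel_Gaussian_shift_integral:
  assumes d: "0 < \<delta>"
  shows "integrable lborel (\<lambda>a. ekernel 0 \<delta> 0 (a - y))" and "integral\<^sup>L lborel (\<lambda>a. ekernel 0 \<delta> 0 (a - y)) = 1"
proof -
  show "integrable lborel (\<lambda>a. ekernel 0 \<delta> 0 (a - y))"
    using lborel_integrable_real_affine[OF ekernel_Gaussian_integral(1)[OF d], of 1 "- y"] by simp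
  show "integral\<^sup>L lborel (\<lambda>a. ekernel 0 \<delta> 0 (a - y)) = 1"
    using lborel_integral_real_affine[of 1 "ekernel 0 \<delta> 0" "- y"] ekernel_Gaussian_integral(2)[OF d] by simp
qed

lemma mollified_integrable:
  assumes d: "0 < \<delta>"
  shows "integrable lborel (\<lambda>a. indicator {c..d} a * ekernel 0 \<delta> 0 (a - y))"
proof (rule Bochner_Integration.integrable_bound[OF ekernel_Gaussian_shift_integral(1)[OF d, of y]])
  have [measurable]: "ekernel 0 \<delta> 0 \<in> borel_measurable borel" by (rule ekernel_measurable[OF d])
  show "(\<lambda>a. indicator {c..d} a * ekernel 0 \<delta> 0 (a - y)) \<in> borel_measurable lborel" by measurable
qed (auto split: split_indicator)

lemma mollified_indicator_bounds:
  assumes d: "0 < \<delta>"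
  shows "0 \<le> mollified_indicator c d \<delta> y" and "mollified_indicator c d \<delta> y \<le> 1"
proof -
  show "0 \<le> mollified_indicator c d \<delta> y"
    unfolding mollified_indicator_def by (rule Bochner_Integration.integral_nonneg) (simp add: ekernel_Gaussian_nonneg[OF d])
  have "mollified_indicator c d \<delta> y \<le> integral\<^sup>L lborel (\<lambda>a. ekernel 0 \<delta> 0 (a - y))"
    unfolding mollified_indicator_def
    by (intro integral_mono mollified_integrable ekernel_Gaussian_shift_integral d)
       (auto split: split_indicator simp: ekernel_Gaussian_nonneg[OF d])
  then show "mollified_indicator c d \<delta> y \<le> 1" by (simp add: ekernel_Gaussian_shift_integral(2)[OF d])
qed

lemma mollified_indicator_measurable:
  assumes d: "0 < \<delta>"
  shows "mollified_indicator c d \<delta> \<in> borel_measurable borel"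
proof -
  have [measurable]: "ekernel 0 \<delta> 0 \<in> borel_measurable borel" by (rule ekernel_measurable[OF d])
  have "(\<lambda>y. integral\<^sup>L lborel (\<lambda>a. indicator {c..d} a * ekernel 0 \<delta> 0 (a - y))) \<in> borel_measurable borel"
    by (rule lborel.borel_measurable_lebesgue_integral) measurable
  then show ?thesis unfolding mollified_indicator_def[abs_def] .
qed

text \<open>Near the interval the bound 1 suffices. For |y| > 2(|c|+|d|)+1 every a in the interval
  satisfies |a-y| \<ge> |y|/2, so the Gaussian is at most 2/|y|. The constant is independent of
  \<delta>.\<close>

lemma mollified_indicator_le_weight:
  assumes d: "0 < \<delta>" and cd: "c \<le> d"
  shows "mollified_indicator c d \<delta> y \<le> (2 * (\<bar>c\<bar> + \<bar>d\<bar>) + 2 + 4 * (d - c)) * weight y"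
proof -
  let ?R = "\<bar>c\<bar> + \<bar>d\<bar>"
  show ?thesis
  proof (cases "\<bar>y\<bar> \<le> 2 * ?R + 1")
    case True
    have "1 \<le> (2 * ?R + 2) * weight y"
      using True by (simp add: weight_def)
    also have "\<dots> \<le> (2 * ?R + 2 + 4 * (d - c)) * weight y"
      using cd by (intro mult_right_mono) (auto simp: weight_nonneg)
    finally show ?thesis using mollified_indicator_bounds(2)[OF d, of c d y] by linarith
  next
    case False
    have R0: "0 \<le> ?R" by simp
    have *: "1 \<le> Y" "A \<le> R \<Longrightarrow> Y \<le> B + A \<Longrightarrow> Y / 2 \<le> B" if "\<not> Y \<le> 2 * R + 1" "0 \<le> R" for Y R A B :: real
      using that by linarith+
    have y1: "1 \<le> \<bar>y\<bar>" by (rule *(1)[OF False R0])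
    have le: "indicator {c..d} a * ekernel 0 \<delta> 0 (a - y) \<le> indicator {c..d} a * (2 / \<bar>y\<bar>)" for a
    proof (cases "a \<in> {c..d}")
      case a: True
      then have aR: "\<bar>a\<bar> \<le> ?R" by auto
      moreover have "\<bar>y\<bar> \<le> \<bar>a - y\<bar> + \<bar>a\<bar>" using abs_triangle_ineq[of "y - a" a] by (simp add: abs_minus_commute)
      ultimately have ay: "\<bar>y\<bar> / 2 \<le> \<bar>a - y\<bar>" using *(2)[OF False R0] by blast
      then have "a - y \<noteq> 0" using y1 by auto
      then have "ekernel 0 \<delta> 0 (a - y) \<le> 1 / \<bar>a - y\<bar>" by (rule ekernel_Gaussian_decay[OF d])
      also have "\<dots> \<le> 1 / (\<bar>y\<bar> / 2)" using ay y1 by (intro frac_le) auto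
      finally show ?thesis using a by simp
    qed simp
    have i: "integrable lborel (\<lambda>a. indicator {c..d} a * (2 / \<bar>y\<bar>))"
      by (intro integrable_mult_left integrable_real_indicator) (auto simp: emeasure_lborel_Icc_eq)
    have "mollified_indicator c d \<delta> y \<le> integral\<^sup>L lborel (\<lambda>a. indicator {c..d} a * (2 / \<bar>y\<bar>))"
      unfolding mollified_indicator_def by (intro integral_mono mollified_integrable d i le)
    also have "\<dots> = (d - c) * (2 / \<bar>y\<bar>)" using cd by simp
    also have "\<dots> \<le> (d - c) * (4 * weight y)"
      using cd y1 by (intro mult_left_mono) (auto simp: weight_def divide_simps)
    also have "\<dots> \<le> (2 * ?R + 2 + 4 * (d - c)) * weight y"
      using weight_nonneg[of y] cd by (simp add: algebra_simps)
    finally show ?thesis .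
  qed
qed

text \<open>The substitution a = y + r z moves the parameter from the Gaussian into the indicator,
  leaving one fixed integrable majorant for all r.\<close>

lemma mollified_indicator_rescale:
  assumes r: "0 < r"
  shows "mollified_indicator c d (r\<^sup>2) y = integral\<^sup>L lborel (\<lambda>z. indicator {c..d} (y + r * z) * ekernel 0 1 0 z)"
proof -
  have "mollified_indicator c d (r\<^sup>2) y = \<bar>r\<bar> *\<^sub>R integral\<^sup>L lborel (\<lambda>z. indicator {c..d} (y + r * z) * ekernel 0 (r\<^sup>2) 0 (y + r * z - y))"
    unfolding mollified_indicator_def
    by (rule lborel_integral_real_affine[of r _ y]) (use r in simp)
  also have "\<dots> = integral\<^sup>L lborel (\<lambda>z. r * (indicator {c..d} (y + r * z) * ekernel 0 (r\<^sup>2) 0 (y + r * z - y)))"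
    using r by simp
  also have "\<dots> = integral\<^sup>L lborel (\<lambda>z. indicator {c..d} (y + r * z) * ekernel 0 1 0 z)"
  proof (rule Bochner_Integration.integral_cong[OF refl])
    fix z :: real
    have "sqrt (4 * pi * r\<^sup>2) = sqrt (4 * pi) * r" using r by (simp add: real_sqrt_mult)
    then have "r * ekernel 0 (r\<^sup>2) 0 (r * z) = ekernel 0 1 0 z"
      using r by (simp add: kernel_Gaussian power_mult_distrib)
    then show "r * (indicator {c..d} (y + r * z) * ekernel 0 (r\<^sup>2) 0 (y + r * z - y)) = indicator {c..d} (y + r * z) * ekernel 0 1 0 z"
      by (simp add: mult.left_commute)
  qed
  finally show ?thesis .
qed

text \<open>Away from the endpoints the rescaled indicator is eventually constant in n for each
  fixed z. At an endpoint of a nondegenerate interval the limit would be 1/2.\<close>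

lemma mollified_indicator_tendsto:
  assumes y: "y \<noteq> c" "y \<noteq> d" and r: "\<And>n::nat. 0 < r n" "r \<longlonglongrightarrow> 0"
  shows "(\<lambda>n. mollified_indicator c d ((r n)\<^sup>2) y) \<longlonglongrightarrow> indicator {c..d} y"
proof -
  have [measurable]: "ekernel 0 1 0 \<in> borel_measurable borel" by (rule ekernel_measurable) simp
  have "(\<lambda>n. integral\<^sup>L lborel (\<lambda>z. indicator {c..d} (y + r n * z) * ekernel 0 1 0 z)) \<longlonglongrightarrow> integral\<^sup>L lborel (\<lambda>z. indicator {c..d} y * ekernel 0 1 0 z)"
  proof (rule integral_dominated_convergence[where w="ekernel 0 1 0"])
    show "integrable lborel (ekernel 0 1 0)" by (rule ekernel_Gaussian_integral) simp
    show "AE z in lborel. (\<lambda>n. indicator {c..d} (y + r n * z) * ekernel 0 1 0 z) \<longlonglongrightarrow> indicator {c..d} y * ekernel 0 1 0 z"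
    proof (rule AE_I2)
      fix z :: real
      have l: "(\<lambda>n. y + r n * z) \<longlonglongrightarrow> y + 0 * z" by (intro tendsto_intros r)
      have "open (if y \<in> {c..d} then {c<..<d} else - {c..d})" "y \<in> (if y \<in> {c..d} then {c<..<d} else - {c..d})"
        using y by (auto intro!: open_Compl)
      with l have "\<forall>\<^sub>F n in sequentially. y + r n * z \<in> (if y \<in> {c..d} then {c<..<d} else - {c..d})"
        by (intro topological_tendstoD) auto
      then have "\<forall>\<^sub>F n in sequentially. indicat_real {c..d} y * ekernel 0 1 0 z = indicator {c..d} (y + r n * z) * ekernel 0 1 0 z"
        by (rule eventually_mono) (auto split: if_splits split_indicator)
      then show "(\<lambda>n. indicator {c..d} (y + r n * z) * ekernel 0 1 0 z) \<longlonglongrightarrow> indicator {c..d} y * ekernel 0 1 0 z"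
        by (rule Lim_transform_eventually[OF tendsto_const])
    qed
    show "AE z in lborel. norm (indicator {c..d} (y + r n * z) * ekernel 0 1 0 z) \<le> ekernel 0 1 0 z" for n
      by (rule AE_I2) (auto split: split_indicator simp: ekernel_Gaussian_nonneg)
  qed measurable
  moreover have "integral\<^sup>L lborel (\<lambda>z. indicator {c..d} y * ekernel 0 1 0 z) = indicator {c..d} y"
    using ekernel_Gaussian_integral(2)[of 1] by simp
  ultimately show ?thesis by (simp only: mollified_indicator_rescale[OF r(1)])
qed

lemma L2_borel_representative:
  assumes "f \<in> L2"
  obtains g where "g \<in> borel_measurable borel" "g \<in> L2" "f =\<^sub>a g"
proof -
  obtain g where g: "g \<in> borel_measurable lborel" "AE x in lborel. f x = g x"
    using completion_ex_borel_measurable_real[OF L2_measurable[OF assms]] by blast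
  have b: "g \<in> borel_measurable borel" using g by simp
  have ae: "f =\<^sub>a g" unfolding eq_ae_def using AE_completion[OF g(2)] .
  have m: "g \<in> borel_measurable lebesgue" using b by (rule borel_measurable_lebesgue)
  have "g \<in> L2"
  proof (rule L2_I[OF m])
    show "integrable lebesgue (\<lambda>x. (g x)\<^sup>2)"
    proof (rule Bochner_Integration.integrable_cong_AE_imp[OF L2_square_integrable[OF assms]])
      show "(\<lambda>x. (g x)\<^sup>2) \<in> borel_measurable lebesgue" using m by measurable
      show "AE x in lebesgue. (f x)\<^sup>2 = (g x)\<^sup>2" using ae unfolding eq_ae_def by eventually_elim simp
    qed
  qed
  from that[OF b this ae] show ?thesis .
qed

lemma mollified_indicator_L2:
  assumes d: "0 < \<delta>" and cd: "c \<le> d"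
  shows "mollified_indicator c d \<delta> \<in> L2"
proof (rule L2_bound)
  show "(\<lambda>y. (2 * (\<bar>c\<bar> + \<bar>d\<bar>) + 2 + 4 * (d - c)) * weight y) \<in> L2" by (intro L2_cmult weight_L2)
  show "mollified_indicator c d \<delta> \<in> borel_measurable lebesgue"
    by (intro borel_measurable_lebesgue mollified_indicator_measurable d)
  show "\<bar>mollified_indicator c d \<delta> y\<bar> \<le> \<bar>(2 * (\<bar>c\<bar> + \<bar>d\<bar>) + 2 + 4 * (d - c)) * weight y\<bar>" for y
    using mollified_indicator_le_weight[OF assms, of y] mollified_indicator_bounds(1)[OF d, of c d y] by linarith
qed

text \<open>Fubini, with integrability ensured by the L2 bound on the mollified indicator. A Borel
  representative of \<open>g\<close> provides measurability on the product.\<close>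

lemma L2_inner_mollified_indicator:
  assumes g: "g \<in> L2" and d: "0 < \<delta>" and cd: "c \<le> d"
  shows "L2_inner g (mollified_indicator c d \<delta>) = integral\<^sup>L lborel (\<lambda>a. indicator {c..d} a * L2_inner g (\<lambda>y. ekernel 0 \<delta> 0 (a - y)))"
proof -
  obtain h where [measurable]: "h \<in> borel_measurable borel" and h: "h \<in> L2" and gh: "g =\<^sub>a h"
    using L2_borel_representative[OF g] by blast
  have [measurable]: "ekernel 0 \<delta> 0 \<in> borel_measurable borel" by (rule ekernel_measurable[OF d])
  have [measurable]: "mollified_indicator c d \<delta> \<in> borel_measurable borel" by (rule mollified_indicator_measurable[OF d])
  let ?F = "\<lambda>(y, a). h y * (indicator {c..d} a * ekernel 0 \<delta> 0 (a - y))"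
  have F: "integrable (lborel \<Otimes>\<^sub>M lborel) ?F"
  proof (rule lborel_pair.Fubini_integrable)
    show "?F \<in> borel_measurable (lborel \<Otimes>\<^sub>M lborel)" by measurable
    have e: "integral\<^sup>L lborel (\<lambda>a. norm (?F (y, a))) = \<bar>h y\<bar> * mollified_indicator c d \<delta> y" for y
      by (simp add: mollified_indicator_def abs_mult ekernel_Gaussian_nonneg[OF d])
    have "(\<lambda>y. \<bar>h y\<bar>) \<in> L2" by (rule L2_bound[OF h]) (auto intro!: borel_measurable_lebesgue)
    from L2_mult_integrable[OF this mollified_indicator_L2[OF d cd]]
    show "integrable lborel (\<lambda>y. integral\<^sup>L lborel (\<lambda>a. norm (?F (y, a))))"
      unfolding e by (subst (asm) integrable_lebesgue_iff_lborel) measurable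
    show "AE y in lborel. integrable lborel (\<lambda>a. ?F (y, a))"
      by (rule AE_I2) (simp add: mollified_integrable[OF d])
  qed
  have "L2_inner g (mollified_indicator c d \<delta>) = L2_inner h (mollified_indicator c d \<delta>)"
    by (rule L2_inner_cong[OF gh g h mollified_indicator_L2[OF d cd]])
  also have "\<dots> = integral\<^sup>L lborel (\<lambda>y. h y * mollified_indicator c d \<delta> y)"
    unfolding L2_inner_def by (rule integral_lebesgue_eq_lborel) measurable
  also have "\<dots> = integral\<^sup>L lborel (\<lambda>y. integral\<^sup>L lborel (\<lambda>a. h y * (indicator {c..d} a * ekernel 0 \<delta> 0 (a - y))))"
    by (simp add: mollified_indicator_def)
  also have "\<dots> = integral\<^sup>L lborel (\<lambda>a. integral\<^sup>L lborel (\<lambda>y. h y * (indicator {c..d} a * ekernel 0 \<delta> 0 (a - y))))"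
    by (rule lborel_pair.Fubini_integral[OF F, symmetric])
  also have "\<dots> = integral\<^sup>L lborel (\<lambda>a. indicator {c..d} a * L2_inner g (\<lambda>y. ekernel 0 \<delta> 0 (a - y)))"
  proof (rule Bochner_Integration.integral_cong[OF refl])
    fix a :: real
    have "L2_inner g (\<lambda>y. ekernel 0 \<delta> 0 (a - y)) = L2_inner h (\<lambda>y. ekernel 0 \<delta> 0 (a - y))"
      by (rule L2_inner_cong[OF gh g h ekernel_reflect_L2[OF d]])
    also have "\<dots> = integral\<^sup>L lborel (\<lambda>y. h y * ekernel 0 \<delta> 0 (a - y))"
      unfolding L2_inner_def by (rule integral_lebesgue_eq_lborel) measurable
    finally show "integral\<^sup>L lborel (\<lambda>y. h y * (indicator {c..d} a * ekernel 0 \<delta> 0 (a - y))) = indicator {c..d} a * L2_inner g (\<lambda>y. ekernel 0 \<delta> 0 (a - y))"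
      by (simp only: mult.left_commute[of _ "indicat_real {c..d} a"] integral_mult_right_zero)
  qed
  finally show ?thesis .
qed

text \<open>The function \<open>w\<close> is not known to be square integrable, so the difference is
  cut to [-N, N]. It is orthogonal to all interval indicators, hence to all of L2, in particular to
  itself.\<close>

lemma L2_eq_ae_continuous:
  fixes g w :: "real \<Rightarrow> real"
  assumes g: "g \<in> L2" and w: "continuous_on UNIV w"
    and eq: "\<And>c d. c \<le> d \<Longrightarrow> L2_inner g (indicator {c..d}) = integral\<^sup>L lborel (\<lambda>a. indicator {c..d} a * w a)"
  shows "g =\<^sub>a w"
proof -
  have wm [measurable]: "w \<in> borel_measurable borel" using w by (rule borel_measurable_continuous_onI)
  define I where "I N = {- real N..real N}" for N :: nat
  have wI: "(\<lambda>x. indicator (I N) x * w x) \<in> L2" for N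
  proof (rule L2_borel_I)
    have "continuous_on (I N) (\<lambda>x. (w x)\<^sup>2)" by (intro continuous_intros continuous_on_subset[OF w]) auto
    then have "integrable lborel (\<lambda>x. indicator (I N) x *\<^sub>R (w x)\<^sup>2)"
      unfolding I_def by (intro borel_integrable_compact) auto
    then show "integrable lborel (\<lambda>x. (indicator (I N) x * w x)\<^sup>2)"
      by (rule back_subst[of "integrable lborel"]) (auto simp: fun_eq_iff split: split_indicator)
  qed (simp add: I_def)
  have gI: "(\<lambda>x. indicator (I N) x * g x) \<in> L2" for N
  proof (rule L2_bound[OF g])
    have "g \<in> borel_measurable lebesgue" by (rule L2_measurable[OF g])
    moreover have "indicat_real (I N) \<in> borel_measurable lebesgue"
      unfolding I_def by (rule L2_measurable[OF L2_indicator_interval])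
    ultimately show "(\<lambda>x. indicator (I N) x * g x) \<in> borel_measurable lebesgue" by measurable
  qed (auto split: split_indicator)
  define v where "v N x = indicator (I N) x * g x - indicator (I N) x * w x" for N x
  have vL: "v N \<in> L2" for N unfolding v_def by (intro L2_diff gI wI)
  have orth: "L2_inner h (v N) = 0" if "h \<in> L2" for h N
    using that
  proof (induction rule: L2_interval_induct)
    case (interval a b)
    let ?c = "max a (- real N)" and ?d = "min b (real N)"
    have "L2_inner (indicator {a..b}) (v N) = L2_inner (indicator {a..b}) (\<lambda>x. indicator (I N) x * g x) - L2_inner (indicator {a..b}) (\<lambda>x. indicator (I N) x * w x)"
      unfolding v_def by (rule L2_inner_diff_right[OF gI wI L2_indicator_interval])
    also have "L2_inner (indicator {a..b}) (\<lambda>x. indicator (I N) x * g x) = L2_inner g (indicator {?c..?d})"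
      unfolding L2_inner_def by (intro Bochner_Integration.integral_cong refl) (auto simp: I_def split: split_indicator)
    also have "L2_inner (indicator {a..b}) (\<lambda>x. indicator (I N) x * w x) = integral\<^sup>L lborel (\<lambda>x. indicator {?c..?d} x * w x)"
    proof -
      have "L2_inner (indicator {a..b}) (\<lambda>x. indicator (I N) x * w x) = integral\<^sup>L lebesgue (\<lambda>x. indicator {?c..?d} x * w x)"
        unfolding L2_inner_def by (intro Bochner_Integration.integral_cong refl) (auto simp: I_def split: split_indicator)
      also have "\<dots> = integral\<^sup>L lborel (\<lambda>x. indicator {?c..?d} x * w x)"
        by (rule integral_lebesgue_eq_lborel) measurable
      finally show ?thesis .
    qed
    also have "L2_inner g (indicator {?c..?d}) - integral\<^sup>L lborel (\<lambda>x. indicator {?c..?d} x * w x) = 0"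
    proof (cases "?c \<le> ?d")
      case True
      then show ?thesis using eq[OF True] by simp
    next
      case False
      then have "{?c..?d} = {}" by auto
      then show ?thesis by (simp add: L2_inner_def del: atLeastatMost_empty_iff atLeastatMost_empty_iff2)
    qed
    finally show ?case .
  next
    case (add f g)
    then show ?case using L2_inner_add_left[OF add(1,2) vL] by simp
  next
    case (cmult f c)
    then show ?case by (simp only: L2_inner_cmult_left)
  next
    case (limit s f)
    have "(\<lambda>n. L2_inner (v N) (s n)) \<longlonglongrightarrow> L2_inner (v N) f"
      by (rule L2_inner_tendsto[OF vL limit(1,2,3)])
    then have "(\<lambda>n::nat. 0) \<longlonglongrightarrow> L2_inner f (v N)"
      using limit(4) by (simp add: L2_inner_commute[of "v N"])
    then show ?case using LIMSEQ_unique[OF _ tendsto_const] by blast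
  qed
  have "AE x in lebesgue. v N x = 0" for N
  proof (rule L2_norm_eq_0_imp[OF vL])
    have "(L2_norm (v N))\<^sup>2 = 0" unfolding L2_norm_inner by (rule orth[OF vL])
    then show "L2_norm (v N) = 0" by simp
  qed
  then have "AE x in lebesgue. \<forall>N. v N x = 0" by (simp add: AE_all_countable)
  then show ?thesis unfolding eq_ae_def
  proof eventually_elim
    case (elim x)
    obtain N :: nat where N: "\<bar>x\<bar> \<le> real N" using real_arch_simple by blast
    then have "x \<in> I N" by (auto simp: I_def)
    then show ?case using elim[rule_format, of N] by (simp add: v_def)
  qed
qed

text \<open>The duality identity is integrated over centres in [c, d] and \<delta> is sent to 0: one
  side tends to the pairing with the indicator, the other to the integral of the
  convolution.\<close>

lemma (in kdvb_semigroup) semigroup_eq_conv: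
  assumes f: "f \<in> L2" and t: "0 < t"
  shows "S t f =\<^sub>a conv 0 t t f"
proof (rule L2_eq_ae_continuous)
  have t': "0 \<le> t" using t by simp
  show SL: "S t f \<in> L2" by (rule closed[OF t' f])
  show "continuous_on UNIV (conv 0 t t f)"
    by (intro continuous_at_imp_continuous_on ballI DERIV_isCont[OF conv_deriv_x[OF f t]])
  fix c d :: real assume cd: "c \<le> d"
  define r where "r n = 1 / real (Suc n)" for n
  have r: "0 < r n" "r n \<le> 1" for n by (auto simp: r_def)
  have rl: "r \<longlonglongrightarrow> 0" unfolding r_def by (rule LIMSEQ_Suc[OF lim_const_over_n])
  have r2: "0 < (r n)\<^sup>2" "(r n)\<^sup>2 \<le> 1" for n using r[of n] by (auto simp: power_le_one)
  have r2l: "(\<lambda>n. (r n)\<^sup>2) \<longlonglongrightarrow> 0" using tendsto_power[OF rl, of 2] by simp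
  let ?C = "2 * (\<bar>c\<bar> + \<bar>d\<bar>) + 2 + 4 * (d - c)"
  have "(\<lambda>n. L2_inner (S t f) (mollified_indicator c d ((r n)\<^sup>2))) \<longlonglongrightarrow> L2_inner (S t f) (indicator {c..d})"
  proof (rule L2_inner_tendsto[OF SL mollified_indicator_L2[OF r2(1) cd] L2_indicator_interval])
    show "(\<lambda>n. L2_norm (\<lambda>x. mollified_indicator c d ((r n)\<^sup>2) x - indicator {c..d} x)) \<longlonglongrightarrow> 0"
    proof (rule L2_dominated_convergence(3)[OF L2_cmult[OF weight_L2, of ?C]])
      show "mollified_indicator c d ((r n)\<^sup>2) \<in> borel_measurable lebesgue" for n
        by (intro borel_measurable_lebesgue mollified_indicator_measurable r2)
      show "indicat_real {c..d} \<in> borel_measurable lebesgue" by (rule L2_measurable[OF L2_indicator_interval])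
      have "AE y in lebesgue. y \<noteq> c \<and> y \<noteq> d"
        by (intro AE_completion AE_conjI AE_lborel_singleton)
      then show "AE y in lebesgue. (\<lambda>n. mollified_indicator c d ((r n)\<^sup>2) y) \<longlonglongrightarrow> indicat_real {c..d} y"
        by (rule eventually_mono) (use mollified_indicator_tendsto[OF _ _ r(1) rl] in blast)
      show "AE y in lebesgue. \<bar>mollified_indicator c d ((r n)\<^sup>2) y\<bar> \<le> ?C * weight y" for n
        using mollified_indicator_le_weight[OF r2(1) cd] mollified_indicator_bounds(1)[OF r2(1)] by (intro AE_I2) simp
    qed
  qed
  moreover have "(\<lambda>n. L2_inner (S t f) (mollified_indicator c d ((r n)\<^sup>2))) \<longlonglongrightarrow> integral\<^sup>L lborel (\<lambda>a. indicator {c..d} a * conv 0 t t f a)"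
  proof -
    have eq: "L2_inner (S t f) (mollified_indicator c d ((r n)\<^sup>2)) = integral\<^sup>L lborel (\<lambda>a. indicator {c..d} a * conv 0 ((r n)\<^sup>2 + t) t f a)" for n
      unfolding L2_inner_mollified_indicator[OF SL r2(1) cd] duality[OF f t' r2(1)] ..
    have cm [measurable]: "conv 0 ((r n)\<^sup>2 + t) t f \<in> borel_measurable borel" for n
      by (intro borel_measurable_continuous_onI continuous_at_imp_continuous_on ballI DERIV_isCont[OF conv_deriv_x[OF f]]
          add_pos_pos r2(1) t)
    have cm0 [measurable]: "conv 0 t t f \<in> borel_measurable borel"
      by (intro borel_measurable_continuous_onI continuous_at_imp_continuous_on ballI DERIV_isCont[OF conv_deriv_x[OF f t]])
    \<comment> \<open>The squares of \<open>r n\<close> are at most 1, so the diffusion parameter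
      stays between t and 1 + t.\<close>
    let ?K = "L2_norm f * (kernel_bound 0 t (1 + t) * L2_norm weight)"
    show ?thesis unfolding eq
    proof (rule integral_dominated_convergence[where w="\<lambda>a. indicator {c..d} a * ?K"])
      show "integrable lborel (\<lambda>a. indicator {c..d} a * ?K)"
        by (intro integrable_mult_left integrable_real_indicator) (auto simp: emeasure_lborel_Icc_eq)
      show "AE a in lborel. (\<lambda>n. indicator {c..d} a * conv 0 ((r n)\<^sup>2 + t) t f a) \<longlonglongrightarrow> indicator {c..d} a * conv 0 t t f a"
      proof (intro AE_I2 tendsto_mult_left)
        fix a :: real
        \<comment> \<open>Direction b = 1, e = 0: only the diffusion parameter varies, and
          differentiability in it gives the continuity.\<close>
        have "((\<lambda>s. conv 0 (t + 1 * s) (t + 0 * s) f a) has_real_derivative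
          1 * conv (0 + 2) (t + 1 * 0) (t + 0 * 0) f a - 0 * conv (0 + 3) (t + 1 * 0) (t + 0 * 0) f a) (at 0)"
          by (rule conv_deriv_t[OF f]) (use t in simp)
        then have "isCont (\<lambda>s. conv 0 (t + 1 * s) (t + 0 * s) f a) 0" by (rule DERIV_isCont)
        from isCont_tendsto_compose[OF this r2l]
        show "(\<lambda>n. conv 0 ((r n)\<^sup>2 + t) t f a) \<longlonglongrightarrow> conv 0 t t f a" by (simp add: add.commute)
      qed
      show "AE a in lborel. norm (indicator {c..d} a * conv 0 ((r n)\<^sup>2 + t) t f a) \<le> indicator {c..d} a * ?K" for n
      proof (rule AE_I2)
        fix a :: real
        have "\<bar>conv 0 ((r n)\<^sup>2 + t) t f a\<bar> \<le> ?K"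
          by (rule conv_bound[OF f t]) (use r2[of n] t in auto)
        then show "norm (indicator {c..d} a * conv 0 ((r n)\<^sup>2 + t) t f a) \<le> indicator {c..d} a * ?K"
          by (simp split: split_indicator)
      qed
    qed measurable
  qed
  ultimately show "L2_inner (S t f) (indicator {c..d}) = integral\<^sup>L lborel (\<lambda>a. indicator {c..d} a * conv 0 t t f a)"
    by (rule LIMSEQ_unique)
qed

section \<open>Cauchy problem in the space variable\<close>

lemma gevrey_on_lincomb:
  assumes D: "gevrey_on I D" and E: "gevrey_on I E"
  shows "gevrey_on I (\<lambda>n t. D n t + c * E n t)"
proof -
  obtain C1 M1 where 1: "0 \<le> C1" "0 \<le> M1" "\<And>n t. t \<in> I \<Longrightarrow> \<bar>D n t\<bar> \<le> C1 * M1 ^ n * (fact n)\<^sup>2"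
    using gevrey_on_bound[OF D] by blast
  obtain C2 M2 where 2: "0 \<le> C2" "0 \<le> M2" "\<And>n t. t \<in> I \<Longrightarrow> \<bar>E n t\<bar> \<le> C2 * M2 ^ n * (fact n)\<^sup>2"
    using gevrey_on_bound[OF E] by blast
  show ?thesis
  proof (rule gevrey_onI)
    show "((\<lambda>t. D n t + c * E n t) has_real_derivative D (Suc n) t + c * E (Suc n) t) (at t)" if "t \<in> I" for n t
      by (intro DERIV_add DERIV_cmult gevrey_on_deriv[OF D that] gevrey_on_deriv[OF E that])
    show "\<bar>D n t + c * E n t\<bar> \<le> (C1 + \<bar>c\<bar> * C2) * (M1 + M2) ^ n * (fact n)\<^sup>2" if t: "t \<in> I" for n t
    proof -
      have m: "M1 ^ n \<le> (M1 + M2) ^ n" "M2 ^ n \<le> (M1 + M2) ^ n" using 1 2 by (auto intro!: power_mono)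
      have "\<bar>D n t + c * E n t\<bar> \<le> \<bar>D n t\<bar> + \<bar>c\<bar> * \<bar>E n t\<bar>"
        using abs_triangle_ineq[of "D n t" "c * E n t"] by (simp add: abs_mult)
      also have "\<dots> \<le> C1 * M1 ^ n * (fact n)\<^sup>2 + \<bar>c\<bar> * (C2 * M2 ^ n * (fact n)\<^sup>2)"
        by (intro add_mono mult_left_mono 1 2 t) simp
      also have "\<dots> \<le> C1 * (M1 + M2) ^ n * (fact n)\<^sup>2 + \<bar>c\<bar> * (C2 * (M1 + M2) ^ n * (fact n)\<^sup>2)"
        using 1 2 by (intro add_mono mult_left_mono mult_right_mono m) auto
      finally show ?thesis by (simp add: algebra_simps)
    qed
  qed (use 1 2 in auto)
qed

text \<open>The growth condition under which the power series with coefficients h k t / k! converges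
  for every x, uniformly for t in \<open>I\<close>.\<close>

definition entire_coeffs :: "real set \<Rightarrow> (nat \<Rightarrow> real \<Rightarrow> real) \<Rightarrow> bool" where
  "entire_coeffs I h \<longleftrightarrow> (\<forall>\<rho>>0. \<exists>C. \<forall>k. \<forall>t\<in>I. \<bar>h k t\<bar> \<le> C * fact k * \<rho> ^ k)"

text \<open>The moments in \<open>kernel_bound k\<close> have index at most k + 2, whence the
  factorial. Taking q \<ge> 1 makes the powers monotone in the index, and the coefficient k is
  absorbed by 2^k.\<close>

lemma kernel_bound_growth:
  assumes p: "0 < p" and R: "0 \<le> R"
  obtains C Q where "0 \<le> C" "1 \<le> Q" "\<And>k. kernel_bound k p R \<le> C * Q ^ k * sqrt (fact (k + 2))"
proof -
  define q where "q = max 1 (1 / sqrt p)"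
  define K where "K = sqrt (pi / (p / 2))"
  have q: "1 \<le> q" "1 / sqrt p \<le> q" by (auto simp: q_def)
  have K: "0 \<le> K" using p by (simp add: K_def)
  have mb: "moment_bound j p \<le> sqrt (fact (k + 2)) * q ^ (k + 2) * K" if j: "j \<le> k + 2" for j k
  proof -
    have "moment_bound j p = sqrt (fact j) * (1 / sqrt p) ^ j * K"
      unfolding moment_bound_def K_def power_divide power_one by simp
    also have "\<dots> \<le> sqrt (fact (k + 2)) * q ^ (k + 2) * K"
    proof (intro mult_right_mono mult_mono K)
      show "sqrt (fact j) \<le> sqrt (fact (k + 2))" using j by (intro real_sqrt_le_mono fact_mono)
      have "(1 / sqrt p) ^ j \<le> q ^ j" using q p by (intro power_mono) auto
      also have "\<dots> \<le> q ^ (k + 2)" using q j by (intro power_increasing)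
      finally show "(1 / sqrt p) ^ j \<le> q ^ (k + 2)" .
    qed (use p in auto)
    finally show ?thesis .
  qed
  have "kernel_bound k p R \<le> ((1 + 5 * R) * q\<^sup>2 * K) * (2 * q) ^ k * sqrt (fact (k + 2))" for k
  proof -
    let ?m = "sqrt (fact (k + 2)) * q ^ (k + 2) * K"
    have m0: "0 \<le> ?m" using q K by simp
    have "kernel_bound k p R \<le> ?m + real k * ?m + 3 * R * ?m + 2 * R * ?m"
      unfolding kernel_bound_def using R by (intro add_mono mult_left_mono mb) auto
    also have "\<dots> = (1 + real k + 5 * R) * ?m" by (simp add: algebra_simps)
    also have "\<dots> \<le> ((1 + 5 * R) * 2 ^ k) * ?m"
    proof (rule mult_right_mono[OF _ m0])
      have "Suc k \<le> 2 ^ k" using less_exp[of k] by (simp add: Suc_le_eq)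
      then have "real (Suc k) \<le> real (2 ^ k)" by (simp only: of_nat_le_iff)
      then have a: "1 + real k \<le> 2 ^ k" by simp
      have "R * 1 \<le> R * 2 ^ k" using R by (intro mult_left_mono) auto
      with a show "1 + real k + 5 * R \<le> (1 + 5 * R) * 2 ^ k" by (simp add: algebra_simps)
    qed
    also have "\<dots> = ((1 + 5 * R) * q\<^sup>2 * K) * (2 * q) ^ k * sqrt (fact (k + 2))"
      by (simp add: power_add power_mult_distrib power2_eq_square)
    finally show ?thesis .
  qed
  moreover have "0 \<le> (1 + 5 * R) * q\<^sup>2 * K" using R K by simp
  moreover have "1 \<le> 2 * q" using q by simp
  ultimately show ?thesis using that by blast
qed

text \<open>The shift by two costs only 2 * 2^k, and D^(2k) \<le> exp(D^2) k! lets the missing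
  square root of k! swallow the geometric factor D^k, where D = 2Q/\<rho>.\<close>

lemma sqrt_fact_growth:
  assumes \<rho>: "0 < \<rho>" and Q: "0 \<le> Q"
  obtains C where "0 \<le> C" "\<And>k. Q ^ k * sqrt (fact (k + 2)) \<le> C * fact k * \<rho> ^ k"
proof -
  define D where "D = 2 * Q / \<rho>"
  have D: "0 \<le> D" using \<rho> Q by (simp add: D_def)
  have "Q ^ k * sqrt (fact (k + 2)) \<le> (2 * sqrt (exp (D\<^sup>2))) * fact k * \<rho> ^ k" for k
  proof -
    have "Suc k \<le> 2 ^ k" using less_exp[of k] by (simp add: Suc_le_eq)
    then have k1: "real (Suc k) \<le> 2 ^ k" using of_nat_le_iff[of "Suc k" "2 ^ k", where ?'a=real] by simp
    then have k2: "real (k + 2) \<le> 2 * 2 ^ k" using one_le_power[of "2::real" k] by simp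
    have "fact (k + 2) = real (k + 2) * (real (Suc k) * fact k)" by (simp add: algebra_simps)
    also have "\<dots> \<le> (2 * 2 ^ k) * (2 ^ k * fact k)" by (intro mult_mono k1 k2) auto
    also have "\<dots> \<le> (2 * 2 ^ k)\<^sup>2 * fact k" by (simp add: power2_eq_square)
    finally have "sqrt (fact (k + 2)) \<le> sqrt ((2 * 2 ^ k)\<^sup>2 * fact k)" by (rule real_sqrt_le_mono)
    also have "\<dots> = 2 * 2 ^ k * sqrt (fact k)" by (simp add: real_sqrt_mult)
    finally have 1: "sqrt (fact (k + 2)) \<le> 2 * 2 ^ k * sqrt (fact k)" .
    have "(D\<^sup>2) ^ k / fact k \<le> exp (D\<^sup>2)" by (rule power_div_fact_le_exp) simp
    then have "(D ^ k)\<^sup>2 \<le> exp (D\<^sup>2) * fact k" by (simp add: divide_simps power_mult[symmetric] mult.commute)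
    then have "sqrt ((D ^ k)\<^sup>2) \<le> sqrt (exp (D\<^sup>2) * fact k)" by (rule real_sqrt_le_mono)
    then have 2: "D ^ k \<le> sqrt (exp (D\<^sup>2)) * sqrt (fact k)" using D by (simp add: real_sqrt_mult)
    have "Q ^ k * sqrt (fact (k + 2)) \<le> Q ^ k * (2 * 2 ^ k * sqrt (fact k))"
      using Q by (intro mult_left_mono 1) auto
    also have "\<dots> = 2 * (D ^ k * sqrt (fact k)) * \<rho> ^ k"
      using \<rho> by (simp add: D_def power_mult_distrib power_divide)
    also have "\<dots> \<le> 2 * ((sqrt (exp (D\<^sup>2)) * sqrt (fact k)) * sqrt (fact k)) * \<rho> ^ k"
      using \<rho> by (intro mult_right_mono mult_left_mono 2) auto
    also have "\<dots> = (2 * sqrt (exp (D\<^sup>2))) * fact k * \<rho> ^ k" by (simp add: mult.assoc)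
    finally show ?thesis .
  qed
  then show ?thesis by (intro that[of "2 * sqrt (exp (D\<^sup>2))"]) auto
qed

lemma conv_entire_bound:
  assumes f: "f \<in> L2" and t0: "0 < t0" and \<rho>: "0 < \<rho>"
  obtains C where "\<And>k t x. t0 \<le> t \<Longrightarrow> t \<le> t1 \<Longrightarrow> \<bar>conv k t t f x\<bar> \<le> C * fact k * \<rho> ^ k"
proof -
  let ?R = "max t0 t1"
  have "0 \<le> ?R" using t0 by simp
  obtain C Q where C: "0 \<le> C" and Q: "1 \<le> Q" and kb: "\<And>k. kernel_bound k t0 ?R \<le> C * Q ^ k * sqrt (fact (k + 2))"
    by (rule kernel_bound_growth[OF t0 \<open>0 \<le> ?R\<close>]) auto
  obtain C' where C': "0 \<le> C'" "\<And>k. Q ^ k * sqrt (fact (k + 2)) \<le> C' * fact k * \<rho> ^ k"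
    by (rule sqrt_fact_growth[OF \<rho>, of Q]) (use Q in auto)
  have "\<bar>conv k t t f x\<bar> \<le> (L2_norm f * C * C' * L2_norm weight) * fact k * \<rho> ^ k" if "t0 \<le> t" "t \<le> t1" for k t x
  proof -
    have "\<bar>conv k t t f x\<bar> \<le> L2_norm f * (kernel_bound k t0 ?R * L2_norm weight)"
      by (rule conv_bound[OF f t0]) (use that t0 in auto)
    also have "\<dots> \<le> L2_norm f * ((C * (Q ^ k * sqrt (fact (k + 2)))) * L2_norm weight)"
      using kb[of k] by (intro mult_left_mono mult_right_mono) (auto simp: mult.assoc)
    also have "\<dots> \<le> L2_norm f * ((C * (C' * fact k * \<rho> ^ k)) * L2_norm weight)"
      by (intro mult_left_mono mult_right_mono C C') auto
    finally show ?thesis by (simp add: mult_ac)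
  qed
  then show ?thesis by (rule that)
qed

text \<open>\<open>conv_coeff f k n\<close> is the \<open>n\<close>-th time derivative of the \<open>k\<close>-th space derivative, at the
  origin, of the solution with initial value \<open>f\<close>.\<close>

fun conv_coeff :: "(real \<Rightarrow> real) \<Rightarrow> nat \<Rightarrow> nat \<Rightarrow> real \<Rightarrow> real" where
  "conv_coeff f k 0 t = conv k t t f 0"
| "conv_coeff f k (Suc n) t = conv_coeff f (k + 2) n t - conv_coeff f (k + 3) n t"

lemma conv_coeff_deriv:
  assumes f: "f \<in> L2" and t: "0 < t"
  shows "(conv_coeff f k n has_real_derivative conv_coeff f k (Suc n) t) (at t)"
proof (induction n arbitrary: k)
  case 0
  have "((\<lambda>t. conv k (0 + 1 * t) (0 + 1 * t) f 0) has_real_derivative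
     1 * conv (k + 2) (0 + 1 * t) (0 + 1 * t) f 0 - 1 * conv (k + 3) (0 + 1 * t) (0 + 1 * t) f 0) (at t)"
    by (rule conv_deriv_t[OF f]) (use t in simp)
  moreover have "conv_coeff f k 0 = (\<lambda>t. conv k t t f 0)" by auto
  ultimately show ?case by simp
next
  case (Suc n)
  have "conv_coeff f k (Suc n) = (\<lambda>t. conv_coeff f (k + 2) n t - conv_coeff f (k + 3) n t)" by auto
  then show ?case using DERIV_diff[OF Suc[of "k + 2"] Suc[of "k + 3"]] by simp
qed

text \<open>Each of the three new factors is at most 7(n+1); 343 is 7^3 and 24 is 4!.\<close>

lemma fact_triple_le: "fact (3 * n + 4) \<le> (24 * 343 ^ n * (fact n) ^ 3 :: real)"
proof (induction n)
  case (Suc n)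
  have "3 * Suc n + 4 = Suc (Suc (Suc (3 * n + 4)))" by simp
  then have "fact (3 * Suc n + 4) = real (3 * n + 7) * (real (3 * n + 6) * (real (3 * n + 5) * fact (3 * n + 4)))"
    by (simp only: fact_Suc) (simp add: algebra_simps)
  also have "\<dots> \<le> (7 * real (Suc n)) * ((7 * real (Suc n)) * ((7 * real (Suc n)) * (24 * 343 ^ n * (fact n) ^ 3)))"
    by (intro mult_mono Suc) auto
  also have "\<dots> = 24 * 343 ^ Suc n * (fact (Suc n)) ^ 3"
  proof -
    have "(7 * a) * ((7 * a) * ((7 * a) * (24 * p * q ^ 3))) = 24 * (343 * p) * (a * q) ^ 3" for a p q :: real
      by (simp add: power_mult_distrib power3_eq_cube)
    then show ?thesis by (simp only: fact_Suc power_Suc)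
  qed
  finally show ?case .
qed (simp add: fact_numeral)

text \<open>Each time derivative costs at most three space derivatives and a factor 2. For k \<le> 2
  the kernel bound involves sqrt((3n+4)!), of size (n!)^(3/2) up to geometric factors, which is
  relaxed to (n!)^2.\<close>

lemma gevrey_conv_coeff:
  assumes f: "f \<in> L2" and t0: "0 < t0" and k: "k < 3"
  shows "gevrey_on {t0<..<t1} (conv_coeff f k)"
proof -
  let ?R = "max t0 t1"
  have R: "0 \<le> ?R" using t0 by simp
  obtain C Q where C: "0 \<le> C" and Q: "1 \<le> Q" and kb: "\<And>k. kernel_bound k t0 ?R \<le> C * Q ^ k * sqrt (fact (k + 2))"
    by (rule kernel_bound_growth[OF t0 R]) auto
  define K where "K = L2_norm f * C * L2_norm weight"
  have K: "0 \<le> K" using C by (simp add: K_def)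
  define b where "b k = K * (Q ^ k * sqrt (fact (k + 2)))" for k
  have mono: "b i \<le> b j" if "i \<le> j" for i j
    unfolding b_def using that Q K
    by (intro mult_left_mono mult_mono power_increasing real_sqrt_le_mono fact_mono) auto
  have bd: "\<bar>conv_coeff f k n t\<bar> \<le> 2 ^ n * b (k + 3 * n)" if t: "t0 \<le> t" "t \<le> t1" for k n t
  proof (induction n arbitrary: k)
    case 0
    have "\<bar>conv k t t f 0\<bar> \<le> L2_norm f * (kernel_bound k t0 ?R * L2_norm weight)"
      by (rule conv_bound[OF f t0]) (use t t0 in auto)
    also have "\<dots> \<le> L2_norm f * ((C * (Q ^ k * sqrt (fact (k + 2)))) * L2_norm weight)"
      using kb[of k] by (intro mult_left_mono mult_right_mono) (auto simp: mult.assoc)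
    finally show ?case by (simp add: b_def K_def mult_ac)
  next
    case (Suc n)
    have "\<bar>conv_coeff f k (Suc n) t\<bar> \<le> \<bar>conv_coeff f (k + 2) n t\<bar> + \<bar>conv_coeff f (k + 3) n t\<bar>"
      by (simp add: abs_triangle_ineq4)
    also have "\<dots> \<le> 2 ^ n * b (k + 2 + 3 * n) + 2 ^ n * b (k + 3 + 3 * n)"
      by (intro add_mono Suc)
    also have "\<dots> \<le> 2 ^ n * b (k + 3 * Suc n) + 2 ^ n * b (k + 3 * Suc n)"
      by (rule add_mono; rule mult_left_mono[OF mono]) auto
    finally show ?case by simp
  qed
  show ?thesis
  proof (rule gevrey_onI)
    show "(conv_coeff f k n has_real_derivative conv_coeff f k (Suc n) t) (at t)" if "t \<in> {t0<..<t1}" for n t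
      using that t0 by (intro conv_coeff_deriv f) auto
    show "\<bar>conv_coeff f k n t\<bar> \<le> (5 * K * Q\<^sup>2) * (38 * Q ^ 3) ^ n * (fact n)\<^sup>2" if t: "t \<in> {t0<..<t1}" for n t
    proof -
      have "sqrt (fact (3 * n + 4)) \<le> sqrt ((5 * 19 ^ n * (fact n)\<^sup>2)\<^sup>2)"
      proof (rule real_sqrt_le_mono)
        have a: "(1::real) \<le> fact n" by (rule fact_ge_1)
        have "fact (3 * n + 4) \<le> (24 * 343 ^ n * (fact n) ^ 3 :: real)" by (rule fact_triple_le)
        \<comment> \<open>The constants and the exponent are rounded up to perfect squares, 361
          being 19^2, so that the root is exact.\<close>
        also have "\<dots> \<le> 25 * 361 ^ n * (fact n) ^ 4"
        proof (rule mult_mono)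
          show "24 * 343 ^ n \<le> (25 * 361 ^ n :: real)" by (intro mult_mono power_mono) auto
          show "(fact n) ^ 3 \<le> ((fact n) ^ 4 :: real)" by (rule power_increasing[OF _ a]) simp
        qed auto
        also have "\<dots> = (5 * 19 ^ n * (fact n)\<^sup>2)\<^sup>2"
        proof -
          have "(19::real) ^ n * 19 ^ n = 361 ^ n" by (simp add: power_mult_distrib[symmetric])
          moreover have "(5 * a * F\<^sup>2)\<^sup>2 = 25 * (a * a) * F ^ 4" for a F :: real
            by (simp add: power2_eq_square power4_eq_xxxx)
          ultimately show ?thesis by simp
        qed
        finally show "fact (3 * n + 4) \<le> ((5 * 19 ^ n * (fact n)\<^sup>2)\<^sup>2 :: real)" .
      qed
      then have s: "sqrt (fact (3 * n + 4)) \<le> 5 * 19 ^ n * (fact n)\<^sup>2" by simp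
      have "\<bar>conv_coeff f k n t\<bar> \<le> 2 ^ n * b (k + 3 * n)" by (rule bd) (use t in auto)
      also have "\<dots> \<le> 2 ^ n * b (2 + 3 * n)" using k by (intro mult_left_mono mono) auto
      also have "\<dots> = 2 ^ n * (K * (Q ^ (2 + 3 * n) * sqrt (fact (3 * n + 4))))"
      proof -
        have "2 + 3 * n + 2 = 3 * n + 4" by simp
        then show ?thesis by (simp only: b_def)
      qed
      also have "\<dots> \<le> 2 ^ n * (K * (Q ^ (2 + 3 * n) * (5 * 19 ^ n * (fact n)\<^sup>2)))"
        using K Q s by (intro mult_left_mono) auto
      also have "\<dots> = (5 * K * Q\<^sup>2) * (2 ^ n * 19 ^ n * Q ^ (3 * n)) * (fact n)\<^sup>2"
        by (simp only: power_add mult_ac)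
      also have "2 ^ n * 19 ^ n * Q ^ (3 * n) = (38 * Q ^ 3) ^ n"
      proof -
        have "(2::real) ^ n * 19 ^ n = 38 ^ n" by (simp flip: power_mult_distrib)
        then show ?thesis by (simp only: power_mult_distrib power_mult)
      qed
      finally show ?thesis .
    qed
  qed (use K Q in auto)
qed

text \<open>Maclaurin's formula with Lagrange remainder. The derivative bound is uniform in space,
  and with \<rho> = 1/(2(|x|+1)) the remainder is at most C / 2^n.\<close>

lemma conv_power_series:
  assumes f: "f \<in> L2" and t: "0 < t"
  shows "(\<lambda>k. conv_coeff f k 0 t / fact k * x ^ k) sums conv 0 t t f x"
proof -
  obtain C where C: "\<And>k u y. t \<le> u \<Longrightarrow> u \<le> t \<Longrightarrow> \<bar>conv k u u f y\<bar> \<le> C * fact k * (1 / (2 * (\<bar>x\<bar> + 1))) ^ k"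
    by (rule conv_entire_bound[OF f t, of "1 / (2 * (\<bar>x\<bar> + 1))" t]) auto
  have rem: "\<bar>conv 0 t t f x - (\<Sum>k<n. conv_coeff f k 0 t / fact k * x ^ k)\<bar> \<le> C * (1 / 2) ^ n" for n
  proof -
    obtain y where y: "conv 0 t t f x = (\<Sum>m<n. (conv m t t f 0 / fact m) * x ^ m) + (conv n t t f y / fact n) * x ^ n"
      using Maclaurin_all_le[of "\<lambda>m. conv m t t f" "conv 0 t t f" x n] conv_deriv_x[OF f t] by blast
    have "\<bar>conv 0 t t f x - (\<Sum>k<n. conv_coeff f k 0 t / fact k * x ^ k)\<bar> = \<bar>conv n t t f y\<bar> * (\<bar>x\<bar> ^ n / fact n)"
      unfolding y by (simp add: abs_mult power_abs)
    also have "\<dots> \<le> (C * fact n * (1 / (2 * (\<bar>x\<bar> + 1))) ^ n) * ((\<bar>x\<bar> + 1) ^ n / fact n)"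
      using C[OF order_refl order_refl, of n y]
      by (intro mult_mono divide_right_mono power_mono) (auto intro: order_trans[OF abs_ge_zero])
    also have "\<dots> = C * ((1 / (2 * (\<bar>x\<bar> + 1))) * (\<bar>x\<bar> + 1)) ^ n"
      by (simp only: power_mult_distrib) simp
    also have "(1 / (2 * (\<bar>x\<bar> + 1))) * (\<bar>x\<bar> + 1) = 1 / 2"
    proof -
      have "\<bar>x\<bar> + 1 \<noteq> 0" using abs_ge_zero[of x] by linarith
      then show ?thesis by simp
    qed
    finally show ?thesis .
  qed
  have "(\<lambda>n. C * (1 / 2) ^ n) \<longlonglongrightarrow> 0" by real_asymp
  then have "(\<lambda>n. conv 0 t t f x - (\<Sum>k<n. conv_coeff f k 0 t / fact k * x ^ k)) \<longlonglongrightarrow> 0"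
    by (rule Lim_null_comparison[rotated]) (use rem in simp)
  then have "(\<lambda>n. conv 0 t t f x - (conv 0 t t f x - (\<Sum>k<n. conv_coeff f k 0 t / fact k * x ^ k))) \<longlonglongrightarrow> conv 0 t t f x - 0"
    by (intro tendsto_diff tendsto_const)
  then show ?thesis by (simp add: sums_def)
qed

text \<open>Solving \<open>u\<^sub>x\<^sub>x\<^sub>x = u\<^sub>x\<^sub>x - u\<^sub>t\<close> from Cauchy data on the line \<open>x = 0\<close>: \<open>G k n\<close> for \<open>k < 3\<close> is
  the \<open>n\<close>-th time derivative of the \<open>k\<close>-th Cauchy datum.\<close>

function taylor_coeff :: "(nat \<Rightarrow> nat \<Rightarrow> real \<Rightarrow> real) \<Rightarrow> nat \<Rightarrow> nat \<Rightarrow> real \<Rightarrow> real" where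
  "taylor_coeff G k n t = (if k < 3 then G k n t else taylor_coeff G (k - 1) n t - taylor_coeff G (k - 3) (Suc n) t)"
  by pat_completeness auto
termination by (relation "Wellfounded.measure (\<lambda>(G, k, n, t). k)") auto

declare taylor_coeff.simps [simp del]

lemma taylor_coeff_less: "k < 3 \<Longrightarrow> taylor_coeff G k n t = G k n t"
  by (simp add: taylor_coeff.simps)

lemma taylor_coeff_add: "taylor_coeff G (k + 3) n t = taylor_coeff G (k + 2) n t - taylor_coeff G k (Suc n) t"
  by (subst taylor_coeff.simps) simp

text \<open>Applied where the cutoff is constant: mixed derivatives of a genuine solution obey the
  same recursion and have the same Cauchy data, so the series reproduces that solution.\<close>

lemma taylor_coeff_unique:
  assumes eq: "\<And>k n. k < 3 \<Longrightarrow> G k n t = c k n" and rec: "\<And>k n. c (k + 3) n = c (k + 2) n - c k (Suc n)"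
  shows "taylor_coeff G k n t = c k n"
proof (induction k arbitrary: n rule: less_induct)
  case (less k)
  show ?case
  proof (cases "k < 3")
    case False
    then obtain j where j: "k = j + 3" by (metis add.commute le_Suc_ex not_less)
    show ?thesis unfolding j taylor_coeff_add rec using less[of "j + 2" n] less[of j "Suc n"] j by simp
  qed (simp add: taylor_coeff_less eq)
qed

lemma taylor_coeff_deriv:
  assumes "\<And>k n. k < 3 \<Longrightarrow> (G k n has_real_derivative G k (Suc n) t) (at t)"
  shows "(taylor_coeff G k n has_real_derivative taylor_coeff G k (Suc n) t) (at t)"
proof (induction k arbitrary: n rule: less_induct)
  case (less k)
  show ?case
  proof (cases "k < 3")
    case True
    then have "taylor_coeff G k n = G k n" "taylor_coeff G k (Suc n) t = G k (Suc n) t" by (auto simp: taylor_coeff_less)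
    then show ?thesis using assms[OF True] by simp
  next
    case False
    then obtain j where j: "k = j + 3" by (metis add.commute le_Suc_ex not_less)
    have "taylor_coeff G (j + 3) n = (\<lambda>t. taylor_coeff G (j + 2) n t - taylor_coeff G j (Suc n) t)" by (auto simp: taylor_coeff_add)
    moreover have "((\<lambda>t. taylor_coeff G (j + 2) n t - taylor_coeff G j (Suc n) t) has_real_derivative taylor_coeff G (j + 2) (Suc n) t - taylor_coeff G j (Suc (Suc n)) t) (at t)"
      by (intro DERIV_diff less) (auto simp: j)
    ultimately show ?thesis unfolding j taylor_coeff_add by simp
  qed
qed

text \<open>Lowering k by three raises n by one, so n + k div 3 never increases. The two branches
  recombine because (1+M)^(j+2) + (1+M)^j M \<le> (1+M)^(j+3).\<close>

lemma taylor_coeff_bound: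
  assumes G: "\<And>k n t. k < 3 \<Longrightarrow> t \<in> I \<Longrightarrow> \<bar>G k n t\<bar> \<le> C * M ^ n * (fact n)\<^sup>2" and C: "0 \<le> C" and M: "0 \<le> M" and t: "t \<in> I"
  shows "\<bar>taylor_coeff G k n t\<bar> \<le> C * (1 + M) ^ k * M ^ n * (fact (n + k div 3))\<^sup>2"
proof (induction k arbitrary: n rule: less_induct)
  case (less k)
  show ?case
  proof (cases "k < 3")
    case True
    have "\<bar>taylor_coeff G k n t\<bar> \<le> C * 1 * M ^ n * (fact n)\<^sup>2" using G[OF True t, of n] True by (simp add: taylor_coeff_less)
    also have "\<dots> \<le> C * (1 + M) ^ k * M ^ n * (fact n)\<^sup>2"
      using C M by (intro mult_right_mono mult_left_mono one_le_power) auto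
    finally show ?thesis using True by simp
  next
    case False
    then obtain j where j: "k = j + 3" by (metis add.commute le_Suc_ex not_less)
    let ?F = "(fact (n + k div 3))\<^sup>2 :: real"
    have k3: "k div 3 = Suc (j div 3)" by (simp add: j)
    have d2: "(j + 2) div 3 \<le> k div 3" unfolding j by (intro div_le_mono) simp
    have f2: "(fact (n + (j + 2) div 3))\<^sup>2 \<le> ?F"
      using d2 by (intro power_mono fact_mono) auto
    have f0: "(fact (Suc n + j div 3))\<^sup>2 = ?F" by (simp add: k3)
    have "\<bar>taylor_coeff G k n t\<bar> \<le> \<bar>taylor_coeff G (j + 2) n t\<bar> + \<bar>taylor_coeff G j (Suc n) t\<bar>"
      unfolding j taylor_coeff_add by (rule abs_triangle_ineq4)
    also have "\<dots> \<le> C * (1 + M) ^ (j + 2) * M ^ n * (fact (n + (j + 2) div 3))\<^sup>2 + C * (1 + M) ^ j * M ^ Suc n * (fact (Suc n + j div 3))\<^sup>2"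
      by (intro add_mono less) (auto simp: j)
    also have "\<dots> \<le> C * (1 + M) ^ (j + 2) * M ^ n * ?F + C * (1 + M) ^ j * M ^ Suc n * ?F"
      unfolding f0 using C M f2 by (intro add_mono mult_left_mono order_refl) auto
    also have "\<dots> = C * ((1 + M) ^ (j + 2) + (1 + M) ^ j * M) * M ^ n * ?F" by (simp add: algebra_simps)
    also have "\<dots> \<le> C * (1 + M) ^ k * M ^ n * ?F"
    proof (intro mult_right_mono mult_left_mono)
      have "(1 + M) ^ j * M \<le> (1 + M) ^ j * ((1 + M)\<^sup>2 * M)"
        using M one_le_power[of "1 + M" 2] mult_right_mono[of 1 "(1 + M)\<^sup>2" M] by (intro mult_left_mono) auto
      then show "(1 + M) ^ (j + 2) + (1 + M) ^ j * M \<le> (1 + M) ^ k"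
        unfolding j by (simp add: power_add algebra_simps power2_eq_square power3_eq_cube)
    qed (use C M in auto)
    finally show ?thesis .
  qed
qed

text \<open>The quotient is a multinomial coefficient, hence a positive integer.\<close>

lemma fact_cube_le: "(fact m) ^ 3 \<le> (fact (3 * m) :: real)"
proof -
  have "fact m * fact m dvd (fact (m + m) :: nat)" by (rule fact_fact_dvd_fact)
  then have "fact m * fact m * fact m dvd (fact (m + m) * fact m :: nat)" by (rule mult_dvd_mono) simp
  also have "fact (m + m) * fact m dvd (fact (m + m + m) :: nat)" by (rule fact_fact_dvd_fact)
  finally have "fact m * fact m * fact m \<le> (fact (m + m + m) :: nat)" by (rule dvd_imp_le) simp
  then have "real (fact m * fact m * fact m) \<le> real (fact (m + m + m))" by (simp only: of_nat_le_iff)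
  then have "fact m * fact m * fact m \<le> (fact (m + m + m) :: real)" by simp
  moreover have "m + m + m = 3 * m" by simp
  ultimately show ?thesis by (simp only: power3_eq_cube)
qed

text \<open>With m = k div 3 the coefficients grow like (1+M)^k (m!)^2, while (m!)^3 \<le> k!. The
  spare m! absorbs (1+M)^k / \<rho>^k for every \<rho>; this is where Gevrey order below three is
  used.\<close>

lemma entire_coeffs_taylor_coeff:
  assumes G: "\<And>k. k < 3 \<Longrightarrow> gevrey_on I (G k)"
  shows "entire_coeffs I (\<lambda>k. taylor_coeff G k 0)"
  unfolding entire_coeffs_def
proof (intro allI impI)
  fix \<rho> :: real assume \<rho>: "0 < \<rho>"
  have "\<exists>C M. 0 \<le> C \<and> 0 \<le> M \<and> (\<forall>k<3. \<forall>n. \<forall>t\<in>I. \<bar>G k n t\<bar> \<le> C * M ^ n * (fact n)\<^sup>2)"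
  proof -
    have "\<exists>C M. 0 \<le> C \<and> 0 \<le> M \<and> (\<forall>n. \<forall>t\<in>I. \<bar>G k n t\<bar> \<le> C * M ^ n * (fact n)\<^sup>2)" if "k < 3" for k
      using G[OF that] unfolding gevrey_on_def by blast
    then obtain C M where CM: "\<And>k. k < 3 \<Longrightarrow> 0 \<le> C k" "\<And>k. k < 3 \<Longrightarrow> 0 \<le> M k"
      "\<And>k n t. k < 3 \<Longrightarrow> t \<in> I \<Longrightarrow> \<bar>G k n t\<bar> \<le> C k * M k ^ n * (fact n)\<^sup>2"
      by metis
    have s: "C k \<le> (\<Sum>i<3. C i)" "M k \<le> (\<Sum>i<3. M i)" if "k < 3" for k
      using that CM by (auto intro!: member_le_sum)
    have "\<bar>G k n t\<bar> \<le> (\<Sum>i<3. C i) * (\<Sum>i<3. M i) ^ n * (fact n)\<^sup>2" if "k < 3" "t \<in> I" for k n t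
    proof (rule order_trans[OF CM(3)[OF that]], rule mult_right_mono)
      show "C k * M k ^ n \<le> (\<Sum>i<3. C i) * (\<Sum>i<3. M i) ^ n"
        using CM(1,2)[OF that(1)] s[OF that(1)] by (intro mult_mono power_mono) auto
    qed simp
    moreover have "0 \<le> (\<Sum>i<3. C i)" "0 \<le> (\<Sum>i<3. M i)" using CM by (auto intro!: sum_nonneg)
    ultimately show ?thesis by blast
  qed
  then obtain C M where C: "0 \<le> C" and M: "0 \<le> M" and bd: "\<And>k n t. k < 3 \<Longrightarrow> t \<in> I \<Longrightarrow> \<bar>G k n t\<bar> \<le> C * M ^ n * (fact n)\<^sup>2"
    by blast
  \<comment> \<open>The maximum with 1 allows the exponent k to be raised to 3 (k div 3) +
    2.\<close>
  define D where "D = max 1 ((1 + M) / \<rho>)"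
  have D: "1 \<le> D" "(1 + M) / \<rho> \<le> D" by (auto simp: D_def)
  have "\<bar>taylor_coeff G k 0 t\<bar> \<le> (C * D\<^sup>2 * exp (D ^ 3)) * fact k * \<rho> ^ k" if t: "t \<in> I" for k t
  proof -
    let ?m = "k div 3"
    have A: "(1 + M) ^ k \<le> D\<^sup>2 * exp (D ^ 3) * fact ?m * \<rho> ^ k"
    proof -
      have "(1 + M) ^ k = ((1 + M) / \<rho>) ^ k * \<rho> ^ k" using \<rho> by (simp add: power_divide)
      also have "\<dots> \<le> D ^ k * \<rho> ^ k" using D M \<rho> by (intro mult_right_mono power_mono) auto
      also have "\<dots> \<le> D ^ (3 * ?m + 2) * \<rho> ^ k"
        using D \<rho> by (intro mult_right_mono power_increasing) auto
      also have "D ^ (3 * ?m + 2) = D\<^sup>2 * (D ^ 3) ^ ?m"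
        by (simp add: power_add power_mult power2_eq_square)
      also have "D\<^sup>2 * (D ^ 3) ^ ?m * \<rho> ^ k \<le> D\<^sup>2 * (exp (D ^ 3) * fact ?m) * \<rho> ^ k"
      proof (intro mult_right_mono mult_left_mono)
        show "(D ^ 3) ^ ?m \<le> exp (D ^ 3) * fact ?m"
          using power_div_fact_le_exp[of "D ^ 3" ?m] D by (simp add: pos_divide_le_eq)
      qed (use \<rho> in auto)
      finally show ?thesis by (simp only: mult.assoc)
    qed
    have fm: "fact ?m * (fact ?m)\<^sup>2 \<le> (fact k :: real)"
    proof -
      have "fact ?m * (fact ?m)\<^sup>2 = ((fact ?m) ^ 3 :: real)" by (simp add: power3_eq_cube power2_eq_square)
      also have "\<dots> \<le> fact (3 * ?m)" by (rule fact_cube_le)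
      also have "\<dots> \<le> fact k" by (rule fact_mono) simp
      finally show ?thesis .
    qed
    have "\<bar>taylor_coeff G k 0 t\<bar> \<le> C * (1 + M) ^ k * M ^ 0 * (fact (0 + ?m))\<^sup>2"
      by (rule taylor_coeff_bound[OF bd C M t])
    also have "\<dots> = (1 + M) ^ k * (C * (fact ?m)\<^sup>2)" by simp
    also have "\<dots> \<le> (D\<^sup>2 * exp (D ^ 3) * fact ?m * \<rho> ^ k) * (C * (fact ?m)\<^sup>2)"
      using C by (intro mult_right_mono A) auto
    also have "\<dots> = (C * D\<^sup>2 * exp (D ^ 3) * \<rho> ^ k) * (fact ?m * (fact ?m)\<^sup>2)" by (simp add: mult_ac)
    also have "\<dots> \<le> (C * D\<^sup>2 * exp (D ^ 3) * \<rho> ^ k) * fact k"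
      using C D \<rho> by (intro mult_left_mono fm) auto
    finally show ?thesis by (simp add: mult_ac)
  qed
  then show "\<exists>C. \<forall>k. \<forall>t\<in>I. \<bar>taylor_coeff G k 0 t\<bar> \<le> C * fact k * \<rho> ^ k" by blast
qed

text \<open>Shifting by j costs (k+j)! \<le> 2^(k+j) k! j!. With \<rho> = 1/(4(r+1)) the majorant is
  geometric of ratio 2 \<rho> (r+1) = 1/2.\<close>

lemma entire_coeffs_majorant:
  assumes h: "entire_coeffs I h" and r: "0 \<le> r"
  obtains M where "summable M" "\<And>k t x. t \<in> I \<Longrightarrow> \<bar>x\<bar> \<le> r \<Longrightarrow> \<bar>h (k + j) t / fact k * x ^ k\<bar> \<le> M k"
proof -
  define \<rho> where "\<rho> = 1 / (4 * (r + 1))"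
  have \<rho>: "0 < \<rho>" using r by (simp add: \<rho>_def)
  obtain C where C: "\<And>k t. t \<in> I \<Longrightarrow> \<bar>h k t\<bar> \<le> C * fact k * \<rho> ^ k"
    using h \<rho> unfolding entire_coeffs_def by blast
  define K where "K = \<bar>C\<bar> * fact j * (2 * \<rho>) ^ j"
  have "\<bar>h (k + j) t / fact k * x ^ k\<bar> \<le> K * (1 / 2) ^ k" if t: "t \<in> I" and x: "\<bar>x\<bar> \<le> r" for k t x
  proof -
    have "fact k * fact j * (k + j choose k) = (fact (k + j) :: nat)"
      using binomial_fact_lemma[of k "k + j"] by simp
    then have "fact (k + j) \<le> (fact k * fact j * 2 ^ (k + j) :: nat)"
      using binomial_le_pow2[of "k + j" k] by (metis mult_le_mono2)
    then have "real (fact (k + j)) \<le> real (fact k * fact j * 2 ^ (k + j))" by (simp only: of_nat_le_iff)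
    then have f: "fact (k + j) \<le> (fact k * fact j * 2 ^ (k + j) :: real)" by simp
    have "\<bar>h (k + j) t / fact k * x ^ k\<bar> = \<bar>h (k + j) t\<bar> / fact k * \<bar>x\<bar> ^ k"
      by (simp add: abs_mult power_abs)
    also have "\<dots> \<le> (\<bar>C\<bar> * (fact k * fact j * 2 ^ (k + j)) * \<rho> ^ (k + j)) / fact k * (r + 1) ^ k"
    proof (intro mult_mono divide_right_mono power_mono)
      have "\<bar>h (k + j) t\<bar> \<le> C * fact (k + j) * \<rho> ^ (k + j)" by (rule C[OF t])
      also have "\<dots> \<le> \<bar>C\<bar> * (fact k * fact j * 2 ^ (k + j)) * \<rho> ^ (k + j)"
        using \<rho> f by (intro mult_right_mono mult_mono) auto
      finally show "\<bar>h (k + j) t\<bar> \<le> \<bar>C\<bar> * (fact k * fact j * 2 ^ (k + j)) * \<rho> ^ (k + j)" .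
    qed (use x \<rho> in auto)
    also have "\<dots> = K * (2 * \<rho> * (r + 1)) ^ k"
    proof -
      have "(c * (a * b * (u * v)) * (p * q)) / a * w = c * b * (v * q) * (u * p * w)" if "a \<noteq> 0" for a b c p q u v w :: real
        using that by simp
      from this[of "fact k"] show ?thesis
        by (simp only: K_def power_add power_mult_distrib fact_nonzero not_False_eq_True)
    qed
    also have "2 * \<rho> * (r + 1) = 1 / 2" using r by (simp add: \<rho>_def)
    finally show ?thesis .
  qed
  moreover have "summable (\<lambda>k. K * (1 / 2) ^ k)" by (intro summable_mult summable_geometric) simp
  ultimately show ?thesis by (rule that[rotated])
qed

section \<open>Termwise differentiation and continuity of the power series in x\<close>

definition series :: "(nat \<Rightarrow> real \<Rightarrow> real) \<Rightarrow> nat \<Rightarrow> real \<times> real \<Rightarrow> real" where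
  "series h j z = (\<Sum>k. h (k + j) (snd z) / fact k * fst z ^ k)"

lemma series_summable:
  assumes h: "entire_coeffs I h" and t: "t \<in> I"
  shows "summable (\<lambda>k. h (k + j) t / fact k * x ^ k)"
proof -
  obtain M where M: "summable M" "\<And>k t y. t \<in> I \<Longrightarrow> \<bar>y\<bar> \<le> \<bar>x\<bar> \<Longrightarrow> \<bar>h (k + j) t / fact k * y ^ k\<bar> \<le> M k"
    by (rule entire_coeffs_majorant[OF h abs_ge_zero[of x]]) auto
  show ?thesis by (rule summable_comparison_test[OF _ M(1)]) (use M(2)[OF t order_refl] in auto)
qed

lemma series_deriv_x:
  assumes h: "entire_coeffs I h" and t: "t \<in> I"
  shows "((\<lambda>x. series h j (x, t)) has_real_derivative series h (Suc j) (x, t)) (at x)"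
proof -
  let ?c = "\<lambda>k. h (k + j) t / fact k"
  have "((\<lambda>x. \<Sum>k. ?c k * x ^ k) has_real_derivative (\<Sum>k. diffs ?c k * x ^ k)) (at x)"
    by (rule termdiffs_strong_converges_everywhere) (rule series_summable[OF h t])
  moreover have "diffs ?c = (\<lambda>k. h (k + Suc j) t / fact k)"
  proof
    fix k
    have "a * (b / (a * c)) = b / c" if "a \<noteq> 0" for a b c :: real using that by simp
    from this[of "real (Suc k)"] show "diffs ?c k = h (k + Suc j) t / fact k"
      by (simp add: diffs_def del: of_nat_Suc)
  qed
  ultimately show ?thesis by (simp add: series_def)
qed

text \<open>The differentiated series splits into the series with shifts 2 and 3, whose majorants do
  not depend on t; the Weierstrass test yields the uniform convergence.\<close>

lemma series_deriv_t:
  assumes h: "entire_coeffs {a<..<b} h" and t: "t \<in> {a<..<b}"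
    and deriv: "\<And>k t. t \<in> {a<..<b} \<Longrightarrow> (h k has_real_derivative h (k + 2) t - h (k + 3) t) (at t)"
  shows "((\<lambda>t. series h 0 (x, t)) has_real_derivative series h 2 (x, t) - series h 3 (x, t)) (at t)"
proof -
  let ?I = "{a<..<b}"
  let ?f' = "\<lambda>k t. (h (k + 2) t - h (k + 3) t) / fact k * x ^ k"
  obtain M2 where M2: "summable M2" "\<And>k t y. t \<in> ?I \<Longrightarrow> \<bar>y\<bar> \<le> \<bar>x\<bar> \<Longrightarrow> \<bar>h (k + 2) t / fact k * y ^ k\<bar> \<le> M2 k"
    by (rule entire_coeffs_majorant[where j=2, OF h abs_ge_zero[of x]], rule that) assumption+
  obtain M3 where M3: "summable M3" "\<And>k t y. t \<in> ?I \<Longrightarrow> \<bar>y\<bar> \<le> \<bar>x\<bar> \<Longrightarrow> \<bar>h (k + 3) t / fact k * y ^ k\<bar> \<le> M3 k"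
    by (rule entire_coeffs_majorant[where j=3, OF h abs_ge_zero[of x]], rule that) assumption+
  have split: "?f' k t = h (k + 2) t / fact k * x ^ k - h (k + 3) t / fact k * x ^ k" for k t
    by (simp add: diff_divide_distrib left_diff_distrib)
  have "((\<lambda>t. \<Sum>k. h k t / fact k * x ^ k) has_real_derivative (\<Sum>k. ?f' k t)) (at t)"
  proof (rule has_field_derivative_series'(2)[where S="?I" and ?x0.0=t])
    show "((\<lambda>t. h k t / fact k * x ^ k) has_real_derivative ?f' k s) (at s within ?I)" if "s \<in> ?I" for k s
      by (rule has_field_derivative_at_within) (intro DERIV_cmult_right DERIV_cdivide deriv that)
    have "uniform_limit ?I (\<lambda>n t. \<Sum>k<n. ?f' k t) (\<lambda>t. suminf (\<lambda>k. ?f' k t)) sequentially"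
    proof (rule Weierstrass_m_test[where M="\<lambda>k. M2 k + M3 k"])
      show "norm (?f' k s) \<le> M2 k + M3 k" if "s \<in> ?I" for k s
        unfolding split real_norm_def
        by (rule order_trans[OF abs_triangle_ineq4 add_mono[OF M2(2)[OF that order_refl] M3(2)[OF that order_refl]]])
      show "summable (\<lambda>k. M2 k + M3 k)" by (rule summable_add[OF M2(1) M3(1)])
    qed
    then show "uniformly_convergent_on ?I (\<lambda>n t. \<Sum>k<n. ?f' k t)"
      by (rule uniformly_convergentI)
    show "summable (\<lambda>k. h k t / fact k * x ^ k)" using series_summable[OF h t, of 0] by simp
  qed (use t in \<open>auto simp: interior_open\<close>)
  moreover have "(\<Sum>k. ?f' k t) = series h 2 (x, t) - series h 3 (x, t)"
    unfolding split series_def fst_conv snd_conv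
    by (rule suminf_diff[symmetric]; rule series_summable[OF h t])
  ultimately show ?thesis by (simp add: series_def)
qed

text \<open>Convergence is uniform only for bounded x; the open strips |x| < r exhaust the
  domain.\<close>

lemma series_continuous:
  assumes h: "entire_coeffs I h" and I: "open I" and c: "\<And>k. continuous_on I (h k)"
  shows "continuous_on (UNIV \<times> I) (series h j)"
proof -
  have "continuous_on ({- r<..<r} \<times> I) (series h j)" if r: "0 \<le> r" for r
  proof -
    obtain M where M: "summable M" "\<And>k t x. t \<in> I \<Longrightarrow> \<bar>x\<bar> \<le> r \<Longrightarrow> \<bar>h (k + j) t / fact k * x ^ k\<bar> \<le> M k"
      by (rule entire_coeffs_majorant[OF h r]) auto
    let ?f = "\<lambda>k z. h (k + j) (snd z) / fact k * fst z ^ k"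
    have "uniform_limit ({- r<..<r} \<times> I) (\<lambda>n z. \<Sum>k<n. ?f k z) (\<lambda>z. suminf (\<lambda>k. ?f k z)) sequentially"
    proof (rule Weierstrass_m_test[where M=M])
      show "norm (?f k z) \<le> M k" if "z \<in> {- r<..<r} \<times> I" for k and z :: "real \<times> real"
        unfolding real_norm_def by (rule M(2)) (use that in \<open>auto simp: abs_le_iff\<close>)
    qed (rule M(1))
    moreover have "continuous_on ({- r<..<r} \<times> I) (\<lambda>z. h (k + j) (snd z))" for k
      by (rule continuous_on_compose2[OF c]) (auto intro!: continuous_intros)
    then have "continuous_on ({- r<..<r} \<times> I) (\<lambda>z. \<Sum>k<n. ?f k z)" for n
      by (intro continuous_intros) auto
    then have "\<forall>\<^sub>F n in sequentially. continuous_on ({- r<..<r} \<times> I) (\<lambda>z. \<Sum>k<n. ?f k z)" by simp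
    ultimately show ?thesis unfolding series_def[abs_def]
      by (intro uniform_limit_theorem[where F=sequentially]) auto
  qed
  then have "continuous_on (\<Union>r\<in>{0..}. {- r<..<r} \<times> I) (series h j)"
    using I by (intro continuous_on_open_UN open_Times) auto
  moreover have "(\<Union>r\<in>{0..}. {- r<..<r} \<times> I) = (UNIV \<times> I :: (real \<times> real) set)"
  proof (rule antisym)
    show "(UNIV \<times> I :: (real \<times> real) set) \<subseteq> (\<Union>r\<in>{0..}. {- r<..<r} \<times> I)"
    proof
      fix z :: "real \<times> real" assume "z \<in> UNIV \<times> I"
      then have "z \<in> {- (\<bar>fst z\<bar> + 1)<..<\<bar>fst z\<bar> + 1} \<times> I" by (cases z) auto
      moreover have "\<bar>fst z\<bar> + 1 \<in> {0..}" by simp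
      ultimately show "z \<in> (\<Union>r\<in>{0..}. {- r<..<r} \<times> I)" by blast
    qed
  qed auto
  ultimately show ?thesis by simp
qed

section \<open>Local square integrability and construction of the solution\<close>

lemma L2_continuous_on_subset:
  "L2_continuous_on I v \<Longrightarrow> J \<subseteq> I \<Longrightarrow> L2_continuous_on J v"
  unfolding L2_continuous_on_def by (meson subsetD tendsto_within_subset)

text \<open>For t \<ge> e continuity on compact sets suffices. Close to t = 0 the function may be
  unbounded, and Tonelli with the bound on time slices takes over.\<close>

lemma L2_loc_of_strip_bound:
  fixes u :: "real \<times> real \<Rightarrow> real"
  assumes u [measurable]: "u \<in> borel_measurable borel"
    and supp: "\<And>x t. t \<le> 0 \<or> T < t \<Longrightarrow> u (x, t) = 0"
    and cont: "continuous_on (UNIV \<times> {e..T}) u"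
    and strip: "\<And>t. 0 < t \<Longrightarrow> t \<le> e \<Longrightarrow> (\<integral>\<^sup>+ x. ennreal ((u (x, t))\<^sup>2) \<partial>lborel) \<le> ennreal B"
  shows "u \<in> L2_loc"
proof -
  have "set_integrable lebesgue K (\<lambda>z. (u z)\<^sup>2)" if K: "compact K" for K
  proof -
    have Kb [measurable]: "K \<in> sets borel" using compact_imp_closed[OF K] by (rule borel_closed)
    obtain R where R: "\<forall>z\<in>K. norm z \<le> R"
      using compact_imp_bounded[OF K] unfolding bounded_iff by blast
    define A where "A z = indicator {0<..e} (snd z) * (u z)\<^sup>2" for z :: "real \<times> real"
    define D where "D z = indicator ({- R..R} \<times> {e..T}) z * (u z)\<^sup>2" for z :: "real \<times> real"
    have [measurable]: "(snd :: real \<times> real \<Rightarrow> real) \<in> borel_measurable borel"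
      by (intro borel_measurable_continuous_onI continuous_intros)
    have [measurable]: "{- R..R} \<times> {e..T} \<in> sets (borel :: (real \<times> real) measure)"
      by (intro borel_closed closed_Times closed_atLeastAtMost)
    have [measurable]: "A \<in> borel_measurable borel"
      unfolding A_def[abs_def] by measurable
    have [measurable]: "D \<in> borel_measurable borel"
      unfolding D_def[abs_def] by measurable
    have iA: "integrable lborel A"
    proof (rule integrableI_nonneg)
      have m: "(\<lambda>z. ennreal (A z)) \<in> borel_measurable (lborel \<Otimes>\<^sub>M lborel)"
        unfolding lborel_prod by measurable
      have "(\<integral>\<^sup>+ z. ennreal (A z) \<partial>lborel) = (\<integral>\<^sup>+ t. (\<integral>\<^sup>+ x. ennreal (A (x, t)) \<partial>lborel) \<partial>lborel)"
        using lborel_pair.nn_integral_snd[OF m] by (simp add: lborel_prod)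
      also have "\<dots> \<le> (\<integral>\<^sup>+ t. ennreal B * indicator {0<..e} t \<partial>lborel)"
      proof (rule nn_integral_mono)
        fix t :: real
        show "(\<integral>\<^sup>+ x. ennreal (A (x, t)) \<partial>lborel) \<le> ennreal B * indicator {0<..e} t"
          using strip[of t] by (cases "t \<in> {0<..e}") (auto simp: A_def)
      qed
      also have "\<dots> = ennreal B * emeasure lborel {0<..e}" by (rule nn_integral_cmult_indicator) simp
      also have "\<dots> < \<infinity>"
      proof -
        have "emeasure lborel {0<..e} < \<infinity>" by (cases "0 \<le> e") simp_all
        then show ?thesis by (simp add: ennreal_mult_less_top)
      qed
      finally show "(\<integral>\<^sup>+ z. ennreal (A z) \<partial>lborel) < \<infinity>" .
    qed (auto simp: A_def)
    have iD: "integrable lborel D"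
    proof -
      have "integrable lborel (\<lambda>z. indicator ({- R..R} \<times> {e..T}) z *\<^sub>R (u z)\<^sup>2)"
        by (rule borel_integrable_compact) (auto intro!: compact_Times continuous_intros continuous_on_subset[OF cont])
      then show ?thesis by (simp add: D_def[abs_def])
    qed
    have "integrable lborel (\<lambda>z. indicator K z *\<^sub>R (u z)\<^sup>2)"
    proof (rule Bochner_Integration.integrable_bound[OF Bochner_Integration.integrable_add[OF iA iD]])
      show "AE z in lborel. norm (indicator K z *\<^sub>R (u z)\<^sup>2) \<le> norm (A z + D z)"
      proof (rule AE_I2)
        fix z :: "real \<times> real"
        have nn: "0 \<le> A z" "0 \<le> D z" by (auto simp: A_def D_def)
        have "indicator K z * (u z)\<^sup>2 \<le> A z + D z"
        proof (cases "z \<in> K \<and> u z \<noteq> 0")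
          case True
          obtain x t where z: "z = (x, t)" by fastforce
          have "norm z \<le> R" using R True by blast
          then have x: "x \<in> {- R..R}" using norm_fst_le[of x t] by (auto simp: z)
          have "\<not> (t \<le> 0 \<or> T < t)" using supp[of t x] True unfolding z by blast
          then have t: "0 < t" "t \<le> T" by simp_all
          have "A z = (u z)\<^sup>2 \<or> D z = (u z)\<^sup>2"
            using x t by (cases "t \<le> e") (auto simp: A_def D_def z)
          then show ?thesis using nn True by auto
        next
          case False
          then show ?thesis using nn by auto
        qed
        then show "norm (indicator K z *\<^sub>R (u z)\<^sup>2) \<le> norm (A z + D z)" using nn by simp
      qed
    qed measurable
    then show ?thesis unfolding set_integrable_def
      by (subst integrable_lebesgue_iff_lborel) measurable
  qed
  moreover have "u \<in> borel_measurable lebesgue" using u by (rule borel_measurable_lebesgue)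
  ultimately show ?thesis by (simp add: L2_loc_def)
qed

theorem theorem1p1:
  fixes S :: "real \<Rightarrow> (real \<Rightarrow> real) \<Rightarrow> real \<Rightarrow> real"
    and T \<epsilon> :: real
    and u0 uT :: "real \<Rightarrow> real"
  assumes "continuous_semigroup_L2 S"
    and "infinitesimal_generator S = operator_A"
    and "T > 0" and "\<epsilon> > 0" and "\<epsilon> < T / 2"
    and "u0 \<in> L2" and "uT \<in> L2"
  shows "\<exists>u :: real \<times> real \<Rightarrow> real. u \<in> L2_loc \<and>
    (\<exists>v w. continuous_representative {0..\<epsilon>} u v \<and>
       continuous_representative {T - \<epsilon>..T} u w \<and>
       solves_equation_in (UNIV \<times> {0<..<T}) u \<and>
       v 0 =\<^sub>a u0 \<and>
       w T =\<^sub>a S T uT)"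
proof -
  interpret kdvb_semigroup S
    by unfold_locales (use assms in auto)
  note u0 = \<open>u0 \<in> L2\<close> and uT = \<open>uT \<in> L2\<close>
  obtain \<theta> where g: "gevrey_on UNIV \<theta>" and \<theta>l: "\<And>t. t \<le> 0 \<Longrightarrow> \<theta> 0 t = 1" and \<theta>r: "\<And>t. 1 \<le> t \<Longrightarrow> \<theta> 0 t = 0"
    and "\<And>t. \<bar>\<theta> 0 t\<bar> \<le> 1" and \<theta>lS: "\<And>n t. t \<le> 0 \<Longrightarrow> \<theta> (Suc n) t = 0" and \<theta>rS: "\<And>n t. 1 \<le> t \<Longrightarrow> \<theta> (Suc n) t = 0"
    by (rule gevrey_step) blast
  \<comment> \<open>The affine map t to q (t - \<epsilon>) sends \<epsilon> to 0 and T - \<epsilon>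
    to 1, the ends of the transition interval of the step.\<close>
  define q where "q = 1 / (T - 2 * \<epsilon>)"
  have q: "0 < q" using assms by (simp add: q_def)
  define \<theta>' where "\<theta>' n t = q ^ n * \<theta> n (- (q * \<epsilon>) + q * t)" for n t
  have g': "gevrey_on UNIV \<theta>'" unfolding \<theta>'_def by (rule gevrey_on_affine[OF g])
  have arg_l: "- (q * \<epsilon>) + q * t \<le> 0" if "t \<le> \<epsilon>" for t using mult_left_mono[OF that, of q] q by simp
  have arg_r: "1 \<le> - (q * \<epsilon>) + q * t" if "T - \<epsilon> \<le> t" for t
  proof -
    have "1 = q * (T - 2 * \<epsilon>)" using assms by (simp add: q_def)
    also have "\<dots> \<le> q * (t - \<epsilon>)" using q that by (intro mult_left_mono) auto
    finally show ?thesis by (simp add: algebra_simps)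
  qed
  \<comment> \<open>The data are those of the \<open>uT\<close> solution plus the cutoff times the
    difference \<open>E\<close>, so they agree with the \<open>u0\<close> data for t \<le>
    \<epsilon> and with the \<open>uT\<close> data for t \<ge> T - \<epsilon>.\<close>
  define E where "E k = (\<lambda>n t. conv_coeff u0 k n t + (- 1) * conv_coeff uT k n t)" for k
  define G where "G k = (\<lambda>n t. conv_coeff uT k n t + 1 * leibniz \<theta>' (E k) n t)" for k
  define h where "h k = taylor_coeff G k 0" for k
  \<comment> \<open>The bounds are taken only from a positive time s on. The interval reaches T + 1
    so that t = T is an interior point.\<close>
  have gG: "gevrey_on {s<..<T + 1} (G k)" if "0 < s" "k < 3" for s k
    unfolding G_def E_def
    by (intro gevrey_on_lincomb gevrey_on_leibniz gevrey_conv_coeff u0 uT that gevrey_on_subset[OF g']) simp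
  have ent: "entire_coeffs {s<..<T + 1} h" if "0 < s" for s
    unfolding h_def[abs_def] by (rule entire_coeffs_taylor_coeff[OF gG[OF that]])
  have der: "(h k has_real_derivative h (k + 2) t - h (k + 3) t) (at t)" if t: "0 < t" "t < T + 1" for k t
  proof -
    have "(taylor_coeff G k 0 has_real_derivative taylor_coeff G k (Suc 0) t) (at t)"
    proof (rule taylor_coeff_deriv)
      fix k n :: nat assume k: "k < 3"
      show "(G k n has_real_derivative G k (Suc n) t) (at t)"
        by (rule gevrey_on_deriv[OF gG[OF _ k, of "t / 2"]]) (use t in auto)
    qed
    moreover have "taylor_coeff G k (Suc 0) t = h (k + 2) t - h (k + 3) t"
      unfolding h_def taylor_coeff_add by simp
    ultimately show ?thesis by (simp add: h_def)
  qed
  \<comment> \<open>For t \<le> \<epsilon> the cutoff is 1 and all its derivatives vanish, so only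
    the term j = 0 of the Leibniz sum survives.\<close>
  have hl: "h k t = conv_coeff u0 k 0 t" if t: "t \<le> \<epsilon>" for k t
    unfolding h_def
  proof (rule taylor_coeff_unique)
    fix k n :: nat
    have z: "\<theta>' j t = (if j = 0 then 1 else 0)" for j
      using \<theta>l[OF arg_l[OF t]] \<theta>lS[OF arg_l[OF t], of "j - 1"] by (cases j) (auto simp: \<theta>'_def)
    have "leibniz \<theta>' (E k) n t = (\<Sum>j\<in>{0}. real (n choose j) * (\<theta>' j t * E k (n - j) t))"
      unfolding leibniz_def by (rule sum.mono_neutral_right) (auto simp: z)
    then show "G k n t = conv_coeff u0 k n t" by (simp add: G_def E_def z)
  qed simp
  have hr: "h k t = conv_coeff uT k 0 t" if t: "T - \<epsilon> \<le> t" for k t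
    unfolding h_def
  proof (rule taylor_coeff_unique)
    fix k n :: nat
    have z: "\<theta>' j t = 0" for j
      using \<theta>r[OF arg_r[OF t]] \<theta>rS[OF arg_r[OF t], of "j - 1"] by (cases j) (auto simp: \<theta>'_def)
    show "G k n t = conv_coeff uT k n t" by (simp add: G_def leibniz_def z)
  qed simp
  \<comment> \<open>The coefficient bounds are not uniform down to t = 0, but each positive time t
    lies in the strip starting at t/2.\<close>
  have contU: "continuous_on (UNIV \<times> {0<..<T + 1}) (series h j)" for j
  proof -
    have "continuous_on (UNIV \<times> {s<..<T + 1}) (series h j)" if s: "0 < s" for s
      by (rule series_continuous[OF ent[OF s]])
         (use s in \<open>auto intro!: continuous_at_imp_continuous_on DERIV_isCont[OF der]\<close>)
    then have "continuous_on (\<Union>s\<in>{0<..}. UNIV \<times> {s<..<T + 1}) (series h j)"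
      by (intro continuous_on_open_UN open_Times) auto
    moreover have "(\<Union>s\<in>{0<..}. UNIV \<times> {s<..<T + 1}) = (UNIV \<times> {0<..<T + 1} :: (real \<times> real) set)"
    proof (rule antisym)
      show "UNIV \<times> {0<..<T + 1} \<subseteq> (\<Union>s\<in>{0<..}. UNIV \<times> {s<..<T + 1} :: (real \<times> real) set)"
      proof
        fix z :: "real \<times> real" assume "z \<in> UNIV \<times> {0<..<T + 1}"
        then have "z \<in> UNIV \<times> {snd z / 2<..<T + 1}" "snd z / 2 \<in> {0<..}" by (cases z; auto)+
        then show "z \<in> (\<Union>s\<in>{0<..}. UNIV \<times> {s<..<T + 1})" by blast
      qed
    qed auto
    ultimately show ?thesis by simp
  qed
  have val: "series h 0 (x, t) = conv 0 t t f x" if "\<And>k. h k t = conv_coeff f k 0 t" "f \<in> L2" "0 < t" for f t x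
    using sums_unique[OF conv_power_series[OF that(2,3), of x]] that(1) by (simp add: series_def)
  have S_series: "(\<lambda>x. series h 0 (x, t)) =\<^sub>a S t f" if "\<And>k. h k t = conv_coeff f k 0 t" "f \<in> L2" "0 < t" for f t
    using semigroup_eq_conv[OF that(2,3)] unfolding val[OF that] eq_ae_def by (rule eventually_mono) simp
  \<comment> \<open>The value 0 outside 0 < t \<le> T makes \<open>u\<close> a function on the
    plane; near t = T the series still equals the \<open>uT\<close> solution.\<close>
  define u where "u z = (if 0 < snd z \<and> snd z \<le> T then series h 0 z else 0)" for z
  have ut: "(\<lambda>x. u (x, t)) = (\<lambda>x. series h 0 (x, t))" if "0 < t" "t \<le> T" for t using that by (simp add: u_def)
  have rep0: "continuous_representative {0..\<epsilon>} u (\<lambda>t. S t u0)"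
    unfolding continuous_representative_def
  proof
    show "L2_continuous_on {0..\<epsilon>} (\<lambda>t. S t u0)" by (rule continuous[OF u0])
    \<comment> \<open>The time t = 0, where \<open>u\<close> was set to 0, is a null set; the
      initial value is carried by the representative S(t)u0.\<close>
    have "AE t in lebesgue. t \<noteq> (0::real)" by (intro AE_completion AE_lborel_singleton)
    then show "AE t in lebesgue. t \<in> {0..\<epsilon>} \<longrightarrow> (\<lambda>x. u (x, t)) =\<^sub>a S t u0"
    proof (rule eventually_mono, intro impI)
      fix t :: real assume "t \<noteq> 0" "t \<in> {0..\<epsilon>}"
      then have t: "0 < t" "t \<le> \<epsilon>" "t \<le> T" using assms by auto
      show "(\<lambda>x. u (x, t)) =\<^sub>a S t u0" unfolding ut[OF t(1,3)] by (rule S_series[OF hl[OF t(2)] u0 t(1)])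
    qed
  qed
  have repT: "continuous_representative {T - \<epsilon>..T} u (\<lambda>t. S t uT)"
    unfolding continuous_representative_def
  proof
    show "L2_continuous_on {T - \<epsilon>..T} (\<lambda>t. S t uT)"
      by (rule L2_continuous_on_subset[OF continuous[OF uT, of T]]) (use assms in auto)
    show "AE t in lebesgue. t \<in> {T - \<epsilon>..T} \<longrightarrow> (\<lambda>x. u (x, t)) =\<^sub>a S t uT"
    proof (rule AE_I2, intro impI)
      fix t :: real assume "t \<in> {T - \<epsilon>..T}"
      then have t: "0 < t" "T - \<epsilon> \<le> t" "t \<le> T" using assms by auto
      show "(\<lambda>x. u (x, t)) =\<^sub>a S t uT" unfolding ut[OF t(1,3)] by (rule S_series[OF hr[OF t(2)] uT t(1)])
    qed
  qed
  have sol: "solves_equation_in (UNIV \<times> {0<..<T}) u"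
  proof (rule classical_solution_solves_equation[where U="series h"])
    show "open (UNIV \<times> {0<..<T} :: (real \<times> real) set)" by (intro open_Times) auto
    show "continuous_on (UNIV \<times> {0<..<T}) (series h k)" for k
      by (rule continuous_on_subset[OF contU]) auto
    show "((\<lambda>x. series h k (x, t)) has_real_derivative series h (Suc k) (x, t)) (at x)" if "(x, t) \<in> UNIV \<times> {0<..<T}" for k x t
      by (rule series_deriv_x[OF ent[of "t / 2"]]) (use that in auto)
    show "((\<lambda>t. series h 0 (x, t)) has_real_derivative series h 2 (x, t) - series h 3 (x, t)) (at t)" if "(x, t) \<in> UNIV \<times> {0<..<T}" for x t
    proof (rule series_deriv_t[OF ent[of "t / 2"]])
      show "0 < t / 2" "t \<in> {t / 2<..<T + 1}" using that by auto
      fix k s assume "s \<in> {t / 2<..<T + 1}"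
      with that show "(h k has_real_derivative h (k + 2) s - h (k + 3) s) (at s)" by (intro der) auto
    qed
    show "u z = series h 0 z" if "z \<in> UNIV \<times> {0<..<T}" for z
      using that by (auto simp: u_def)
  qed
  have "u \<in> L2_loc"
  proof -
    \<comment> \<open>The uniform semigroup bound on [0, \<epsilon>] controls the time slices of
      \<open>u\<close> down to t = 0, where the kernel bounds degenerate.\<close>
    obtain M where M: "M > 0" "\<And>t f. 0 \<le> t \<Longrightarrow> t \<le> \<epsilon> \<Longrightarrow> f \<in> L2 \<Longrightarrow> L2_norm (S t f) \<le> M * L2_norm f"
      by (rule locally_bounded[of \<epsilon>]) blast
    show ?thesis
    proof (rule L2_loc_of_strip_bound[where T=T and e=\<epsilon> and B="(M * L2_norm u0)\<^sup>2"])
      have "(\<lambda>z. indicator (UNIV \<times> {0<..<T + 1}) z *\<^sub>R series h 0 z) \<in> borel_measurable borel"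
        by (rule borel_measurable_continuous_on_indicator[OF _ contU]) (intro borel_open open_Times; simp)
      then have [measurable]: "(\<lambda>z. indicator (UNIV \<times> {0<..<T + 1}) z * series h 0 z) \<in> borel_measurable borel" by simp
      have [measurable]: "(snd :: real \<times> real \<Rightarrow> real) \<in> borel_measurable borel"
        by (intro borel_measurable_continuous_onI continuous_intros)
      have ueq: "u = (\<lambda>z. if 0 < snd z \<and> snd z \<le> T then indicator (UNIV \<times> {0<..<T + 1}) z * series h 0 z else 0)"
        by (auto simp: u_def fun_eq_iff)
      show "u \<in> borel_measurable borel" unfolding ueq by measurable
      show "u (x, t) = 0" if "t \<le> 0 \<or> T < t" for x t using that by (auto simp: u_def)
      have "continuous_on (UNIV \<times> {\<epsilon>..T}) (series h 0)"
        by (rule continuous_on_subset[OF contU]) (use assms in auto)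
      then show "continuous_on (UNIV \<times> {\<epsilon>..T}) u"
        by (rule continuous_on_eq) (use assms in \<open>auto simp: u_def\<close>)
      fix t :: real assume t: "0 < t" "t \<le> \<epsilon>"
      have tT: "t \<le> T" using t assms by linarith
      note v = val[OF hl[OF t(2)] u0 t(1)]
      have eq: "(\<lambda>x. u (x, t)) =\<^sub>a S t u0" unfolding ut[OF t(1) tT] by (rule S_series[OF hl[OF t(2)] u0 t(1)])
      have SL: "S t u0 \<in> L2" using t by (intro closed u0) simp
      have cm [measurable]: "(\<lambda>x. u (x, t)) \<in> borel_measurable borel"
        unfolding ut[OF t(1) tT] v
        by (intro borel_measurable_continuous_onI continuous_at_imp_continuous_on ballI DERIV_isCont[OF conv_deriv_x[OF u0 t(1)]])
      have "(\<integral>\<^sup>+ x. ennreal ((u (x, t))\<^sup>2) \<partial>lborel) = (\<integral>\<^sup>+ x. ennreal ((u (x, t))\<^sup>2) \<partial>lebesgue)"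
        by (simp add: nn_integral_completion)
      also have "\<dots> = (\<integral>\<^sup>+ x. ennreal ((S t u0 x)\<^sup>2) \<partial>lebesgue)"
      proof (rule nn_integral_cong_AE)
        show "AE x in lebesgue. ennreal ((u (x, t))\<^sup>2) = ennreal ((S t u0 x)\<^sup>2)"
          using eq unfolding eq_ae_def by eventually_elim simp
      qed
      also have "\<dots> = ennreal ((L2_norm (S t u0))\<^sup>2)"
        unfolding L2_norm_square by (rule nn_integral_eq_integral[OF L2_square_integrable[OF SL]]) simp
      also have "\<dots> \<le> ennreal ((M * L2_norm u0)\<^sup>2)"
        using M(2)[OF _ t(2) u0] t by (intro ennreal_leI power_mono) auto
      finally show "(\<integral>\<^sup>+ x. ennreal ((u (x, t))\<^sup>2) \<partial>lborel) \<le> ennreal ((M * L2_norm u0)\<^sup>2)" .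
    qed
  qed
  moreover have "S 0 u0 =\<^sub>a u0" by (rule at_0[OF u0])
  moreover have "S T uT =\<^sub>a S T uT" by (simp add: eq_ae_def)
  ultimately show ?thesis using rep0 repT sol by blast
qed

end
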